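(* Let $\varphi_1,\varphi_2\in L^2(\mathbb{R}^d)$ and consider the map $\mathcal{A}:L^\infty(\mathbb{R}^{2d})\to B(L^2(\mathbb{R}^d))$, $\mathcal{A}a=A_a^{\varphi_1,\varphi_2}$. If $V_{\varphi_1}\varphi_2(z)\neq0$ for almost all $z\in\mathbb{R}^{2d}$, then the range of $\mathcal{A}$ is weak*-dense in $B(L^2(\mathbb{R}^d))$.
   Context: For $z=(x,\xi)\in\mathbb{R}^{2d}$ the time-frequency shift is $\pi(z)f(t)=e^{2\pi i\xi\cdot t}f(t-x)$. The short-time Fourier transform is $V_gf(z)=\langle f,\pi(z)g\rangle$ (inner product of $L^2(\mathbb{R}^d)$, linear in the first argument). For windows $\varphi_1,\varphi_2\in L^2(\mathbb{R}^d)$ and a symbol $a\in L^\infty(\mathbb{R}^{2d})$, the localization operator $A_a^{\varphi_1,\varphi_2}\in B(L^2(\mathbb{R}^d))$ is defined weakly by $\langle A_a^{\varphi_1,\varphi_2}f,g\rangle=\int_{\mathbb{R}^{2d}}a(z)\,V_{\varphi_1}f(z)\,\overline{V_{\varphi_2}g(z)}\,dz$. The weak* topology on $B(L^2(\mathbb{R}^d))$ is the one coming from its identification (via the trace pairing) with the dual of the trace class $\mathscr{S}^1$. *)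

theory Defs
  imports "HOL-Analysis.Analysis"
begin

section \<open>The Hilbert space of square-integrable functions on \<open>\<real>\<^sup>d\<close>\<close>

definition square_integrable :: "(real ^ 'd \<Rightarrow> complex) \<Rightarrow> bool" where
  "square_integrable f \<longleftrightarrow>
     f \<in> borel_measurable lborel \<and> integrable lborel (\<lambda>t. (cmod (f t))\<^sup>2)"

lemma square_integrable_zero: "square_integrable (\<lambda>_. 0)"
  by (simp add: square_integrable_def)

lemma square_integrable_add:
  assumes "square_integrable f" "square_integrable g"
  shows "square_integrable (\<lambda>t. f t + g t)"
proof -
  have [measurable]: "f \<in> borel_measurable lborel" "g \<in> borel_measurable lborel"
    using assms by (auto simp: square_integrable_def)
  have "integrable lborel (\<lambda>t. 2 * (cmod (f t))\<^sup>2 + 2 * (cmod (g t))\<^sup>2)"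
    using assms by (auto simp: square_integrable_def)
  moreover have "(cmod (f t + g t))\<^sup>2 \<le> 2 * (cmod (f t))\<^sup>2 + 2 * (cmod (g t))\<^sup>2" for t
  proof -
    have "(cmod (f t + g t))\<^sup>2 \<le> (cmod (f t) + cmod (g t))\<^sup>2"
      by (intro power_mono norm_triangle_ineq) auto
    also have "\<dots> \<le> 2 * (cmod (f t))\<^sup>2 + 2 * (cmod (g t))\<^sup>2"
      using sum_squares_bound[of "cmod (f t)" "cmod (g t)"] by (simp add: power2_sum)
    finally show ?thesis .
  qed
  ultimately have "integrable lborel (\<lambda>t. (cmod (f t + g t))\<^sup>2)"
    by (elim Bochner_Integration.integrable_bound) auto
  then show ?thesis
    by (simp add: square_integrable_def)
qed

lemma square_integrable_mult:
  assumes "square_integrable f"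
  shows "square_integrable (\<lambda>t. c * f t)"
  using assms by (auto simp: square_integrable_def norm_mult power_mult_distrib)

lemma borel_measurable_cnj [measurable]: "cnj \<in> borel_measurable borel"
  by (intro borel_measurable_continuous_onI continuous_intros)

lemma integrable_mult_cnj:
  assumes "square_integrable f" "square_integrable g"
  shows "integrable lborel (\<lambda>t. f t * cnj (g t))"
proof -
  have [measurable]: "f \<in> borel_measurable lborel" "g \<in> borel_measurable lborel"
    using assms by (auto simp: square_integrable_def)
  have "integrable lborel (\<lambda>t. (cmod (f t))\<^sup>2 + (cmod (g t))\<^sup>2)"
    using assms by (auto simp: square_integrable_def)
  moreover have "cmod (f t * cnj (g t)) \<le> (cmod (f t))\<^sup>2 + (cmod (g t))\<^sup>2" for t
  proof -
    have "0 \<le> cmod (f t) * cmod (g t)"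
      by simp
    with sum_squares_bound[of "cmod (f t)" "cmod (g t)"]
    have "cmod (f t) * cmod (g t) \<le> (cmod (f t))\<^sup>2 + (cmod (g t))\<^sup>2"
      by linarith
    then show ?thesis
      by (simp add: norm_mult)
  qed
  ultimately show ?thesis
    by (elim Bochner_Integration.integrable_bound) auto
qed

definition ae_rel :: "(real ^ 'd \<Rightarrow> complex) \<Rightarrow> (real ^ 'd \<Rightarrow> complex) \<Rightarrow> bool" where
  "ae_rel f g \<longleftrightarrow>
     square_integrable f \<and> square_integrable g \<and> (AE t in lborel. f t = g t)"

lemma ae_rel_trans: "ae_rel f g \<Longrightarrow> ae_rel g h \<Longrightarrow> ae_rel f h"
  by (auto simp: ae_rel_def elim: eventually_elim2)

quotient_type 'd L2 = "real ^ 'd \<Rightarrow> complex" / partial: ae_rel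
proof (rule part_equivpI)
  show "\<exists>f. ae_rel f f"
    using square_integrable_zero by (auto simp: ae_rel_def)
  show "symp ae_rel"
    by (auto simp: symp_def ae_rel_def elim!: eventually_mono)
  show "transp ae_rel"
    by (auto simp: transp_def intro: ae_rel_trans)
qed

lift_definition cscale :: "complex \<Rightarrow> 'd::finite L2 \<Rightarrow> 'd L2"  (infixr \<open>*\<^sub>C\<close> 75)
  is "\<lambda>c f t. c * f t"
  by (auto simp: ae_rel_def intro: square_integrable_mult elim!: eventually_mono)

lift_definition cinner :: "'d::finite L2 \<Rightarrow> 'd L2 \<Rightarrow> complex"
  is "\<lambda>f g. \<integral>t. f t * cnj (g t) \<partial>lborel"
proof -
  fix f f' g g' :: "real ^ 'd \<Rightarrow> complex"
  assume *: "ae_rel f f'" "ae_rel g g'"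
  have meas [measurable]: "f \<in> borel_measurable lborel" "f' \<in> borel_measurable lborel"
      "g \<in> borel_measurable lborel" "g' \<in> borel_measurable lborel"
    using * by (auto simp: ae_rel_def square_integrable_def)
  have "AE t in lborel. f t = f' t" "AE t in lborel. g t = g' t"
    using * by (auto simp: ae_rel_def)
  then have "AE t in lborel. f t * cnj (g t) = f' t * cnj (g' t)"
    by eventually_elim auto
  then show "(\<integral>t. f t * cnj (g t) \<partial>lborel) = (\<integral>t. f' t * cnj (g' t) \<partial>lborel)"
    by (intro integral_cong_AE) auto
qed

instantiation L2 :: (finite) real_vector
begin

lift_definition zero_L2 :: "'a L2" is "\<lambda>_. 0"
  by (simp add: ae_rel_def square_integrable_zero)

lift_definition plus_L2 :: "'a L2 \<Rightarrow> 'a L2 \<Rightarrow> 'a L2" is "\<lambda>f g t. f t + g t"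
  by (auto simp: ae_rel_def intro: square_integrable_add elim: eventually_elim2)

definition uminus_L2 :: "'a L2 \<Rightarrow> 'a L2" where "- f = (-1) *\<^sub>C f"

definition minus_L2 :: "'a L2 \<Rightarrow> 'a L2 \<Rightarrow> 'a L2" where "f - g = f + (-1) *\<^sub>C g"

definition scaleR_L2 :: "real \<Rightarrow> 'a L2 \<Rightarrow> 'a L2" where "r *\<^sub>R f = complex_of_real r *\<^sub>C f"

instance
proof
  fix f g h :: "'a L2" and r s :: real
  show "f + g + h = f + (g + h)"
    by transfer (auto simp: ae_rel_def add.assoc intro!: square_integrable_add)
  show "f + g = g + f"
    by transfer (auto simp: ae_rel_def add.commute intro!: square_integrable_add)
  show "0 + f = f"
    by transfer (auto simp: ae_rel_def)
  show "- f + f = 0"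
    unfolding uminus_L2_def
    by transfer (auto simp: ae_rel_def square_integrable_zero)
  show "f - g = f + - g"
    by (simp add: uminus_L2_def minus_L2_def)
  show "r *\<^sub>R (f + g) = r *\<^sub>R f + r *\<^sub>R g"
    unfolding scaleR_L2_def
    by transfer (auto simp: ae_rel_def distrib_left
        intro!: square_integrable_add square_integrable_mult)
  show "(r + s) *\<^sub>R f = r *\<^sub>R f + s *\<^sub>R f"
    unfolding scaleR_L2_def
    by transfer (auto simp: ae_rel_def distrib_right
        intro!: square_integrable_add square_integrable_mult)
  show "r *\<^sub>R s *\<^sub>R f = (r * s) *\<^sub>R f"
    unfolding scaleR_L2_def
    by transfer (auto simp: ae_rel_def mult.assoc intro!: square_integrable_mult)
  show "1 *\<^sub>R f = f"
    unfolding scaleR_L2_def by transfer (auto simp: ae_rel_def)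
qed

end

lemma cinner_commute: "cinner f g = cnj (cinner g f)"
proof transfer
  fix f g :: "real ^ 'a \<Rightarrow> complex"
  have "cnj (\<integral>t. g t * cnj (f t) \<partial>lborel) = (\<integral>t. cnj (g t * cnj (f t)) \<partial>lborel)"
    by (simp only: Bochner_Integration.integral_cnj)
  then show "(\<integral>t. f t * cnj (g t) \<partial>lborel) = cnj (\<integral>t. g t * cnj (f t) \<partial>lborel)"
    by (simp add: mult.commute)
qed

lemma cinner_add_left: "cinner (f + g) h = cinner f h + cinner g h"
  by transfer
    (auto simp: distrib_right ae_rel_def intro!: Bochner_Integration.integral_add integrable_mult_cnj)

lemma cinner_cscale_left: "cinner (c *\<^sub>C f) g = c * cinner f g"
  by transfer (simp add: mult.assoc)

lemma integral_mult_cnj_self: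
  "(\<integral>t. u t * cnj (u t) \<partial>lborel) = complex_of_real (\<integral>t. (cmod (u t))\<^sup>2 \<partial>lborel)"
  for u :: "real ^ 'd \<Rightarrow> complex"
  by (simp only: complex_norm_square[symmetric] integral_complex_of_real)

lemma Re_cinner_self_nonneg: "0 \<le> Re (cinner f f)"
  by transfer (simp add: integral_mult_cnj_self)

lemma Re_cinner_self_eq_0_iff: "Re (cinner f f) = 0 \<longleftrightarrow> f = 0"
proof transfer
  fix u :: "real ^ 'a \<Rightarrow> complex"
  assume "ae_rel u u"
  then have u: "square_integrable u" by (simp add: ae_rel_def)
  then have "(\<integral>t. (cmod (u t))\<^sup>2 \<partial>lborel) = 0 \<longleftrightarrow> (AE t in lborel. (cmod (u t))\<^sup>2 = 0)"
    by (intro integral_nonneg_eq_0_iff_AE) (auto simp: square_integrable_def)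
  with u show "Re (\<integral>t. u t * cnj (u t) \<partial>lborel) = 0 \<longleftrightarrow> ae_rel u (\<lambda>_. 0)"
    by (simp add: integral_mult_cnj_self ae_rel_def square_integrable_zero)
qed

instantiation L2 :: (finite) real_inner
begin

definition inner_L2 :: "'a L2 \<Rightarrow> 'a L2 \<Rightarrow> real" where "inner_L2 f g = Re (cinner f g)"

definition norm_L2 :: "'a L2 \<Rightarrow> real" where "norm_L2 f = sqrt (Re (cinner f f))"

definition dist_L2 :: "'a L2 \<Rightarrow> 'a L2 \<Rightarrow> real" where "dist_L2 f g = norm (f - g)"

definition sgn_L2 :: "'a L2 \<Rightarrow> 'a L2" where "sgn_L2 f = f /\<^sub>R norm f"

definition uniformity_L2 :: "('a L2 \<times> 'a L2) filter" where
  "uniformity_L2 = (INF e\<in>{0 <..}. principal {(f, g). dist f g < e})"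

definition open_L2 :: "'a L2 set \<Rightarrow> bool" where
  "open_L2 U \<longleftrightarrow> (\<forall>f\<in>U. \<forall>\<^sub>F (f', g) in uniformity. f' = f \<longrightarrow> g \<in> U)"

instance
proof
  fix f g h :: "'a L2" and r :: real
  show "dist f g = norm (f - g)"
    by (simp add: dist_L2_def)
  show "sgn f = f /\<^sub>R norm f"
    by (simp add: sgn_L2_def)
  show "uniformity = (INF e\<in>{0 <..}. principal {(f, g :: 'a L2). dist f g < e})"
    by (simp add: uniformity_L2_def)
  show "open U \<longleftrightarrow> (\<forall>f\<in>U. \<forall>\<^sub>F (f', g) in uniformity. f' = f \<longrightarrow> g \<in> U)" for U :: "'a L2 set"
    by (simp add: open_L2_def)
  show "f \<bullet> g = g \<bullet> f"
    using cinner_commute[of f g] by (simp add: inner_L2_def)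
  show "(f + g) \<bullet> h = f \<bullet> h + g \<bullet> h"
    by (simp add: inner_L2_def cinner_add_left)
  show "r *\<^sub>R f \<bullet> g = r * (f \<bullet> g)"
    by (simp add: inner_L2_def scaleR_L2_def cinner_cscale_left)
  show "0 \<le> f \<bullet> f"
    by (simp add: inner_L2_def Re_cinner_self_nonneg)
  show "f \<bullet> f = 0 \<longleftrightarrow> f = 0"
    by (simp add: inner_L2_def Re_cinner_self_eq_0_iff)
  show "norm f = sqrt (f \<bullet> f)"
    by (simp add: norm_L2_def inner_L2_def)
qed

end

section \<open>Time-frequency shifts and the short-time Fourier transform\<close>

lemma square_integrable_tf_shift:
  assumes "square_integrable f"
  shows "square_integrable (\<lambda>t. cis (2 * pi * (\<xi> \<bullet> t)) * f (t - x))"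
proof -
  have [measurable]: "f \<in> borel_measurable borel"
    using assms by (simp add: square_integrable_def)
  have "integrable (distr lborel borel ((+) (- x))) (\<lambda>t. (cmod (f t))\<^sup>2)"
    using assms by (simp add: lborel_distr_plus square_integrable_def)
  then have "integrable lborel (\<lambda>t. (cmod (f (t - x)))\<^sup>2)"
    by (subst (asm) integrable_distr_eq) (auto simp: algebra_simps)
  moreover have "(\<lambda>t. cis (2 * pi * (\<xi> \<bullet> t))) \<in> borel_measurable borel"
    by (intro borel_measurable_continuous_onI continuous_intros)
  ultimately show ?thesis
    by (simp add: square_integrable_def norm_mult)
qed

lift_definition tf_shift :: "(real ^ 'd) \<times> (real ^ 'd) \<Rightarrow> 'd::finite L2 \<Rightarrow> 'd L2"
  is "\<lambda>(x, \<xi>) f t. cis (2 * pi * (\<xi> \<bullet> t)) * f (t - x)"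
proof clarify
  fix x \<xi> :: "real ^ 'd" and f g :: "real ^ 'd \<Rightarrow> complex"
  assume *: "ae_rel f g"
  then have [measurable]: "f \<in> borel_measurable borel" "g \<in> borel_measurable borel"
    by (auto simp: ae_rel_def square_integrable_def)
  have "AE t in distr lborel borel ((+) (- x)). f t = g t"
    unfolding lborel_distr_plus using * by (simp add: ae_rel_def)
  then have "AE t in lborel. f (t - x) = g (t - x)"
    by (subst (asm) AE_distr_iff) (auto simp: algebra_simps)
  with * show "ae_rel (\<lambda>t. cis (2 * pi * (\<xi> \<bullet> t)) * f (t - x))
                      (\<lambda>t. cis (2 * pi * (\<xi> \<bullet> t)) * g (t - x))"
    by (auto simp: ae_rel_def intro: square_integrable_tf_shift)
qed

definition stft :: "'d::finite L2 \<Rightarrow> 'd L2 \<Rightarrow> (real ^ 'd) \<times> (real ^ 'd) \<Rightarrow> complex" where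
  "stft g f z = cinner f (tf_shift z g)"

section \<open>Bounded operators, trace class, weak* topology\<close>

text \<open>\<open>\<Rightarrow>\<^sub>L\<close> is the library's space of bounded real-linear maps; \<open>B(L\<^sup>2)\<close> consists of the
  complex-linear ones.\<close>

definition bounded_ops :: "('d::finite L2 \<Rightarrow>\<^sub>L 'd L2) set" where
  "bounded_ops = {T. \<forall>c f. blinfun_apply T (c *\<^sub>C f) = c *\<^sub>C blinfun_apply T f}"

text \<open>The real span of all complex multiples of elements of \<open>E\<close> is the complex span of \<open>E\<close>.\<close>

definition is_onb :: "'d::finite L2 set \<Rightarrow> bool" where
  "is_onb E \<longleftrightarrow>
     (\<forall>e\<in>E. \<forall>e'\<in>E. cinner e e' = (if e = e' then 1 else 0)) \<and>
     closure (span {c *\<^sub>C e |c e. e \<in> E}) = UNIV"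

text \<open>\<open>is_abs_op T P\<close>: \<open>P = |T|\<close>, the positive square root of \<open>T\<^sup>* T\<close>. The identity
  \<open>P\<^sup>2 = T\<^sup>* T\<close> is written with the defining property of the adjoint.\<close>

definition is_abs_op :: "('d::finite L2 \<Rightarrow>\<^sub>L 'd L2) \<Rightarrow> ('d L2 \<Rightarrow>\<^sub>L 'd L2) \<Rightarrow> bool" where
  "is_abs_op T P \<longleftrightarrow>
     P \<in> bounded_ops \<and>
     (\<forall>f. cinner (blinfun_apply P f) f \<in> \<real>\<^sub>\<ge>\<^sub>0) \<and>
     (\<forall>f g. cinner (blinfun_apply P (blinfun_apply P f)) g =
            cinner (blinfun_apply T f) (blinfun_apply T g))"

text \<open>Trace-class operators: \<open>\<Sum>\<^sub>e \<langle>|T| e, e\<rangle> < \<infinity>\<close> for some (equivalently, every) orthonormal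
  basis.\<close>

definition trace_class :: "('d::finite L2 \<Rightarrow>\<^sub>L 'd L2) set" where
  "trace_class = {T \<in> bounded_ops. \<exists>P E. is_abs_op T P \<and> is_onb E \<and>
     (\<lambda>e. cinner (blinfun_apply P e) e) summable_on E}"

text \<open>For trace-class operators the value does not depend on the chosen orthonormal basis.\<close>

definition op_trace :: "('d::finite L2 \<Rightarrow>\<^sub>L 'd L2) \<Rightarrow> complex" where
  "op_trace T = (\<Sum>\<^sub>\<infinity>e\<in>(SOME E. is_onb E). cinner (blinfun_apply T e) e)"

text \<open>The weak* topology of \<open>B(L\<^sup>2)\<close> as the dual of the trace class: the coarsest topology for
  which \<open>T \<mapsto> tr (T S)\<close> is continuous for every trace-class \<open>S\<close>.\<close>

definition weak_star_topology :: "('d::finite L2 \<Rightarrow>\<^sub>L 'd L2) topology" where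
  "weak_star_topology = topology_generated_by
     {{T \<in> bounded_ops. op_trace (T o\<^sub>L S) \<in> U} |S U. S \<in> trace_class \<and> open U}"

section \<open>Localization operators\<close>

text \<open>Representatives of the elements of \<open>L\<^sup>\<infinity>(\<real>\<^sup>2\<^sup>d)\<close>.\<close>

definition Linfty :: "((real ^ 'd) \<times> (real ^ 'd) \<Rightarrow> complex) set" where
  "Linfty = {a \<in> borel_measurable lborel. \<exists>C. AE z in lborel. cmod (a z) \<le> C}"

text \<open>The sesquilinear form on the right is bounded, so by the Riesz representation theorem it
  determines exactly one bounded operator.\<close>

definition loc_op ::
  "'d::finite L2 \<Rightarrow> 'd L2 \<Rightarrow> ((real ^ 'd) \<times> (real ^ 'd) \<Rightarrow> complex) \<Rightarrow> 'd L2 \<Rightarrow>\<^sub>L 'd L2" where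
  "loc_op \<phi>\<^sub>1 \<phi>\<^sub>2 a = (THE A. A \<in> bounded_ops \<and>
     (\<forall>f g. cinner (blinfun_apply A f) g =
            (\<integral>z. a z * stft \<phi>\<^sub>1 f z * cnj (stft \<phi>\<^sub>2 g z) \<partial>lborel)))"

end

theory Submission
  imports Defs "HOL-Probability.Characteristic_Functions"
begin

text \<open>
  Write \<open>\<pi>(w)\<close> for the time-frequency shift by \<open>w = (y, \<eta>)\<close>. Everything rests on the
  orthogonality relations
  \<open>\<integral> V\<^sub>g f(z) \<cdot> cnj (V\<^sub>h k(z)) dz = \<langle>f, k\<rangle> \<cdot> cnj \<langle>g, h\<rangle>\<close> (\<open>stft_orthogonality\<close>),
  which are used in two ways.

  First, they show that the range contains almost every time-frequency shift. If the symbol is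
  the character \<open>z = (x, \<xi>) \<mapsto> exp (2 \<pi> i (\<eta> \<bullet> x - \<xi> \<bullet> y))\<close>, then multiplying
  \<open>V\<^sub>\<phi>\<^sub>1 f\<close> by it has the same effect as shifting both \<open>\<phi>\<^sub>1\<close> and \<open>f\<close> by \<open>w\<close>, and the
  orthogonality relations evaluate the quadratic form of the localization operator: the operator
  is \<open>V\<^sub>\<phi>\<^sub>1 \<phi>\<^sub>2(w) \<cdot> \<pi>(w)\<close>. As the scalar vanishes only on a null set, \<open>\<pi>(w)\<close> lies in the
  range for almost all \<open>w\<close> (\<open>tf_op_in_loc_range\<close>).

  Second, they invert the map that sends a trace-class operator \<open>S\<close> to the function
  \<open>w \<mapsto> tr (\<pi>(w) S)\<close>: integrating this function against \<open>V\<^sub>f g\<close> returns \<open>\<langle>S g, f\<rangle>\<close>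
  (\<open>fourier_wigner_inversion\<close>). For rank-one \<open>S\<close> this is the orthogonality relation itself, and
  the general case follows by summing an expansion \<open>S = \<Sum>\<^sub>n \<langle>\<cdot>, u\<^sub>n\<rangle> v\<^sub>n\<close> with
  \<open>\<Sum>\<^sub>n \<parallel>u\<^sub>n\<parallel> \<parallel>v\<^sub>n\<parallel> < \<infinity>\<close> (\<open>trace_class_nuclear\<close>). Consequently a finite linear combination of
  trace-class operators whose pairings with almost all \<open>\<pi>(w)\<close> vanish is zero, hence pairs to zero
  with every bounded operator.

  A weak* neighbourhood of \<open>T\<close> constrains only finitely many numbers \<open>tr (T S)\<close>. By elementary
  linear algebra (\<open>finite_interpolation\<close>) the last statement says that some operator in the
  range attains exactly the same finitely many values, so the neighbourhood meets the range.

  The orthogonality relations come from Plancherel's theorem in the frequency variable, which is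
  proved by Gaussian summation: the Gaussian means of the energy \<open>\<bar>F^(\<xi>)\<bar>\<^sup>2\<close> are
  averages of the autocorrelation of \<open>F\<close> near the origin, and the autocorrelation is continuous
  there because translations act continuously on \<open>L\<^sup>2\<close>. That continuity and the existence of
  an orthonormal basis both follow from the totality of the indicators of open sets.
\<close>

section \<open>The complex inner product space of square-integrable functions\<close>

lemma cscale_add_right: "c *\<^sub>C (f + g) = c *\<^sub>C f + c *\<^sub>C (g :: 'd::finite L2)"
  by transfer (auto simp: ae_rel_def distrib_left
        intro!: square_integrable_add square_integrable_mult)

lemma cscale_add_left: "(c + c') *\<^sub>C f = c *\<^sub>C f + c' *\<^sub>C (f :: 'd::finite L2)"
  by transfer (auto simp: ae_rel_def distrib_right
        intro!: square_integrable_add square_integrable_mult)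

lemma cscale_cscale: "c *\<^sub>C c' *\<^sub>C f = (c * c') *\<^sub>C (f :: 'd::finite L2)"
  by transfer (auto simp: ae_rel_def mult.assoc intro!: square_integrable_mult)

lemma cscale_1 [simp]: "1 *\<^sub>C f = (f :: 'd::finite L2)"
  by transfer (auto simp: ae_rel_def)

lemma cscale_0 [simp]: "0 *\<^sub>C f = (0 :: 'd::finite L2)"
  by transfer (auto simp: ae_rel_def square_integrable_zero)

lemma cscale_0_right [simp]: "c *\<^sub>C (0 :: 'd::finite L2) = 0"
  by transfer (auto simp: ae_rel_def square_integrable_zero)

lemma cscale_scaleR: "c *\<^sub>C (r *\<^sub>R f) = r *\<^sub>R (c *\<^sub>C (f :: 'd::finite L2))"
  by (simp add: scaleR_L2_def cscale_cscale mult.commute)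

lemma cscale_minus_right: "c *\<^sub>C (f - g) = c *\<^sub>C f - c *\<^sub>C (g :: 'd::finite L2)"
  unfolding minus_L2_def cscale_add_right cscale_cscale by (simp add: mult.commute)

lemma cscale_sum_right: "c *\<^sub>C (\<Sum>i\<in>I. f i) = (\<Sum>i\<in>I. c *\<^sub>C (f i :: 'd::finite L2))"
  by (induction I rule: infinite_finite_induct) (auto simp: cscale_add_right)

lemma cinner_add_right: "cinner f (g + h) = cinner f g + cinner f h"
  by (metis cinner_add_left cinner_commute complex_cnj_add)

lemma cinner_cscale_right: "cinner f (c *\<^sub>C g) = cnj c * cinner f g"
  by (metis cinner_cscale_left cinner_commute complex_cnj_mult)

lemma cinner_minus_left: "cinner (f - g) h = cinner f h - cinner g h"
  by (simp add: minus_L2_def cinner_add_left cinner_cscale_left)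

lemma cinner_zero_left [simp]: "cinner 0 g = 0"
  using cinner_cscale_left[of 0 0 g] by simp

lemma cinner_zero_right [simp]: "cinner g 0 = 0"
  using cinner_cscale_right[of g 0 0] by simp

lemma cinner_sum_left: "cinner (\<Sum>i\<in>I. f i) g = (\<Sum>i\<in>I. cinner (f i) g)"
  by (induction I rule: infinite_finite_induct) (auto simp: cinner_add_left)

lemma cinner_self: "cinner f f = complex_of_real ((norm f)\<^sup>2)"
proof -
  have "Im (cinner f f) = 0"
    using cinner_commute[of f f] by (metis complex_cnj_cancel_iff Reals_cnj_iff complex_is_Real_iff)
  moreover have "Re (cinner f f) = (norm f)\<^sup>2"
    by (simp add: power2_norm_eq_inner inner_L2_def)
  ultimately show ?thesis by (simp add: complex_eq_iff)
qed

lemma cinner_eqI: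
  assumes "\<And>h. cinner f h = cinner g h"
  shows "f = g"
proof -
  have "cinner (f - g) (f - g) = 0"
    using assms by (simp add: cinner_minus_left)
  then show ?thesis by (simp add: cinner_self)
qed

lemma norm_cscale: "norm (c *\<^sub>C f) = cmod c * norm (f :: 'd::finite L2)"
proof -
  have "complex_of_real ((norm (c *\<^sub>C f))\<^sup>2) = complex_of_real ((cmod c * norm f)\<^sup>2)"
  proof -
    have "complex_of_real ((norm (c *\<^sub>C f))\<^sup>2) = (c * cnj c) * cinner f f"
      by (simp add: cinner_self[symmetric] cinner_cscale_left cinner_cscale_right del: of_real_power)
    also have "\<dots> = complex_of_real ((cmod c * norm f)\<^sup>2)"
      by (simp only: cinner_self complex_norm_square[symmetric] power_mult_distrib of_real_mult)
    finally show ?thesis .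
  qed
  then show ?thesis
    by (metis of_real_eq_iff norm_ge_zero power2_eq_imp_eq mult_nonneg_nonneg)
qed

lemma bounded_linear_cscale: "bounded_linear (\<lambda>f :: 'd::finite L2. c *\<^sub>C f)"
  by (rule bounded_linear_intro[where K = "cmod c"])
     (auto simp: cscale_add_right cscale_scaleR norm_cscale mult.commute)

text \<open>Polarization: the diagonal at \<open>f + g\<close> gives \<open>D f g + D g f = 0\<close>, and at \<open>f + i g\<close> it gives
  \<open>D g f = D f g\<close>.\<close>

lemma sesquilinear_eq_0I:
  fixes D :: "'d::finite L2 \<Rightarrow> 'd L2 \<Rightarrow> complex"
  assumes add_left: "\<And>f g h. D (f + g) h = D f h + D g h"
    and add_right: "\<And>f g h. D h (f + g) = D h f + D h g"
    and scale_left: "\<And>c f g. D (c *\<^sub>C f) g = c * D f g"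
    and scale_right: "\<And>c f g. D f (c *\<^sub>C g) = cnj c * D f g"
    and diag: "\<And>f. D f f = 0"
  shows "D f g = 0"
proof -
  have "D (f + g) (f + g) = D f g + D g f"
    unfolding add_left add_right by (simp add: diag)
  then have 1: "D f g + D g f = 0"
    using diag[of "f + g"] by simp
  have "D (f + \<i> *\<^sub>C g) (f + \<i> *\<^sub>C g) = - \<i> * D f g + \<i> * D g f"
    unfolding add_left add_right scale_left scale_right by (simp add: diag)
  then have "\<i> * (D g f - D f g) = 0"
    using diag[of "f + \<i> *\<^sub>C g"] by (simp add: algebra_simps)
  with 1 show ?thesis by simp
qed

section \<open>Positive forms and orthonormal expansions\<close>

text \<open>Bounded positive forms occur below in two roles: the inner product itself, for orthonormal
  bases, and \<open>\<langle>\<bar>S\<bar> f, g\<rangle>\<close> for a trace-class operator \<open>S\<close>. Bessel's inequality, expansions and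
  the Gram--Schmidt process are therefore developed for a form that may be degenerate.\<close>

locale positive_form =
  fixes B :: "'d::finite L2 \<Rightarrow> 'd L2 \<Rightarrow> complex" and K :: real
  assumes add_left: "B (f + g) h = B f h + B g h"
    and scale_left: "B (c *\<^sub>C f) g = c * B f g"
    and hermitian: "B f g = cnj (B g f)"
    and nonneg: "0 \<le> Re (B f f)"
    and bounded: "Re (B f f) \<le> K * (norm f)\<^sup>2"
begin

abbreviation q where "q f \<equiv> Re (B f f)"

lemma add_right: "B h (f + g) = B h f + B h g"
  by (metis add_left hermitian complex_cnj_add)

lemma scale_right: "B f (c *\<^sub>C g) = cnj c * B f g"
  by (metis scale_left hermitian complex_cnj_mult)

lemma diff_left: "B (f - g) h = B f h - B g h"
  by (simp add: minus_L2_def add_left scale_left)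

lemma diff_right: "B h (f - g) = B h f - B h g"
  by (simp add: minus_L2_def add_right scale_right)

lemma zero_left [simp]: "B 0 g = 0"
  using scale_left[of 0 0 g] by simp

lemma zero_right [simp]: "B g 0 = 0"
  using scale_right[of g 0 0] by simp

lemma sum_left: "B (\<Sum>i\<in>I. f i) g = (\<Sum>i\<in>I. B (f i) g)"
  by (induction I rule: infinite_finite_induct) (auto simp: add_left)

lemma diag: "B f f = complex_of_real (q f)"
proof -
  have "Im (B f f) = 0"
    using hermitian[of f f] by (metis Reals_cnj_iff complex_is_Real_iff)
  then show ?thesis by (simp add: complex_eq_iff)
qed

lemma q_scale: "q (c *\<^sub>C f) = (cmod c)\<^sup>2 * q f"
proof -
  have "B (c *\<^sub>C f) (c *\<^sub>C f) = complex_of_real ((cmod c)\<^sup>2) * B f f"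
    unfolding scale_left scale_right complex_norm_square by simp
  then show ?thesis by simp
qed

lemma q_add_le: "q (f + g) \<le> 2 * q f + 2 * q g"
proof -
  have "q (f + g) + q (f - g) = 2 * q f + 2 * q g"
    by (simp add: add_left add_right diff_left diff_right)
  then show ?thesis using nonneg[of "f - g"] by linarith
qed

lemma Cauchy_Schwarz: "(cmod (B f g))\<^sup>2 \<le> q f * q g"
proof -
  define b where "b = B f g"
  define \<beta> where "\<beta> = (cmod b)\<^sup>2"
  \<comment> \<open>Positivity at f - t b g; the best choice is t = 1 / q g, and for q g = 0 a large t.\<close>
  have *: "0 \<le> q f - 2 * t * \<beta> + t\<^sup>2 * \<beta> * q g" for t :: real
  proof -
    define c where "c = complex_of_real t * b"
    have "B (f - c *\<^sub>C g) (f - c *\<^sub>C g) =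
        B f f - cnj c * b - c * cnj b + (c * cnj c) * B g g"
      unfolding b_def using hermitian[of g f]
      by (simp add: diff_left diff_right scale_left scale_right algebra_simps)
    also have "\<dots> = complex_of_real (q f - 2 * t * \<beta> + t\<^sup>2 * \<beta> * q g)"
    proof -
      define qf qg where "qf = q f" and "qg = q g"
      have ff: "B f f = complex_of_real qf" and gg: "B g g = complex_of_real qg"
        unfolding qf_def qg_def by (rule diag)+
      have b: "b * cnj b = complex_of_real \<beta>" "cnj b * b = complex_of_real \<beta>"
        by (simp_all only: \<beta>_def complex_norm_square mult.commute)
      have c: "cnj c * b = complex_of_real (t * \<beta>)" "c * cnj b = complex_of_real (t * \<beta>)"
        "c * cnj c = complex_of_real (t\<^sup>2 * \<beta>)"
        unfolding c_def using b by (simp_all add: power2_eq_square mult.assoc mult.left_commute)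
      show ?thesis
        unfolding ff gg c by simp
    qed
    finally show ?thesis using nonneg[of "f - c *\<^sub>C g"] by simp
  qed
  show ?thesis
  proof (cases "q g = 0")
    case True
    have "\<beta> = 0"
    proof (rule ccontr)
      assume "\<beta> \<noteq> 0"
      then have "2 * ((q f + 1) / (2 * \<beta>)) * \<beta> = q f + 1" by simp
      with *[of "(q f + 1) / (2 * \<beta>)"] True show False by simp
    qed
    then show ?thesis using True by (simp add: \<beta>_def b_def)
  next
    case False
    then have pos: "q g > 0" using nonneg[of g] by simp
    have "0 \<le> q f - \<beta> / q g"
      using *[of "1 / q g"] pos by (simp add: power2_eq_square field_simps)
    then show ?thesis using pos by (simp add: field_simps \<beta>_def b_def)
  qed
qed

lemma q_eq_0D: "q f = 0 \<Longrightarrow> B f g = 0"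
  using Cauchy_Schwarz[of f g] by simp

definition residual :: "('i \<Rightarrow> 'd L2) \<Rightarrow> 'i set \<Rightarrow> 'd L2 \<Rightarrow> 'd L2" where
  "residual \<phi> F x = x - (\<Sum>i\<in>F. B x (\<phi> i) *\<^sub>C \<phi> i)"

lemma residual_add: "residual \<phi> F (x + y) = residual \<phi> F x + residual \<phi> F y"
  by (simp add: residual_def add_left cscale_add_left sum.distrib)

lemma residual_cscale: "residual \<phi> F (c *\<^sub>C x) = c *\<^sub>C residual \<phi> F x"
  by (simp add: residual_def scale_left cscale_minus_right cscale_sum_right cscale_cscale)

text \<open>Zero vectors are tolerated because the Gram--Schmidt process produces one
  whenever an input vector depends on its predecessors.\<close>

definition orthonormal_or_zero :: "('i \<Rightarrow> 'd L2) \<Rightarrow> 'i set \<Rightarrow> bool" where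
  "orthonormal_or_zero \<phi> I \<longleftrightarrow>
     (\<forall>i\<in>I. \<forall>j\<in>I. i \<noteq> j \<longrightarrow> B (\<phi> i) (\<phi> j) = 0) \<and>
     (\<forall>i\<in>I. \<phi> i = 0 \<or> B (\<phi> i) (\<phi> i) = 1)"

lemma residual_orthogonal:
  assumes "orthonormal_or_zero \<phi> I" "finite F" "F \<subseteq> I" "j \<in> F"
  shows "B (residual \<phi> F x) (\<phi> j) = 0"
proof -
  have "(\<Sum>i\<in>F. B x (\<phi> i) * B (\<phi> i) (\<phi> j)) = (\<Sum>i\<in>F. if i = j then B x (\<phi> j) else 0)"
  proof (intro sum.cong refl)
    fix i assume "i \<in> F"
    then show "B x (\<phi> i) * B (\<phi> i) (\<phi> j) = (if i = j then B x (\<phi> j) else 0)"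
      using assms zero_right unfolding orthonormal_or_zero_def
      by (cases "i = j"; cases "\<phi> j = 0") auto
  qed
  also have "\<dots> = B x (\<phi> j)"
    using assms by simp
  finally show ?thesis
    by (simp add: residual_def diff_left sum_left scale_left)
qed

lemma q_residual:
  assumes "orthonormal_or_zero \<phi> I" "finite F" "F \<subseteq> I"
  shows "q (residual \<phi> F x) = q x - (\<Sum>i\<in>F. (cmod (B x (\<phi> i)))\<^sup>2)"
proof -
  let ?r = "residual \<phi> F x"
  have "B (\<Sum>i\<in>F. B x (\<phi> i) *\<^sub>C \<phi> i) ?r = 0"
    unfolding sum_left scale_left
  proof (intro sum.neutral ballI)
    fix i assume "i \<in> F"
    then have "B (\<phi> i) ?r = 0"
      using residual_orthogonal[OF assms, of i x] by (subst hermitian) simp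
    then show "B x (\<phi> i) * B (\<phi> i) ?r = 0" by simp
  qed
  then have "B ?r ?r = B x ?r"
    using diff_left[of x _ ?r] unfolding residual_def by simp
  also have "\<dots> = cnj (B ?r x)" by (rule hermitian)
  also have "B ?r x = B x x - (\<Sum>i\<in>F. B x (\<phi> i) * cnj (B x (\<phi> i)))"
    unfolding residual_def diff_left sum_left scale_left hermitian[of "\<phi> _" x] ..
  finally have "B ?r ?r = cnj (B x x) - complex_of_real (\<Sum>i\<in>F. (cmod (B x (\<phi> i)))\<^sup>2)"
    by (simp add: complex_norm_square[symmetric] of_real_sum del: of_real_power)
  then show ?thesis by simp
qed

lemma Bessel:
  assumes "orthonormal_or_zero \<phi> I" "finite F" "F \<subseteq> I"
  shows "(\<Sum>i\<in>F. (cmod (B x (\<phi> i)))\<^sup>2) \<le> q x"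
  using q_residual[OF assms, of x] nonneg[of "residual \<phi> F x"] by linarith

lemma q_residual_le:
  assumes "orthonormal_or_zero \<phi> I" "finite F" "F \<subseteq> I"
  shows "q (residual \<phi> F x) \<le> q x"
  using q_residual[OF assms, of x] sum_nonneg[of F "\<lambda>i. (cmod (B x (\<phi> i)))\<^sup>2"] by simp

lemma q_residual_antimono:
  assumes "orthonormal_or_zero \<phi> I" "finite F" "F \<subseteq> I" "G \<subseteq> F"
  shows "q (residual \<phi> F x) \<le> q (residual \<phi> G x)"
proof -
  have "(\<Sum>i\<in>G. (cmod (B x (\<phi> i)))\<^sup>2) \<le> (\<Sum>i\<in>F. (cmod (B x (\<phi> i)))\<^sup>2)"
    using assms by (intro sum_mono2) auto
  then show ?thesis
    using assms by (subst (1 2) q_residual[OF assms(1)]) (auto intro: finite_subset)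
qed

text \<open>By \<open>q_residual\<close> these are the vectors for which Bessel's inequality becomes an equality.\<close>

definition expandable :: "('i \<Rightarrow> 'd L2) \<Rightarrow> 'i set \<Rightarrow> 'd L2 set" where
  "expandable \<phi> I = {x. ((\<lambda>F. q (residual \<phi> F x)) \<longlongrightarrow> 0) (finite_subsets_at_top I)}"

text \<open>By \<open>q_residual_le\<close> the residual maps are uniformly bounded, so the expandable
  vectors form a closed subspace, and expandability need only be tested on a total set.\<close>

lemma expandable_eq_UNIV:
  assumes \<phi>: "orthonormal_or_zero \<phi> I"
    and S: "S \<subseteq> expandable \<phi> I"
    and total: "closure (span {c *\<^sub>C e |c e. e \<in> S}) = UNIV"
  shows "expandable \<phi> I = UNIV"
proof -
  let ?F = "finite_subsets_at_top I"
  have ev: "\<forall>\<^sub>F F in ?F. finite F \<and> F \<subseteq> I"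
    by (rule eventually_finite_subsets_at_top_weakI) auto
  have limI: "x \<in> expandable \<phi> I"
    if "\<And>e. e > 0 \<Longrightarrow> \<forall>\<^sub>F F in ?F. q (residual \<phi> F x) < e" for x
    unfolding expandable_def mem_Collect_eq tendsto_iff dist_real_def diff_0_right abs_of_nonneg[OF nonneg]
    using that by blast
  have limD: "\<forall>\<^sub>F F in ?F. q (residual \<phi> F x) < e" if "x \<in> expandable \<phi> I" "e > 0" for x e
    using that
    unfolding expandable_def mem_Collect_eq tendsto_iff dist_real_def diff_0_right abs_of_nonneg[OF nonneg]
    by blast
  have add: "x + y \<in> expandable \<phi> I" if "x \<in> expandable \<phi> I" "y \<in> expandable \<phi> I" for x y
  proof (rule limI)
    fix e :: real assume "e > 0"
    then have "e / 4 > 0" by simp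
    from limD[OF that(1) this] limD[OF that(2) this]
    show "\<forall>\<^sub>F F in ?F. q (residual \<phi> F (x + y)) < e"
    proof eventually_elim
      case (elim F)
      then show ?case
        using q_add_le[of "residual \<phi> F x" "residual \<phi> F y"] by (simp add: residual_add)
    qed
  qed
  have scale: "c *\<^sub>C x \<in> expandable \<phi> I" if "x \<in> expandable \<phi> I" for c x
  proof -
    have "((\<lambda>F. (cmod c)\<^sup>2 * q (residual \<phi> F x)) \<longlongrightarrow> (cmod c)\<^sup>2 * 0) ?F"
      using that unfolding expandable_def by (intro tendsto_mult tendsto_const) auto
    then show ?thesis by (simp add: expandable_def residual_cscale q_scale)
  qed
  have "subspace (expandable \<phi> I)"
    unfolding subspace_def
  proof (intro conjI ballI allI)
    show "0 \<in> expandable \<phi> I" by (simp add: expandable_def residual_def)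
  qed (use add scale in \<open>auto simp: scaleR_L2_def\<close>)
  then have sub: "span {c *\<^sub>C e |c e. e \<in> S} \<subseteq> expandable \<phi> I"
    using S scale by (intro span_minimal) auto
  have "x \<in> expandable \<phi> I" for x
  proof (rule limI)
    fix e :: real assume e: "e > 0"
    have K: "\<bar>K\<bar> + 1 > 0" by simp
    have "x \<in> closure (span {c *\<^sub>C e |c e. e \<in> S})" using total by simp
    moreover have "sqrt (e / (4 * (\<bar>K\<bar> + 1))) > 0" using e K by simp
    ultimately obtain y where y: "y \<in> span {c *\<^sub>C e |c e. e \<in> S}"
      and d: "dist y x < sqrt (e / (4 * (\<bar>K\<bar> + 1)))"
      unfolding closure_approachable by blast
    have "(norm (x - y))\<^sup>2 < (sqrt (e / (4 * (\<bar>K\<bar> + 1))))\<^sup>2"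
      using d by (intro power_strict_mono) (auto simp: dist_norm norm_minus_commute)
    then have "(norm (x - y))\<^sup>2 < e / (4 * (\<bar>K\<bar> + 1))"
      using e K by simp
    then have "(\<bar>K\<bar> + 1) * (norm (x - y))\<^sup>2 < e / 4"
      using K by (simp add: field_simps)
    moreover have "K * (norm (x - y))\<^sup>2 \<le> (\<bar>K\<bar> + 1) * (norm (x - y))\<^sup>2"
      by (intro mult_right_mono) auto
    ultimately have small: "q (x - y) < e / 4"
      using bounded[of "x - y"] by linarith
    have "\<forall>\<^sub>F F in ?F. q (residual \<phi> F y) < e / 4"
      using y sub e by (intro limD) auto
    with ev show "\<forall>\<^sub>F F in ?F. q (residual \<phi> F x) < e"
    proof eventually_elim
      case (elim F)
      have "q (residual \<phi> F x) \<le> 2 * q (residual \<phi> F (x - y)) + 2 * q (residual \<phi> F y)"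
        using q_add_le[of "residual \<phi> F (x - y)" "residual \<phi> F y"]
        by (simp add: residual_add[symmetric])
      with elim q_residual_le[OF \<phi>, of F "x - y"] small show ?case by linarith
    qed
  qed
  then show ?thesis by auto
qed

fun gram_schmidt :: "(nat \<Rightarrow> 'd L2) \<Rightarrow> nat \<Rightarrow> 'd L2" where
  "gram_schmidt e n =
     (let y = e n - (\<Sum>k<n. B (e n) (gram_schmidt e k) *\<^sub>C gram_schmidt e k)
      in if q y = 0 then 0 else complex_of_real (1 / sqrt (q y)) *\<^sub>C y)"

declare gram_schmidt.simps [simp del]

lemma gram_schmidt_step:
  fixes e :: "nat \<Rightarrow> 'd L2" and n :: nat
  defines "y \<equiv> residual (gram_schmidt e) {..<n} (e n)"
  shows "gram_schmidt e n = (if q y = 0 then 0 else complex_of_real (1 / sqrt (q y)) *\<^sub>C y)"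
  unfolding y_def residual_def using gram_schmidt.simps[of e n] unfolding Let_def .

lemma orthonormal_gram_schmidt: "orthonormal_or_zero (gram_schmidt e) UNIV"
proof -
  let ?\<phi> = "gram_schmidt e"
  have unit: "?\<phi> n = 0 \<or> B (?\<phi> n) (?\<phi> n) = 1" for n
  proof -
    define y where "y = residual ?\<phi> {..<n} (e n)"
    note step = gram_schmidt_step[of e n, folded y_def]
    show ?thesis
    proof (cases "q y = 0")
      case False
      then have "q (?\<phi> n) = (1 / sqrt (q y))\<^sup>2 * q y"
        unfolding step by (simp add: q_scale norm_divide power_divide)
      also have "\<dots> = 1"
        using False nonneg[of y] by (simp add: power_divide)
      finally have "q (?\<phi> n) = 1" .
      then show ?thesis by (subst diag) simp
    qed (simp add: step)
  qed
  have "orthonormal_or_zero ?\<phi> {..<n}" for n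
  proof (induction n)
    case 0
    then show ?case by (simp add: orthonormal_or_zero_def)
  next
    case (Suc n)
    have "B (?\<phi> n) (?\<phi> k) = 0" if "k < n" for k
      using residual_orthogonal[OF Suc, of "{..<n}" k "e n"] that
      by (subst gram_schmidt_step) (simp add: scale_left)
    then have "B (?\<phi> n) (?\<phi> k) = 0 \<and> B (?\<phi> k) (?\<phi> n) = 0" if "k < n" for k
      using that by (subst (2) hermitian) simp
    with Suc unit show ?case
      unfolding orthonormal_or_zero_def by (auto simp: less_Suc_eq)
  qed
  then have "B (?\<phi> i) (?\<phi> j) = 0" if "i \<noteq> j" for i j
    using that unfolding orthonormal_or_zero_def
    by (meson lessThan_iff less_Suc_eq_le max.cobounded1 max.cobounded2)
  with unit show ?thesis
    unfolding orthonormal_or_zero_def by blast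
qed

text \<open>The vector \<open>e n\<close> differs from a combination of the first \<open>n + 1\<close> Gram--Schmidt vectors only
  by a null vector, so its residual vanishes as soon as the index set contains them.\<close>

lemma gram_schmidt_expandable: "e n \<in> expandable (gram_schmidt e) UNIV"
proof -
  let ?\<phi> = "gram_schmidt e"
  let ?y = "residual ?\<phi> {..<n} (e n)"
  note o = orthonormal_gram_schmidt[of e]
  have orth: "B (\<Sum>k<n. B (e n) (?\<phi> k) *\<^sub>C ?\<phi> k) (?\<phi> n) = 0"
    unfolding sum_left scale_left using o
    by (intro sum.neutral) (simp add: orthonormal_or_zero_def)
  have "B (e n) (?\<phi> n) = B ?y (?\<phi> n)"
    unfolding residual_def diff_left orth by simp
  moreover have "(cmod (B ?y (?\<phi> n)))\<^sup>2 = q ?y"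
  proof (cases "q ?y = 0")
    case True
    then show ?thesis using q_eq_0D by simp
  next
    case False
    have "B ?y (?\<phi> n) = complex_of_real (1 / sqrt (q ?y)) * B ?y ?y"
      unfolding gram_schmidt_step[of e n] scale_right if_not_P[OF False]
      by (simp only: complex_cnj_complex_of_real)
    then have "B ?y (?\<phi> n) = complex_of_real (1 / sqrt (q ?y) * q ?y)"
      by (metis diag of_real_mult)
    then have "cmod (B ?y (?\<phi> n)) = q ?y / sqrt (q ?y)"
      using nonneg[of ?y] by (simp del: of_real_mult of_real_divide)
    then show ?thesis using nonneg[of ?y] by (simp add: real_div_sqrt)
  qed
  ultimately have "(cmod (B (e n) (?\<phi> n)))\<^sup>2 = q ?y" by simp
  then have zero: "q (residual ?\<phi> {..n} (e n)) = 0"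
    using q_residual[OF o, of "{..<n}" "e n"] q_residual[OF o, of "{..n}" "e n"]
    by (simp add: lessThan_Suc_atMost[symmetric])
  have "\<forall>\<^sub>F F in finite_subsets_at_top UNIV. q (residual ?\<phi> F (e n)) = 0"
    unfolding eventually_finite_subsets_at_top
  proof (intro exI[of _ "{..n}"] conjI allI impI; clarsimp?)
    fix F :: "nat set" assume "finite F" "{..n} \<subseteq> F"
    then have "q (residual ?\<phi> F (e n)) \<le> q (residual ?\<phi> {..n} (e n))"
      by (intro q_residual_antimono[OF o]) auto
    then show "q (residual ?\<phi> F (e n)) = 0"
      using zero nonneg[of "residual ?\<phi> F (e n)"] by linarith
  qed
  then show ?thesis
    unfolding expandable_def mem_Collect_eq by (rule tendsto_eventually)
qed

lemma null_expandable:
  assumes "q x = 0"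
  shows "x \<in> expandable \<phi> I"
  unfolding expandable_def residual_def mem_Collect_eq by (simp add: q_eq_0D[OF assms] assms)

text \<open>The Gram--Schmidt vectors need not be total, only total modulo the null space of the form.\<close>

lemma exists_expansion:
  assumes "\<And>s. s \<in> S \<Longrightarrow> s \<in> range e \<or> q s = 0"
    and "closure (span {c *\<^sub>C s |c s. s \<in> S}) = UNIV"
  shows "expandable (gram_schmidt e) UNIV = UNIV"
proof (rule expandable_eq_UNIV[OF orthonormal_gram_schmidt _ assms(2)])
  show "S \<subseteq> expandable (gram_schmidt e) UNIV"
  proof
    fix s assume "s \<in> S"
    from assms(1)[OF this] show "s \<in> expandable (gram_schmidt e) UNIV"
      using gram_schmidt_expandable[of e] null_expandable[of s "gram_schmidt e" UNIV] by fastforce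
  qed
qed

end

interpretation L2: positive_form cinner 1
proof
  show "Re (cinner f f) \<le> 1 * (norm f)\<^sup>2" for f :: "'d::finite L2"
    by (simp add: cinner_self)
qed (auto simp: cinner_add_left cinner_cscale_left Re_cinner_self_nonneg intro: cinner_commute)

lemma norm_cinner_le: "cmod (cinner f g) \<le> norm f * norm g"
proof -
  have "(cmod (cinner f g))\<^sup>2 \<le> (norm f * norm g)\<^sup>2"
    using L2.Cauchy_Schwarz[of f g] by (simp add: cinner_self power_mult_distrib)
  then show ?thesis by (rule power2_le_imp_le) simp
qed

lemma bounded_linear_cinner_left: "bounded_linear (\<lambda>f. cinner f g)"
  by (rule bounded_linear_intro[where K = "norm g"])
     (auto simp: cinner_add_left cinner_cscale_left scaleR_L2_def norm_cinner_le scaleR_conv_of_real)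

lemma bounded_linear_cinner_right: "bounded_linear (\<lambda>f. cinner g f)"
  by (rule bounded_linear_intro[where K = "norm g"])
     (use norm_cinner_le[of g] in \<open>auto simp: cinner_add_right cinner_cscale_right scaleR_L2_def
       scaleR_conv_of_real mult.commute[of "norm _" "norm g"]\<close>)

section \<open>Orthonormal bases\<close>

lemma orthonormal_or_zero_onb:
  assumes "is_onb E"
  shows "L2.orthonormal_or_zero (\<lambda>e. e) E"
  using assms by (auto simp: is_onb_def L2.orthonormal_or_zero_def)

lemma expansion_has_sum:
  assumes "L2.expandable \<phi> I = UNIV"
  shows "((\<lambda>i. cinner x (\<phi> i) *\<^sub>C \<phi> i) has_sum x) I"
proof -
  have "((\<lambda>F. (norm (L2.residual \<phi> F x))\<^sup>2) \<longlongrightarrow> 0) (finite_subsets_at_top I)"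
    using assms by (auto simp: L2.expandable_def cinner_self)
  then have "((\<lambda>F. sqrt ((norm (L2.residual \<phi> F x))\<^sup>2)) \<longlongrightarrow> sqrt 0) (finite_subsets_at_top I)"
    by (rule tendsto_real_sqrt)
  then have "((\<lambda>F. L2.residual \<phi> F x) \<longlongrightarrow> 0) (finite_subsets_at_top I)"
    by (simp add: tendsto_norm_zero_iff)
  then have "((\<lambda>F. x - L2.residual \<phi> F x) \<longlongrightarrow> x - 0) (finite_subsets_at_top I)"
    by (intro tendsto_diff tendsto_const)
  then show ?thesis
    by (simp add: has_sum_def L2.residual_def)
qed

lemma onb_has_sum:
  assumes "is_onb E"
  shows "((\<lambda>e. cinner x e *\<^sub>C e) has_sum x) E"
proof (rule expansion_has_sum)
  have "E \<subseteq> L2.expandable (\<lambda>e. e) E"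
  proof
    fix e assume e: "e \<in> E"
    have "\<forall>\<^sub>F F in finite_subsets_at_top E. Re (cinner (L2.residual (\<lambda>e. e) F e)
        (L2.residual (\<lambda>e. e) F e)) = 0"
      unfolding eventually_finite_subsets_at_top
    proof (intro exI[of _ "{e}"] conjI allI impI; (use e in \<open>simp; fail\<close>)?)
      fix F assume F: "finite F \<and> {e} \<subseteq> F \<and> F \<subseteq> E"
      have "Re (cinner (L2.residual (\<lambda>e. e) F e) (L2.residual (\<lambda>e. e) F e)) \<le>
          Re (cinner (L2.residual (\<lambda>e. e) {e} e) (L2.residual (\<lambda>e. e) {e} e))"
        using F by (intro L2.q_residual_antimono[OF orthonormal_or_zero_onb[OF assms]]) auto
      also have "L2.residual (\<lambda>e. e) {e} e = 0"
        using assms e by (simp add: L2.residual_def is_onb_def)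
      finally show "Re (cinner (L2.residual (\<lambda>e. e) F e) (L2.residual (\<lambda>e. e) F e)) = 0"
        using Re_cinner_self_nonneg[of "L2.residual (\<lambda>e. e) F e"] by simp
    qed
    then show "e \<in> L2.expandable (\<lambda>e. e) E"
      unfolding L2.expandable_def mem_Collect_eq by (rule tendsto_eventually)
  qed
  then show "L2.expandable (\<lambda>e. e) E = UNIV"
    using assms by (intro L2.expandable_eq_UNIV[of _ _ E] orthonormal_or_zero_onb)
      (auto simp: is_onb_def)
qed

lemma onb_Parseval:
  assumes "is_onb E"
  shows "((\<lambda>e. cinner x e * cinner e y) has_sum cinner x y) E"
  using has_sum_bounded_linear[OF bounded_linear_cinner_left onb_has_sum[OF assms], of x y]
  by (simp add: cinner_cscale_left)

lemma onb_norm_has_sum: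
  assumes "is_onb E"
  shows "((\<lambda>e. (cmod (cinner x e))\<^sup>2) has_sum (norm x)\<^sup>2) E"
proof -
  have "(\<lambda>e. cinner x e * cinner e x) = (\<lambda>e. complex_of_real ((cmod (cinner x e))\<^sup>2))"
    using cinner_commute[of _ x] by (simp only: complex_norm_square)
  then have "((\<lambda>e. complex_of_real ((cmod (cinner x e))\<^sup>2)) has_sum complex_of_real ((norm x)\<^sup>2)) E"
    using onb_Parseval[OF assms, of x x] by (simp only: cinner_self)
  then show ?thesis by (simp only: has_sum_of_real_iff)
qed

text \<open>Bessel's inequality for \<open>x\<close> and \<open>y\<close> combined with the Cauchy--Schwarz inequality for finite
  sums.\<close>

lemma onb_products_abs_summable:
  assumes "is_onb E"
  shows "(\<lambda>e. cmod (cinner x e * cinner e y)) summable_on E"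
    and "(\<Sum>\<^sub>\<infinity>e\<in>E. cmod (cinner x e * cinner e y)) \<le> norm x * norm y"
proof -
  have fin: "(\<Sum>e\<in>F. cmod (cinner x e * cinner e y)) \<le> norm x * norm y"
    if F: "finite F" "F \<subseteq> E" for F
  proof -
    have le: "L2_set (\<lambda>e. cmod (cinner z e)) F \<le> norm z" for z
      using L2.Bessel[OF orthonormal_or_zero_onb[OF assms] F, of z]
      by (auto simp: L2_set_def cinner_self intro: real_le_lsqrt sum_nonneg)
    have "(\<Sum>e\<in>F. cmod (cinner x e * cinner e y)) =
        (\<Sum>e\<in>F. \<bar>cmod (cinner x e)\<bar> * \<bar>cmod (cinner y e)\<bar>)"
      by (intro sum.cong refl) (metis abs_norm_cancel cinner_commute complex_mod_cnj norm_mult)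
    also have "\<dots> \<le> L2_set (\<lambda>e. cmod (cinner x e)) F * L2_set (\<lambda>e. cmod (cinner y e)) F"
      by (rule L2_set_mult_ineq)
    also have "\<dots> \<le> norm x * norm y"
      by (intro mult_mono le) (auto intro: L2_set_nonneg)
    finally show ?thesis .
  qed
  show s: "(\<lambda>e. cmod (cinner x e * cinner e y)) summable_on E"
    by (rule nonneg_bdd_above_summable_on) (use fin in \<open>auto intro!: bdd_aboveI\<close>)
  show "(\<Sum>\<^sub>\<infinity>e\<in>E. cmod (cinner x e * cinner e y)) \<le> norm x * norm y"
    by (rule infsum_le_finite_sums[OF s fin])
qed

lemma is_onb_of_expandable:
  assumes \<phi>: "L2.orthonormal_or_zero \<phi> I" and "L2.expandable \<phi> I = UNIV"
  shows "is_onb (\<phi> ` I - {0})"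
  unfolding is_onb_def
proof (intro conjI ballI)
  fix e e' assume e: "e \<in> \<phi> ` I - {0}" "e' \<in> \<phi> ` I - {0}"
  then obtain i j where ij: "i \<in> I" "j \<in> I" "e = \<phi> i" "e' = \<phi> j" by auto
  show "cinner e e' = (if e = e' then 1 else 0)"
    using \<phi> e ij unfolding L2.orthonormal_or_zero_def
    by (metis DiffE singletonI zero_neq_one)
next
  let ?S = "span {c *\<^sub>C e |c e. e \<in> \<phi> ` I - {0}}"
  have "x \<in> closure ?S" for x
  proof (rule Lim_in_closed_set)
    show "((\<lambda>F. \<Sum>i\<in>F. cinner x (\<phi> i) *\<^sub>C \<phi> i) \<longlongrightarrow> x) (finite_subsets_at_top I)"
      using expansion_has_sum[OF assms(2), of x] by (simp add: has_sum_def)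
    have "(\<Sum>i\<in>F. cinner x (\<phi> i) *\<^sub>C \<phi> i) \<in> ?S" if "F \<subseteq> I" for F
    proof (rule span_sum)
      fix i assume "i \<in> F"
      with that show "cinner x (\<phi> i) *\<^sub>C \<phi> i \<in> ?S"
        by (cases "\<phi> i = 0") (auto intro!: span_base exI[of _ "cinner x (\<phi> i)"] span_zero)
    qed
    then show "\<forall>\<^sub>F F in finite_subsets_at_top I. (\<Sum>i\<in>F. cinner x (\<phi> i) *\<^sub>C \<phi> i) \<in> closure ?S"
      by (intro eventually_finite_subsets_at_top_weakI) (use closure_subset in blast)
  qed auto
  then show "closure ?S = UNIV" by auto
qed

section \<open>Trace-class operators\<close>

lemma bounded_ops_cscale: "T \<in> bounded_ops \<Longrightarrow> blinfun_apply T (c *\<^sub>C f) = c *\<^sub>C blinfun_apply T f"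
  by (simp add: bounded_ops_def)

text \<open>Hermitian symmetry is not part of the positivity assumption; it follows by polarization from
  the diagonal being real.\<close>

lemma positive_form_operator:
  assumes P: "P \<in> bounded_ops" and pos: "\<And>f. cinner (blinfun_apply P f) f \<in> \<real>\<^sub>\<ge>\<^sub>0"
  shows "positive_form (\<lambda>f g. cinner (blinfun_apply P f) g) (norm P)"
proof
  fix f g h :: "'a L2" and c :: complex
  let ?P = "blinfun_apply P"
  show "cinner (?P (f + g)) h = cinner (?P f) h + cinner (?P g) h"
    by (simp add: blinfun.add_right cinner_add_left)
  show "cinner (?P (c *\<^sub>C f)) g = c * cinner (?P f) g"
    by (simp add: bounded_ops_cscale[OF P] cinner_cscale_left)
  show "0 \<le> Re (cinner (?P f) f)"
    using pos[of f] complex_nonneg_Reals_iff by blast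
  have "Re (cinner (?P f) f) \<le> norm (?P f) * norm f"
    using complex_Re_le_cmod norm_cinner_le order_trans by blast
  also have "\<dots> \<le> (norm P * norm f) * norm f"
    by (intro mult_right_mono norm_blinfun) auto
  finally show "Re (cinner (?P f) f) \<le> norm P * (norm f)\<^sup>2"
    by (simp add: power2_eq_square mult.assoc)
  have "cinner (?P f) g - cnj (cinner (?P g) f) = 0"
  proof (rule sesquilinear_eq_0I[of "\<lambda>f g. cinner (?P f) g - cnj (cinner (?P g) f)"])
    fix x :: "'a L2"
    have "cinner (?P x) x \<in> \<real>"
      using pos[of x] nonneg_Reals_subset_Reals by blast
    then show "cinner (?P x) x - cnj (cinner (?P x) x) = 0"
      by (simp add: Reals_cnj_iff)
  qed (simp_all add: blinfun.add_right cinner_add_left cinner_add_right bounded_ops_cscale[OF P]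
      cinner_cscale_left cinner_cscale_right algebra_simps)
  then show "cinner (?P f) g = cnj (cinner (?P g) f)" by simp
qed

definition nuclear_rep ::
  "('d::finite L2 \<Rightarrow>\<^sub>L 'd L2) \<Rightarrow> (nat \<Rightarrow> 'd L2) \<Rightarrow> (nat \<Rightarrow> 'd L2) \<Rightarrow> bool" where
  "nuclear_rep S u v \<longleftrightarrow> summable (\<lambda>n. norm (u n) * norm (v n)) \<and>
     (\<forall>f. ((\<lambda>n. cinner f (u n) *\<^sub>C v n) has_sum blinfun_apply S f) UNIV)"

text \<open>Let \<open>P = \<bar>S\<bar>\<close> and orthonormalize a basis with respect to the form \<open>\<langle>P f, g\<rangle>\<close>. The resulting
  vectors \<open>\<phi>\<^sub>n\<close> give a Cholesky factorization: the residuals of \<open>f\<close> tend to zero in the form, hence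
  \<open>P\<close>, and with it \<open>S\<close>, maps them to a null sequence, because \<open>\<parallel>S y\<parallel> = \<parallel>P y\<parallel>\<close>. This yields
  \<open>S f = \<Sum>\<^sub>n \<langle>f, P \<phi>\<^sub>n\<rangle> S \<phi>\<^sub>n\<close>. The product of norms is \<open>\<parallel>P \<phi>\<^sub>n\<parallel>\<^sup>2\<close>; expanding it in
  the basis and applying Bessel's inequality for the form bounds the sum over \<open>n\<close> by the trace
  of \<open>P\<close>.\<close>

lemma trace_class_nuclear:
  assumes "S \<in> trace_class"
  shows "\<exists>u v. nuclear_rep S u v"
proof -
  obtain P E where S: "S \<in> bounded_ops" and abs: "is_abs_op S P" and E: "is_onb E"
    and sumP: "(\<lambda>e. cinner (blinfun_apply P e) e) summable_on E"
    using assms unfolding trace_class_def by blast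
  let ?P = "blinfun_apply P" and ?S = "blinfun_apply S"
  have P: "P \<in> bounded_ops" and pos: "\<And>f. cinner (?P f) f \<in> \<real>\<^sub>\<ge>\<^sub>0"
    and PS: "\<And>f g. cinner (?P (?P f)) g = cinner (?S f) (?S g)"
    using abs unfolding is_abs_op_def by auto
  interpret P: positive_form "\<lambda>f g. cinner (?P f) g" "norm P"
    by (rule positive_form_operator[OF P pos])
  have norm_eq: "norm (?S y) = norm (?P y)" for y
  proof -
    have "complex_of_real ((norm (?S y))\<^sup>2) = cnj (cinner (?P y) (?P y))"
      unfolding cinner_self[symmetric] PS[symmetric] by (rule P.hermitian)
    also have "\<dots> = complex_of_real ((norm (?P y))\<^sup>2)"
      by (simp add: cinner_self)
    finally show ?thesis
      by (metis of_real_eq_iff norm_ge_zero power2_eq_imp_eq)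
  qed
  have norm_P_le: "(norm (?P y))\<^sup>2 \<le> norm P * Re (cinner (?P y) y)" for y
  proof (cases "norm (?P y) = 0")
    case True
    then show ?thesis by simp
  next
    case False
    \<comment> \<open>Cauchy--Schwarz for the form, applied to y and P y.\<close>
    have "((norm (?P y))\<^sup>2)\<^sup>2 = (cmod (cinner (?P y) (?P y)))\<^sup>2"
      by (simp add: cinner_self norm_power)
    also have "\<dots> \<le> Re (cinner (?P y) y) * Re (cinner (?P (?P y)) (?P y))"
      by (rule P.Cauchy_Schwarz)
    also have "\<dots> \<le> Re (cinner (?P y) y) * (norm P * (norm (?P y))\<^sup>2)"
      by (intro mult_left_mono P.bounded P.nonneg)
    finally show ?thesis using False by (simp add: power2_eq_square mult.commute)
  qed
  \<comment> \<open>Summability leaves only countably many basis vectors that are not null for P; zero is added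
    so that the set to be enumerated is not empty.\<close>
  define E' where "E' = {e\<in>E. cinner (?P e) e \<noteq> 0}"
  have "countable E'"
    unfolding E'_def by (rule summable_countable_complex[OF sumP])
  then have countable: "countable (insert 0 E')" by simp
  define e where "e = from_nat_into (insert 0 E')"
  have range_e: "range e = insert 0 E'"
    unfolding e_def using countable by (intro range_from_nat_into) auto
  define \<phi> where "\<phi> = P.gram_schmidt e"
  note ortho = P.orthonormal_gram_schmidt[of e, folded \<phi>_def]
  have expand: "P.expandable \<phi> UNIV = UNIV"
    unfolding \<phi>_def
  proof (rule P.exists_expansion)
    show "closure (span {c *\<^sub>C s |c s. s \<in> E}) = UNIV"
      using E by (simp add: is_onb_def)
    show "s \<in> range e \<or> Re (cinner (?P s) s) = 0" if "s \<in> E" for s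
      using that unfolding range_e E'_def by auto
  qed
  have "((\<lambda>n. cinner f (?P (\<phi> n)) *\<^sub>C ?S (\<phi> n)) has_sum ?S f) UNIV" for f
  proof -
    have *: "?S (P.residual \<phi> F f) = ?S f - (\<Sum>n\<in>F. cinner f (?P (\<phi> n)) *\<^sub>C ?S (\<phi> n))" for F
      using P.hermitian[of f] cinner_commute[of f]
      by (simp add: P.residual_def blinfun.diff_right blinfun.sum_right bounded_ops_cscale[OF S])
    have "((\<lambda>F. sqrt (norm P * Re (cinner (?P (P.residual \<phi> F f)) (P.residual \<phi> F f)))) \<longlongrightarrow>
        sqrt (norm P * 0)) (finite_subsets_at_top UNIV)"
      using expand by (intro tendsto_intros) (auto simp: P.expandable_def)
    then have lim0: "((\<lambda>F. sqrt (norm P * Re (cinner (?P (P.residual \<phi> F f)) (P.residual \<phi> F f))))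
        \<longlongrightarrow> 0) (finite_subsets_at_top UNIV)" by simp
    have "norm (?S (P.residual \<phi> F f)) \<le>
        sqrt (norm P * Re (cinner (?P (P.residual \<phi> F f)) (P.residual \<phi> F f)))" for F
      unfolding norm_eq by (rule real_le_rsqrt) (rule norm_P_le)
    then have lim: "((\<lambda>F. ?S (P.residual \<phi> F f)) \<longlongrightarrow> 0) (finite_subsets_at_top UNIV)"
      by (intro Lim_null_comparison[OF always_eventually lim0]) simp
    have "((\<lambda>F. ?S f - ?S (P.residual \<phi> F f)) \<longlongrightarrow> ?S f - 0) (finite_subsets_at_top UNIV)"
      by (intro tendsto_diff tendsto_const lim)
    then show ?thesis unfolding has_sum_def * by simp
  qed
  moreover have "summable (\<lambda>n. norm (?P (\<phi> n)) * norm (?S (\<phi> n)))"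
  proof (rule summableI_nonneg_bounded)
    fix N :: nat
    have "((\<lambda>e. \<Sum>n<N. (cmod (cinner (?P (\<phi> n)) e))\<^sup>2) has_sum (\<Sum>n<N. (norm (?P (\<phi> n)))\<^sup>2)) E"
      by (induction N) (auto intro!: has_sum_add onb_norm_has_sum[OF E])
    moreover have "((\<lambda>e. Re (cinner (?P e) e)) has_sum
        Re (\<Sum>\<^sub>\<infinity>e\<in>E. cinner (?P e) e)) E"
      by (intro has_sum_Re has_sum_infsum sumP)
    moreover have "(\<Sum>n<N. (cmod (cinner (?P (\<phi> n)) e))\<^sup>2) \<le> Re (cinner (?P e) e)" for e
    proof -
      have "(\<Sum>n<N. (cmod (cinner (?P (\<phi> n)) e))\<^sup>2) = (\<Sum>n<N. (cmod (cinner (?P e) (\<phi> n)))\<^sup>2)"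
        by (intro sum.cong refl) (metis P.hermitian complex_mod_cnj)
      also have "\<dots> \<le> Re (cinner (?P e) e)"
        by (rule P.Bessel[OF ortho]) auto
      finally show ?thesis .
    qed
    ultimately have "(\<Sum>n<N. (norm (?P (\<phi> n)))\<^sup>2) \<le> Re (\<Sum>\<^sub>\<infinity>e\<in>E. cinner (?P e) e)"
      by (rule has_sum_mono)
    then show "(\<Sum>n<N. norm (?P (\<phi> n)) * norm (?S (\<phi> n))) \<le> Re (\<Sum>\<^sub>\<infinity>e\<in>E. cinner (?P e) e)"
      by (simp add: norm_eq power2_eq_square)
  qed auto
  ultimately show ?thesis
    unfolding nuclear_rep_def
    by (intro exI[of _ "\<lambda>n. ?P (\<phi> n)"] exI[of _ "\<lambda>n. ?S (\<phi> n)"]) simp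
qed

text \<open>Both sums are iterated sums of the double family \<open>\<langle>T v\<^sub>n, e\<rangle> \<langle>e, u\<^sub>n\<rangle>\<close>, which converges
  absolutely with total at most \<open>\<parallel>T\<parallel> \<Sum>\<^sub>n \<parallel>u\<^sub>n\<parallel> \<parallel>v\<^sub>n\<parallel>\<close>. In particular the trace does not
  depend on the basis.\<close>

lemma trace_nuclear:
  assumes S: "nuclear_rep S u v" and T: "T \<in> bounded_ops" and E: "is_onb E"
  obtains t where "((\<lambda>n. cinner (blinfun_apply T (v n)) (u n)) has_sum t) UNIV"
    and "((\<lambda>e. cinner (blinfun_apply T (blinfun_apply S e)) e) has_sum t) E"
proof -
  let ?T = "blinfun_apply T" and ?S = "blinfun_apply S"
  define g where "g = (\<lambda>n e. cinner (?T (v n)) e * cinner e (u n))"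
  have row: "(g n has_sum cinner (?T (v n)) (u n)) E" for n
    unfolding g_def by (rule onb_Parseval[OF E])
  have col: "((\<lambda>n. g n e) has_sum cinner (?T (?S e)) e) UNIV" for e
  proof -
    have "((\<lambda>n. cinner e (u n) *\<^sub>C v n) has_sum ?S e) UNIV"
      using S by (simp add: nuclear_rep_def)
    from has_sum_bounded_linear[OF bounded_linear_compose[OF bounded_linear_cinner_left
        blinfun.bounded_linear_right] this, of T e]
    show ?thesis
      by (simp add: g_def bounded_ops_cscale[OF T] cinner_cscale_left mult.commute)
  qed
  have "summable (\<lambda>n. norm T * (norm (u n) * norm (v n)))"
    using S by (intro summable_mult) (simp add: nuclear_rep_def)
  then have uv: "(\<lambda>n. norm T * (norm (u n) * norm (v n))) summable_on UNIV"
    by (simp add: summable_on_UNIV_nonneg_real_iff)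
  have "(\<lambda>n. \<Sum>\<^sub>\<infinity>e\<in>E. cmod (g n e)) summable_on UNIV"
  proof (rule summable_on_comparison_test[OF uv])
    fix n
    have "(\<Sum>\<^sub>\<infinity>e\<in>E. cmod (g n e)) \<le> norm (?T (v n)) * norm (u n)"
      unfolding g_def by (rule onb_products_abs_summable[OF E])
    also have "\<dots> \<le> (norm T * norm (v n)) * norm (u n)"
      by (intro mult_right_mono norm_blinfun) auto
    finally show "(\<Sum>\<^sub>\<infinity>e\<in>E. cmod (g n e)) \<le> norm T * (norm (u n) * norm (v n))"
      by (simp add: mult_ac)
  qed (auto intro: infsum_nonneg)
  moreover have "(\<lambda>e. cmod (g n e)) summable_on E" for n
    unfolding g_def by (rule onb_products_abs_summable[OF E])
  ultimately have "(\<lambda>z. norm (case z of (n, e) \<Rightarrow> g n e)) summable_on UNIV \<times> E"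
    by (intro iffD2[OF Infinite_Sum.abs_summable_on_Sigma_iff]) (simp add: infsum_nonneg)
  then obtain t where t: "((\<lambda>(n, e). g n e) has_sum t) (UNIV \<times> E)"
    using abs_summable_summable has_sum_infsum by blast
  have "((\<lambda>n. cinner (?T (v n)) (u n)) has_sum t) UNIV"
    by (rule has_sum_SigmaD[OF t]) (use row in simp)
  moreover have "((\<lambda>(e, n). g n e) has_sum t) (E \<times> UNIV)"
    using iffD1[OF has_sum_swap t] by (simp only: prod.case)
  then have "((\<lambda>e. cinner (?T (?S e)) e) has_sum t) E"
    by (rule has_sum_SigmaD) (use col in simp)
  ultimately show ?thesis by (rule that)
qed

section \<open>Representatives\<close>

lemma L2_cases:
  obtains f where "square_integrable f" "x = abs_L2 f"
proof -
  have "ae_rel (rep_L2 x) (rep_L2 x)" "abs_L2 (rep_L2 x) = x"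
    by (rule Quotient3_rep_reflp[OF Quotient3_L2], rule Quotient3_abs_rep[OF Quotient3_L2])
  then show ?thesis using that[of "rep_L2 x"] by (simp add: ae_rel_def)
qed

lemma square_integrable_iff_ae_rel: "square_integrable f \<longleftrightarrow> ae_rel f f"
  by (simp add: ae_rel_def)

lemma measurable_square_integrable: "square_integrable f \<Longrightarrow> f \<in> borel_measurable borel"
  by (simp add: square_integrable_def)

lemma cinner_abs_L2:
  assumes "square_integrable f" "square_integrable g"
  shows "cinner (abs_L2 f) (abs_L2 g) = (\<integral>t. f t * cnj (g t) \<partial>lborel)"
  using assms by (simp add: square_integrable_iff_ae_rel cinner.abs_eq)

lemma plus_abs_L2:
  assumes "square_integrable f" "square_integrable g"
  shows "abs_L2 f + abs_L2 g = abs_L2 (\<lambda>t. f t + g t)"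
  using assms by (simp add: square_integrable_iff_ae_rel plus_L2.abs_eq)

lemma cscale_abs_L2:
  assumes "square_integrable f"
  shows "c *\<^sub>C abs_L2 f = abs_L2 (\<lambda>t. c * f t)"
  using assms by (simp add: square_integrable_iff_ae_rel cscale.abs_eq)

lemma diff_abs_L2:
  assumes "square_integrable f" "square_integrable g"
  shows "abs_L2 f - abs_L2 g = abs_L2 (\<lambda>t. f t - g t)"
  using plus_abs_L2[OF assms(1) square_integrable_mult[OF assms(2), of "-1"]] assms
  by (simp add: minus_L2_def cscale_abs_L2)

lemma norm_abs_L2:
  assumes "square_integrable f"
  shows "(norm (abs_L2 f))\<^sup>2 = (\<integral>t. (cmod (f t))\<^sup>2 \<partial>lborel)"
proof -
  have "complex_of_real ((norm (abs_L2 f))\<^sup>2) = complex_of_real (\<integral>t. (cmod (f t))\<^sup>2 \<partial>lborel)"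
    using assms by (simp only: cinner_self[symmetric] cinner_abs_L2 integral_mult_cnj_self)
  then show ?thesis by (simp only: of_real_eq_iff)
qed

lemma square_integrable_diff:
  assumes "square_integrable f" "square_integrable g"
  shows "square_integrable (\<lambda>t. f t - g t)"
  using square_integrable_add[OF assms(1) square_integrable_mult[OF assms(2), of "-1"]] by simp

section \<open>Indicators of open sets are total\<close>

definition ind :: "(real ^ 'd) set \<Rightarrow> 'd::finite L2" where
  "ind A = abs_L2 (\<lambda>t. complex_of_real (indicator A t))"

lemma square_integrable_indicator:
  fixes A :: "(real ^ 'd) set"
  assumes "A \<in> fmeasurable lborel"
  shows "square_integrable (\<lambda>t. complex_of_real (indicator A t))"
proof -
  have "(\<lambda>t. (cmod (complex_of_real (indicator A t)))\<^sup>2) = (indicator A :: _ \<Rightarrow> real)"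
    by (auto simp: indicator_def)
  then show ?thesis
    using assms by (auto simp: square_integrable_def fmeasurable_def less_top[symmetric]
        intro!: measurable_compose[OF borel_measurable_indicator])
qed

lemma norm_diff_ind:
  fixes A B :: "(real ^ 'd::finite) set"
  assumes A: "A \<in> fmeasurable lborel" and B: "B \<in> fmeasurable lborel" and "B \<subseteq> A"
  shows "(norm (ind A - ind B))\<^sup>2 = measure lborel A - measure lborel B"
proof -
  have "(norm (ind A - ind B))\<^sup>2 =
      (\<integral>t. (cmod (complex_of_real (indicator A t) - complex_of_real (indicator B t)))\<^sup>2 \<partial>lborel)"
    unfolding ind_def
    by (simp add: diff_abs_L2 norm_abs_L2 square_integrable_diff square_integrable_indicator A B)
  also have "\<dots> = (\<integral>t. indicator (A - B) t \<partial>lborel)"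
    using \<open>B \<subseteq> A\<close> by (intro Bochner_Integration.integral_cong) (auto simp: indicator_def)
  also have "\<dots> = measure lborel (A - B)"
    by simp
  also have "\<dots> = measure lborel A - measure lborel B"
    using assms by (intro measurable_measure_Diff) auto
  finally show ?thesis .
qed

lemma abs_L2_sum:
  assumes "finite I" "\<And>i. i \<in> I \<Longrightarrow> square_integrable (f i)"
  shows "square_integrable (\<lambda>t. \<Sum>i\<in>I. f i t) \<and> (\<Sum>i\<in>I. abs_L2 (f i)) = abs_L2 (\<lambda>t. \<Sum>i\<in>I. f i t)"
  using assms
proof (induction I rule: finite_induct)
  case empty
  then show ?case by (simp add: square_integrable_zero zero_L2.abs_eq)
next
  case (insert i I)
  then show ?case by (simp add: square_integrable_add plus_abs_L2)
qed

text \<open>Open sets suffice by outer regularity of Lebesgue measure and approximation of square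
  integrable functions by simple functions.\<close>

lemma total_ind_open:
  fixes V :: "'d::finite L2 set"
  assumes zero: "0 \<in> V" and add: "\<And>x y. x \<in> V \<Longrightarrow> y \<in> V \<Longrightarrow> x + y \<in> V"
    and scale: "\<And>c x. x \<in> V \<Longrightarrow> c *\<^sub>C x \<in> V"
    and "closed V"
    and ind_open: "\<And>U. open U \<Longrightarrow> U \<in> fmeasurable lborel \<Longrightarrow> ind U \<in> V"
  shows "V = UNIV"
proof -
  have V_sum: "(\<Sum>i\<in>I. x i) \<in> V" if "\<And>i. i \<in> I \<Longrightarrow> x i \<in> V" for I :: "complex set" and x
    using that by (induction I rule: infinite_finite_induct) (auto simp: zero add)
  have ind_V: "ind A \<in> V" if A: "A \<in> fmeasurable lborel" for A
  proof -
    have "ind A \<in> closure V"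
      unfolding closure_approachable
    proof (intro allI impI)
      fix e :: real assume e: "e > 0"
      have "A \<in> sets borel" using A by (simp add: fmeasurable_def)
      from outer_regular_lborel[OF this, of "e\<^sup>2"] obtain U where U: "open U" "A \<subseteq> U"
        and d: "emeasure lborel (U - A) < ennreal (e\<^sup>2)"
        using e by auto
      have "U - A \<in> fmeasurable lborel"
        using U(1) A d by (intro fmeasurableI) (auto simp: fmeasurable_def intro: less_trans)
      then have "A \<union> (U - A) \<in> fmeasurable lborel"
        using A by (intro fmeasurable.Un)
      then have Uf: "U \<in> fmeasurable lborel"
        using U(2) by (simp add: Un_absorb1)
      have "(norm (ind U - ind A))\<^sup>2 = measure lborel (U - A)"
        using measurable_measure_Diff[OF Uf, of A] norm_diff_ind[OF Uf A U(2)] A U(2)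
        by (simp add: fmeasurable_def)
      also have "\<dots> < e\<^sup>2"
      proof -
        have "ennreal (measure lborel (U - A)) < ennreal (e\<^sup>2)"
          using d by (metis emeasure_eq_ennreal_measure ennreal_less_top less_trans order_less_irrefl)
        then show ?thesis by (simp add: ennreal_less_iff)
      qed
      finally have "norm (ind U - ind A) < e"
        using e by (simp add: power_less_imp_less_base)
      then show "\<exists>y\<in>V. dist y (ind A) < e"
        using ind_open[OF U(1) Uf] by (auto simp: dist_norm)
    qed
    then show ?thesis using \<open>closed V\<close> by simp
  qed
  have "x \<in> V" for x
  proof -
    obtain f where f: "square_integrable f" "x = abs_L2 f" by (rule L2_cases)
    have fm [measurable]: "f \<in> borel_measurable borel"
      using f by (rule_tac measurable_square_integrable)
    then have "f \<in> borel_measurable lborel" by simp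
    from borel_measurable_implies_sequence_metric[OF this, of 0] obtain F where
      simple: "\<And>i. simple_function lborel (F i)"
      and lim: "\<And>t. (\<lambda>i. F i t) \<longlonglongrightarrow> f t"
      and le: "\<And>i t. cmod (F i t) \<le> 2 * cmod (f t)"
      unfolding norm_conv_dist by auto
    have Fm [measurable]: "F i \<in> borel_measurable borel" for i
      using borel_measurable_simple_function[OF simple] by simp
    have int: "integrable lborel (\<lambda>t. (cmod (f t))\<^sup>2)"
      using f by (simp add: square_integrable_def)
    have sqF: "square_integrable (F i)" for i
      unfolding square_integrable_def
    proof
      show "integrable lborel (\<lambda>t. (cmod (F i t))\<^sup>2)"
      proof (rule Bochner_Integration.integrable_bound[OF integrable_mult_right[OF int, of 4]])
        have "(cmod (F i t))\<^sup>2 \<le> 4 * (cmod (f t))\<^sup>2" for t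
          using power_mono[OF le[of i t], of 2] by (simp add: power_mult_distrib)
        then show "AE t in lborel. norm ((cmod (F i t))\<^sup>2) \<le> norm (4 * (cmod (f t))\<^sup>2)"
          by simp
      qed simp
    qed simp
    have "abs_L2 (F i) \<in> V" for i
    proof -
      let ?Y = "range (F i) - {0}"
      have fin: "finite ?Y"
        using simple_functionD(1)[OF simple, of i] by simp
      have meas: "F i -` {y} \<in> fmeasurable lborel" if "y \<in> ?Y" for y
      proof -
        have "integrable lborel (\<lambda>t. (cmod (F i t))\<^sup>2 / (cmod y)\<^sup>2)"
          using sqF[of i] by (auto simp: square_integrable_def)
        then have "integrable lborel (indicator (F i -` {y}) :: _ \<Rightarrow> real)"
          using that by (elim Bochner_Integration.integrable_bound) (auto simp: indicator_def)
        then show ?thesis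
          by (auto simp: fmeasurable_def integrable_indicator_iff less_top measurable_sets_borel)
      qed
      have "abs_L2 (F i) = abs_L2 (\<lambda>t. \<Sum>y\<in>?Y. y * complex_of_real (indicator (F i -` {y}) t))"
      proof (rule arg_cong[of _ _ abs_L2], rule ext)
        fix t
        have "(\<Sum>y\<in>?Y. y * complex_of_real (indicator (F i -` {y}) t)) =
            (\<Sum>y\<in>?Y. if y = F i t then y else 0)"
          by (intro sum.cong) (auto simp: indicator_def)
        also have "\<dots> = F i t" using fin by (subst sum.delta) auto
        finally show "F i t = (\<Sum>y\<in>?Y. y * complex_of_real (indicator (F i -` {y}) t))" by simp
      qed
      also have "\<dots> = (\<Sum>y\<in>?Y. y *\<^sub>C ind (F i -` {y}))"
        using abs_L2_sum[OF fin, of "\<lambda>y t. y * complex_of_real (indicator (F i -` {y}) t)"] meas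
        by (simp add: square_integrable_mult square_integrable_indicator ind_def cscale_abs_L2)
      also have "\<dots> \<in> V"
        using meas by (intro V_sum scale ind_V)
      finally show ?thesis .
    qed
    moreover have "(\<lambda>i. abs_L2 (F i)) \<longlonglongrightarrow> x"
    proof -
      have "(\<lambda>i. \<integral>t. (cmod (F i t - f t))\<^sup>2 \<partial>lborel) \<longlonglongrightarrow> (\<integral>t. 0 \<partial>(lborel :: (real^'d) measure))"
      \<comment> \<open>The factor 9 is (2 + 1) squared, as the simple functions satisfy |F i| <= 2 |f|.\<close>
      proof (rule integral_dominated_convergence[where w = "\<lambda>t. 9 * (cmod (f t))\<^sup>2"])
        show "AE t in lborel. (\<lambda>i. (cmod (F i t - f t))\<^sup>2) \<longlonglongrightarrow> 0"
        proof (intro AE_I2)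
          fix t
          have "(\<lambda>i. (cmod (F i t - f t))\<^sup>2) \<longlonglongrightarrow> (cmod (f t - f t))\<^sup>2"
            by (intro tendsto_intros lim)
          then show "(\<lambda>i. (cmod (F i t - f t))\<^sup>2) \<longlonglongrightarrow> 0" by simp
        qed
        show "AE t in lborel. norm ((cmod (F i t - f t))\<^sup>2) \<le> 9 * (cmod (f t))\<^sup>2" for i
        proof (intro AE_I2)
          fix t
          have "cmod (F i t - f t) \<le> 3 * cmod (f t)"
            using norm_triangle_ineq4[of "F i t" "f t"] le[of i t] by linarith
          from power_mono[OF this, of 2] show "norm ((cmod (F i t - f t))\<^sup>2) \<le> 9 * (cmod (f t))\<^sup>2"
            by (simp add: power_mult_distrib)
        qed
      qed (use int in auto)
      moreover have "(norm (abs_L2 (F i) - x))\<^sup>2 = (\<integral>t. (cmod (F i t - f t))\<^sup>2 \<partial>lborel)" for i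
        unfolding f(2) using sqF[of i] f(1)
        by (simp add: diff_abs_L2 norm_abs_L2 square_integrable_diff)
      ultimately have "(\<lambda>i. (norm (abs_L2 (F i) - x))\<^sup>2) \<longlonglongrightarrow> 0" by simp
      then have "(\<lambda>i. sqrt ((norm (abs_L2 (F i) - x))\<^sup>2)) \<longlonglongrightarrow> sqrt 0"
        by (rule tendsto_real_sqrt)
      then show ?thesis by (simp add: tendsto_norm_zero_iff LIM_zero_iff)
    qed
    ultimately show ?thesis
      using \<open>closed V\<close> by (intro closed_sequentially[of V "\<lambda>i. abs_L2 (F i)" x])
  qed
  then show ?thesis by auto
qed

section \<open>Separability and existence of an orthonormal basis\<close>

lemma cscale_span_closure:
  fixes S :: "'d::finite L2 set"
  assumes "x \<in> closure (span {c *\<^sub>C e |c e. e \<in> S})"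
  shows "a *\<^sub>C x \<in> closure (span {c *\<^sub>C e |c e. e \<in> S})"
proof -
  let ?G = "{c *\<^sub>C e |c e. e \<in> S}"
  interpret bounded_linear "\<lambda>x :: 'd L2. a *\<^sub>C x" by (rule bounded_linear_cscale)
  have "(\<lambda>x. a *\<^sub>C x) ` span ?G = span ((\<lambda>x. a *\<^sub>C x) ` ?G)"
    by (rule linear_span_image[symmetric]) (rule linear_axioms)
  also have "\<dots> \<subseteq> span ?G"
    by (intro span_mono) (force simp: cscale_cscale)
  finally have "closure ((\<lambda>x. a *\<^sub>C x) ` span ?G) \<subseteq> closure (span ?G)"
    by (rule closure_mono)
  with closure_bounded_linear_image_subset[OF bounded_linear_axioms, of "span ?G"] assms
  show ?thesis by blast
qed

lemma add_closure_span:
  fixes x y :: "'a::real_normed_vector"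
  assumes "x \<in> closure (span G)" "y \<in> closure (span G)"
  shows "x + y \<in> closure (span G)"
proof -
  obtain a b where ab: "\<And>n. a n \<in> span G" "a \<longlonglongrightarrow> x" "\<And>n. b n \<in> span G" "b \<longlonglongrightarrow> y"
    using assms unfolding closure_sequential by blast
  then have "(\<lambda>n. a n + b n) \<longlonglongrightarrow> x + y" "\<And>n. a n + b n \<in> span G"
    by (auto intro: tendsto_add span_add)
  then show ?thesis unfolding closure_sequential by (intro exI[of _ "\<lambda>n. a n + b n"]) simp
qed

text \<open>A countable total family consists of the indicators of finite unions of basic open sets, cut
  off by balls to have finite measure; they exhaust any open set of finite measure from inside.\<close>

lemma separable: "\<exists>e :: nat \<Rightarrow> 'd::finite L2. closure (span {c *\<^sub>C s |c s. s \<in> range e}) = UNIV"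
proof -
  obtain B :: "(real ^ 'd) set set" where B: "countable B" "topological_basis B"
    using ex_countable_basis by blast
  define \<U> where "\<U> = (\<lambda>(F, n). \<Union> F \<inter> ball 0 (real n)) ` ({F. finite F \<and> F \<subseteq> B} \<times> UNIV)"
  have "countable \<U>"
    unfolding \<U>_def by (intro countable_image countable_SIGMA countable_Collect_finite_subset B) auto
  moreover have "\<U> \<noteq> {}" unfolding \<U>_def by auto
  ultimately have range: "range (from_nat_into (ind ` \<U>)) = ind ` \<U>"
    by (intro range_from_nat_into) auto
  define V where "V = closure (span {c *\<^sub>C s |c s :: 'd L2. s \<in> ind ` \<U>})"
  have fm: "U \<in> fmeasurable lborel" if "U \<in> \<U>" for U
  proof -
    from that obtain F n where U: "U = \<Union> F \<inter> ball 0 (real n)" "F \<subseteq> B"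
      unfolding \<U>_def by auto
    have "open U" unfolding U(1) using U(2) topological_basis_open[OF B(2)]
      by (intro open_Int open_Union) auto
    moreover have "bounded U" unfolding U(1) by (intro bounded_Int) auto
    ultimately show ?thesis
      by (intro fmeasurableI emeasure_bounded_finite) auto
  qed
  have "V = UNIV"
  proof (rule total_ind_open)
    show "0 \<in> V"
      unfolding V_def by (rule subsetD[OF closure_subset]) (rule span_zero)
    show "\<And>x y. x \<in> V \<Longrightarrow> y \<in> V \<Longrightarrow> x + y \<in> V"
      unfolding V_def by (rule add_closure_span)
    show "\<And>c x. x \<in> V \<Longrightarrow> c *\<^sub>C x \<in> V"
      unfolding V_def by (rule cscale_span_closure)
    show "closed V" by (simp add: V_def)
  next
    fix U :: "(real ^ 'd) set" assume U: "open U" "U \<in> fmeasurable lborel"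
    have "\<exists>B'. B' \<subseteq> B \<and> \<Union> B' = U"
      using B(2) U(1) unfolding topological_basis_def by simp
    then obtain B' where B': "B' \<subseteq> B" "U = \<Union> B'" by auto
    have cB': "countable (insert {} B')"
      using B' B(1) countable_subset by auto
    define b where "b = from_nat_into (insert {} B')"
    have rb: "range b = insert {} B'"
      unfolding b_def using cB' by (intro range_from_nat_into) auto
    define W where "W n = \<Union> ((b ` {..<n}) \<inter> B) \<inter> ball 0 (real n)" for n
    have W\<U>: "W n \<in> \<U>" for n
      unfolding W_def \<U>_def by (auto intro!: image_eqI[of _ _ "((b ` {..<n}) \<inter> B, n)"])
    have incW: "incseq W"
      unfolding W_def incseq_def by (auto intro: less_le_trans)
    have UW: "(\<Union>n. W n) = U"
    proof
      show "(\<Union>n. W n) \<subseteq> U" unfolding W_def B'(2) using rb by auto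
      show "U \<subseteq> (\<Union>n. W n)"
      proof
        fix t assume "t \<in> U"
        then obtain X where X: "X \<in> B'" "t \<in> X" using B' by auto
        then obtain k where k: "X = b k" using rb by (metis insertCI rangeE)
        obtain m where m: "norm t < real m" using reals_Archimedean2 by blast
        have "t \<in> W (max (Suc k) m)"
          unfolding W_def using X k m B' by (auto simp: less_max_iff_disj)
        then show "t \<in> (\<Union>n. W n)" by blast
      qed
    qed
    have WU: "W n \<subseteq> U" for n using UW by auto
    have "(\<lambda>n. measure lborel (W n)) \<longlonglongrightarrow> measure lborel (\<Union>n. W n)"
      using fm[OF W\<U>] incW U(2) unfolding UW[symmetric]
      by (intro Lim_measure_incseq) (auto simp: fmeasurable_def)
    then have "(\<lambda>n. sqrt (measure lborel U - measure lborel (W n))) \<longlonglongrightarrow>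
        sqrt (measure lborel U - measure lborel U)"
      unfolding UW by (intro tendsto_intros)
    moreover have "sqrt (measure lborel U - measure lborel (W n)) = norm (ind U - ind (W n))" for n
      by (simp add: norm_diff_ind[OF U(2) fm[OF W\<U>] WU, symmetric])
    ultimately have "(\<lambda>n. norm (ind (W n) - ind U)) \<longlonglongrightarrow> 0"
      by (simp add: norm_minus_commute)
    then have lim: "(\<lambda>n. ind (W n)) \<longlonglongrightarrow> ind U"
      by (simp add: tendsto_norm_zero_iff LIM_zero_iff)
    have "ind (W n) \<in> V" for n
      unfolding V_def using W\<U>[of n]
      by (intro subsetD[OF closure_subset] span_base) (auto intro!: exI[of _ 1])
    with lim show "ind U \<in> V"
      using closed_sequentially[of V "\<lambda>n. ind (W n)"] by (auto simp: V_def)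
  qed
  then show ?thesis
    unfolding V_def using range by (intro exI[of _ "from_nat_into (ind ` \<U>)"]) simp
qed

theorem ex_onb: "\<exists>E :: 'd::finite L2 set. is_onb E"
proof -
  obtain e :: "nat \<Rightarrow> 'd L2" where "closure (span {c *\<^sub>C s |c s. s \<in> range e}) = UNIV"
    using separable by blast
  then have "L2.expandable (L2.gram_schmidt e) UNIV = UNIV"
    by (intro L2.exists_expansion[of "range e"]) auto
  from is_onb_of_expandable[OF L2.orthonormal_gram_schmidt this] show ?thesis by blast
qed

section \<open>Time-frequency shifts are unitary and strongly continuous\<close>

lemma integral_translate:
  fixes h :: "real ^ 'd::finite \<Rightarrow> complex"
  assumes [measurable]: "h \<in> borel_measurable borel"
  shows "(\<integral>t. h (t - x) \<partial>lborel) = (\<integral>t. h t \<partial>lborel)"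
proof -
  have "(\<integral>t. h t \<partial>lborel) = (\<integral>t. h t \<partial>distr lborel borel ((+) (- x)))"
    by (simp add: lborel_distr_plus)
  also have "\<dots> = (\<integral>t. h (- x + t) \<partial>lborel)"
    by (subst integral_distr) auto
  finally show ?thesis by (simp add: algebra_simps)
qed

lemma tf_shift_abs_L2:
  assumes "square_integrable f"
  shows "tf_shift (x, \<xi>) (abs_L2 f) = abs_L2 (\<lambda>t. cis (2 * pi * (\<xi> \<bullet> t)) * f (t - x))"
  using assms tf_shift.abs_eq[of f "(x, \<xi>)"] by (simp add: square_integrable_iff_ae_rel)

lemma tf_shift_add: "tf_shift z (f + g) = tf_shift z f + tf_shift z g"
proof (cases z)
  case (Pair x \<xi>)
  obtain f' g' where f: "square_integrable f'" "f = abs_L2 f'" and g: "square_integrable g'" "g = abs_L2 g'"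
    using L2_cases by metis
  show ?thesis
    unfolding f g Pair using f g
    by (simp add: plus_abs_L2 tf_shift_abs_L2 square_integrable_add square_integrable_tf_shift distrib_left)
qed

lemma tf_shift_cscale: "tf_shift z (c *\<^sub>C f) = c *\<^sub>C tf_shift z f"
proof (cases z)
  case (Pair x \<xi>)
  obtain f' where f: "square_integrable f'" "f = abs_L2 f'"
    using L2_cases by metis
  show ?thesis
    unfolding f Pair using f
    by (simp add: cscale_abs_L2 tf_shift_abs_L2 square_integrable_mult square_integrable_tf_shift mult.left_commute[of c])
qed

lemma tf_shift_diff: "tf_shift z (f - g) = tf_shift z f - tf_shift z g"
  by (simp add: minus_L2_def tf_shift_add tf_shift_cscale)

lemma cinner_tf_shift: "cinner (tf_shift z f) (tf_shift z g) = cinner f g"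
proof (cases z)
  case (Pair x \<xi>)
  obtain f' g' where f: "square_integrable f'" "f = abs_L2 f'" and g: "square_integrable g'" "g = abs_L2 g'"
    using L2_cases by metis
  note [measurable] = measurable_square_integrable[OF f(1)] measurable_square_integrable[OF g(1)]
  have c: "cis a * cnj (cis a) = 1" for a by (simp add: cis_cnj cis_mult)
  have "cinner (tf_shift z f) (tf_shift z g) =
      (\<integral>t. cis (2 * pi * (\<xi> \<bullet> t)) * f' (t - x) * cnj (cis (2 * pi * (\<xi> \<bullet> t)) * g' (t - x)) \<partial>lborel)"
    unfolding f(2) g(2) Pair using f(1) g(1)
    by (simp only: tf_shift_abs_L2 cinner_abs_L2 square_integrable_tf_shift)
  also have "\<dots> = (\<integral>t. f' (t - x) * cnj (g' (t - x)) \<partial>lborel)"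
  proof (intro Bochner_Integration.integral_cong refl)
    fix t
    have "cis (2 * pi * (\<xi> \<bullet> t)) * f' (t - x) * cnj (cis (2 * pi * (\<xi> \<bullet> t)) * g' (t - x)) =
        (cis (2 * pi * (\<xi> \<bullet> t)) * cnj (cis (2 * pi * (\<xi> \<bullet> t)))) * (f' (t - x) * cnj (g' (t - x)))"
      by (simp only: complex_cnj_mult mult_ac)
    then show "cis (2 * pi * (\<xi> \<bullet> t)) * f' (t - x) * cnj (cis (2 * pi * (\<xi> \<bullet> t)) * g' (t - x)) =
        f' (t - x) * cnj (g' (t - x))"
      by (simp only: c mult_1)
  qed
  also have "\<dots> = (\<integral>t. f' t * cnj (g' t) \<partial>lborel)"
    by (rule integral_translate[of "\<lambda>t. f' t * cnj (g' t)"]) measurable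
  also have "\<dots> = cinner f g"
    using f g by (simp add: cinner_abs_L2)
  finally show ?thesis .
qed

lemma norm_tf_shift: "norm (tf_shift z f) = norm f"
proof -
  have "complex_of_real ((norm (tf_shift z f))\<^sup>2) = complex_of_real ((norm f)\<^sup>2)"
    by (simp only: cinner_self[symmetric] cinner_tf_shift)
  then show ?thesis
    by (metis of_real_eq_iff norm_ge_zero power2_eq_imp_eq)
qed

lemma norm_diff_squared:
  fixes a b :: "'d::finite L2"
  shows "(norm (a - b))\<^sup>2 = (norm a)\<^sup>2 + (norm b)\<^sup>2 - 2 * Re (cinner a b)"
  by (simp add: power2_norm_eq_inner inner_diff_left inner_diff_right inner_commute[of b a])
     (simp add: inner_L2_def)

text \<open>The vectors on which the convergence holds form a closed subspace, because translations are
  isometries. For the indicator of an open set \<open>U\<close> it suffices that \<open>\<langle>\<tau> 1\<^sub>U, 1\<^sub>U\<rangle>\<close> tends to the measure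
  of \<open>U\<close>; this follows by dominated convergence, since \<open>t - X n\<close> lies in \<open>U\<close> eventually for every
  \<open>t \<in> U\<close>.\<close>

theorem translation_tendsto:
  fixes X :: "nat \<Rightarrow> real ^ 'd::finite"
  assumes X: "X \<longlonglongrightarrow> 0"
  shows "(\<lambda>n. tf_shift (X n, 0) f) \<longlonglongrightarrow> f"
proof -
  let ?\<tau> = "\<lambda>n. tf_shift (X n, 0) :: 'd L2 \<Rightarrow> 'd L2"
  define V where "V = {f :: 'd L2. (\<lambda>n. ?\<tau> n f) \<longlonglongrightarrow> f}"
  have "V = UNIV"
  proof (rule total_ind_open)
    show "0 \<in> V"
      using tf_shift_cscale[of _ 0 "0 :: 'd L2"] by (simp add: V_def)
    show "x + y \<in> V" if "x \<in> V" "y \<in> V" for x y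
      using that by (simp add: V_def tf_shift_add tendsto_add)
    show "c *\<^sub>C x \<in> V" if "x \<in> V" for c x
      using that bounded_linear.tendsto[OF bounded_linear_cscale, of "\<lambda>n. ?\<tau> n x" x sequentially c]
      by (simp add: V_def tf_shift_cscale)
    show "closed V"
    proof (rule closed_sequential_limits[THEN iffD2], intro allI impI, elim conjE)
      fix g l assume g: "\<forall>n. g n \<in> V" and lim: "g \<longlonglongrightarrow> l"
      have "(\<lambda>n. ?\<tau> n l) \<longlonglongrightarrow> l"
      proof (rule LIMSEQ_I)
        fix r :: real assume r: "r > 0"
        then obtain m where m: "norm (g m - l) < r / 3"
          using LIMSEQ_D[OF lim, of "r / 3"] by auto
        have "(\<lambda>n. ?\<tau> n (g m)) \<longlonglongrightarrow> g m" using g by (simp add: V_def)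
        then obtain N where N: "\<And>n. n \<ge> N \<Longrightarrow> norm (?\<tau> n (g m) - g m) < r / 3"
          using LIMSEQ_D[of _ _ "r / 3"] r by (metis divide_pos_pos zero_less_numeral)
        have "norm (?\<tau> n l - l) < r" if "n \<ge> N" for n
        proof -
          have "?\<tau> n l - l = ?\<tau> n (l - g m) + (?\<tau> n (g m) - g m) + (g m - l)"
            by (simp add: tf_shift_diff)
          then have "norm (?\<tau> n l - l) \<le>
              norm (?\<tau> n (l - g m)) + norm (?\<tau> n (g m) - g m) + norm (g m - l)"
            using norm_triangle_ineq[of "?\<tau> n (l - g m) + (?\<tau> n (g m) - g m)" "g m - l"]
              norm_triangle_ineq[of "?\<tau> n (l - g m)" "?\<tau> n (g m) - g m"] by (simp only:)
          then show ?thesis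
            using N[OF that] m by (simp add: norm_tf_shift norm_minus_commute)
        qed
        then show "\<exists>no. \<forall>n\<ge>no. norm (?\<tau> n l - l) < r" by blast
      qed
      then show "l \<in> V" by (simp add: V_def)
    qed
  next
    fix U :: "(real ^ 'd) set" assume U: "open U" "U \<in> fmeasurable lborel"
    have [measurable]: "U \<in> sets borel" using U by simp
    note sq = square_integrable_indicator[OF U(2)]
    let ?m = "complex_of_real (measure lborel U)"
    have "cinner (?\<tau> n (ind U)) (ind U) =
        (\<integral>t. complex_of_real (indicator U (t - X n) * indicator U t) \<partial>lborel)" for n
      unfolding ind_def tf_shift_abs_L2[OF sq]
        cinner_abs_L2[OF square_integrable_tf_shift[OF sq] sq]
      by (intro Bochner_Integration.integral_cong) (auto simp: indicator_def)
    moreover have "(\<lambda>n. \<integral>t. complex_of_real (indicator U (t - X n) * indicator U t) \<partial>lborel)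
        \<longlonglongrightarrow> (\<integral>t. complex_of_real (indicator U t) \<partial>lborel)"
    proof (rule integral_dominated_convergence[where w = "indicator U"])
      show "integrable lborel (indicator U :: _ \<Rightarrow> real)"
        using U(2) by (simp add: fmeasurable_def)
      show "AE t in lborel. (\<lambda>n. complex_of_real (indicator U (t - X n) * indicator U t))
          \<longlonglongrightarrow> complex_of_real (indicator U t)"
      proof (intro AE_I2)
        fix t
        show "(\<lambda>n. complex_of_real (indicator U (t - X n) * indicator U t))
          \<longlonglongrightarrow> complex_of_real (indicator U t)"
        proof (cases "t \<in> U")
          case True
          have "(\<lambda>n. t - X n) \<longlonglongrightarrow> t - 0"
            by (intro tendsto_diff tendsto_const X)
          then have "\<forall>\<^sub>F n in sequentially. t - X n \<in> U"
            using U(1) True by (auto dest: topological_tendstoD)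
          then show ?thesis
            by (intro tendsto_eventually) (auto elim!: eventually_mono simp: True)
        qed simp
      qed
    qed (auto simp: indicator_def)
    moreover have "(\<integral>t. complex_of_real (indicator U t) \<partial>lborel) = ?m"
      by simp
    ultimately have lim: "(\<lambda>n. cinner (?\<tau> n (ind U)) (ind U)) \<longlonglongrightarrow> ?m"
      by (simp only:)
    have norm_U: "(norm (ind U))\<^sup>2 = measure lborel U"
    proof -
      have "(norm (ind U))\<^sup>2 = (\<integral>t. indicator U t \<partial>lborel)"
        unfolding ind_def norm_abs_L2[OF sq]
        by (intro Bochner_Integration.integral_cong) (auto simp: indicator_def)
      then show ?thesis by simp
    qed
    have "(\<lambda>n. (norm (ind U))\<^sup>2 + (norm (ind U))\<^sup>2 - 2 * Re (cinner (?\<tau> n (ind U)) (ind U)))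
        \<longlonglongrightarrow> (norm (ind U))\<^sup>2 + (norm (ind U))\<^sup>2 - 2 * Re ?m"
      by (intro tendsto_intros lim)
    then have "(\<lambda>n. (norm (?\<tau> n (ind U) - ind U))\<^sup>2) \<longlonglongrightarrow> 0"
      unfolding norm_diff_squared norm_tf_shift by (simp add: norm_U)
    then have "(\<lambda>n. sqrt ((norm (?\<tau> n (ind U) - ind U))\<^sup>2)) \<longlonglongrightarrow> sqrt 0"
      by (rule tendsto_real_sqrt)
    then show "ind U \<in> V"
      by (simp add: V_def tendsto_norm_zero_iff LIM_zero_iff)
  qed
  then show ?thesis by (auto simp: V_def)
qed

section \<open>The Fourier transform of the Gaussian\<close>

lemma measurable_cis [measurable]: "cis \<in> borel_measurable borel"
  by (intro borel_measurable_continuous_onI continuous_intros)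

lemma
  fixes f :: "'a::euclidean_space \<Rightarrow> real \<Rightarrow> complex"
  assumes int: "\<And>b. b \<in> Basis \<Longrightarrow> integrable lborel (f b)"
  shows integrable_lborel_prod: "integrable lborel (\<lambda>x::'a. \<Prod>b\<in>Basis. f b (x \<bullet> b))"
    and integral_lborel_prod:
      "(\<integral>x. (\<Prod>b\<in>Basis. f b (x \<bullet> b)) \<partial>(lborel :: 'a measure)) = (\<Prod>b\<in>Basis. (\<integral>x. f b x \<partial>lborel))"
proof -
  interpret product_sigma_finite "\<lambda>_::'a. lborel :: real measure" ..
  have [measurable]: "f b \<in> borel_measurable borel" if "b \<in> Basis" for b
    using int[OF that] by auto
  have coord: "(\<Prod>b\<in>Basis. f b ((\<Sum>c\<in>Basis. g c *\<^sub>R c) \<bullet> b)) = (\<Prod>b\<in>Basis. f b (g b))" for g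
    by (intro prod.cong) auto
  show "integrable lborel (\<lambda>x::'a. \<Prod>b\<in>Basis. f b (x \<bullet> b))"
    unfolding lborel_eq[where 'a='a]
    by (subst integrable_distr_eq) (auto simp: coord intro!: product_integrable_prod int)
  show "(\<integral>x. (\<Prod>b\<in>Basis. f b (x \<bullet> b)) \<partial>(lborel :: 'a measure)) = (\<Prod>b\<in>Basis. (\<integral>x. f b x \<partial>lborel))"
    unfolding lborel_eq[where 'a='a]
    by (subst integral_distr) (auto simp: coord intro!: product_integral_prod int)
qed

definition gaussian :: "'a::euclidean_space \<Rightarrow> real" where
  "gaussian y = exp (- (norm y)\<^sup>2 / 2)"

lemma gaussian_nonneg [simp]: "0 \<le> gaussian y"
  and gaussian_0 [simp]: "gaussian 0 = 1"
  by (simp_all add: gaussian_def)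

lemma measurable_gaussian [measurable]: "gaussian \<in> borel_measurable borel"
  unfolding gaussian_def by measurable

lemma gaussian_eq_prod: "gaussian y = (\<Prod>b\<in>Basis. exp (- (y \<bullet> b)\<^sup>2 / 2))"
proof -
  have "(norm y)\<^sup>2 = (\<Sum>b\<in>Basis. (y \<bullet> b)\<^sup>2)"
    by (subst power2_norm_eq_inner, subst euclidean_inner) (simp add: power2_eq_square)
  then show ?thesis
    by (simp add: gaussian_def exp_sum[symmetric] sum_negf sum_divide_distrib)
qed

lemma cis_sum: "cis (\<Sum>i\<in>I. f i) = (\<Prod>i\<in>I. cis (f i))"
  by (induction I rule: infinite_finite_induct) (auto simp: cis_mult[symmetric])

text \<open>The one-dimensional transform is the characteristic function of the standard normal
  distribution; in higher dimension the integrand factors over the coordinates.\<close>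

lemma
  fixes t :: real
  shows integrable_gauss_real: "integrable lborel (\<lambda>x. complex_of_real (exp (- x\<^sup>2 / 2)) * cis (x * t))"
    and integral_gauss_real:
      "(\<integral>x. complex_of_real (exp (- x\<^sup>2 / 2)) * cis (x * t) \<partial>lborel) =
         complex_of_real (sqrt (2 * pi) * exp (- t\<^sup>2 / 2))"
proof -
  have dens: "exp (- x\<^sup>2 / 2) = sqrt (2 * pi) * std_normal_density x" for x :: real
    by (simp add: std_normal_density_def)
  have "integrable lborel (\<lambda>x. sqrt (2 * pi) * std_normal_density x)"
    using integrable_std_normal_moment[of 0] by simp
  then have "integrable lborel (\<lambda>x::real. exp (- x\<^sup>2 / 2))"
    unfolding dens[symmetric] .
  then show "integrable lborel (\<lambda>x. complex_of_real (exp (- x\<^sup>2 / 2)) * cis (x * t))"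
    by (rule Bochner_Integration.integrable_bound) (auto simp: norm_mult)
  have "complex_of_real (exp (- t\<^sup>2 / 2)) = (\<integral>x. std_normal_density x *\<^sub>R iexp (t * x) \<partial>lborel)"
    using fun_cong[OF char_std_normal_distribution, of t]
    by (simp add: char_def integral_density)
  also have "\<dots> = (\<integral>x. complex_of_real (std_normal_density x) * cis (x * t) \<partial>lborel)"
    by (simp add: cis_conv_exp scaleR_conv_of_real mult_ac)
  finally have "complex_of_real (sqrt (2 * pi)) * complex_of_real (exp (- t\<^sup>2 / 2)) =
      (\<integral>x. complex_of_real (sqrt (2 * pi)) * (complex_of_real (std_normal_density x) * cis (x * t)) \<partial>lborel)"
    by simp
  then show "(\<integral>x. complex_of_real (exp (- x\<^sup>2 / 2)) * cis (x * t) \<partial>lborel) =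
         complex_of_real (sqrt (2 * pi) * exp (- t\<^sup>2 / 2))"
    unfolding dens by (simp add: mult.assoc)
qed

lemma
  fixes u :: "'a::euclidean_space"
  shows integrable_gaussian_cis: "integrable lborel (\<lambda>x::'a. complex_of_real (gaussian x) * cis (x \<bullet> u))"
    and fourier_gaussian: "(\<integral>x. complex_of_real (gaussian x) * cis (x \<bullet> u) \<partial>(lborel :: 'a measure)) =
      complex_of_real (sqrt (2 * pi) ^ DIM('a) * gaussian u)"
proof -
  let ?f = "\<lambda>b x. complex_of_real (exp (- x\<^sup>2 / 2)) * cis (x * (u \<bullet> b))"
  have eq: "complex_of_real (gaussian x) * cis (x \<bullet> u) = (\<Prod>b\<in>Basis. ?f b (x \<bullet> b))" for x :: 'a
    by (subst euclidean_inner) (simp add: cis_sum gaussian_eq_prod prod.distrib)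
  show "integrable lborel (\<lambda>x::'a. complex_of_real (gaussian x) * cis (x \<bullet> u))"
    unfolding eq by (intro integrable_lborel_prod integrable_gauss_real)
  have "(\<integral>x. complex_of_real (gaussian x) * cis (x \<bullet> u) \<partial>(lborel :: 'a measure)) =
      (\<Prod>b\<in>(Basis :: 'a set). complex_of_real (sqrt (2 * pi) * exp (- (u \<bullet> b)\<^sup>2 / 2)))"
    unfolding eq
    by (subst integral_lborel_prod[OF integrable_gauss_real]) (simp only: integral_gauss_real)
  also have "\<dots> = complex_of_real (sqrt (2 * pi) ^ DIM('a) * gaussian u)"
    by (simp add: gaussian_eq_prod prod.distrib)
  finally show "(\<integral>x. complex_of_real (gaussian x) * cis (x \<bullet> u) \<partial>(lborel :: 'a measure)) =
      complex_of_real (sqrt (2 * pi) ^ DIM('a) * gaussian u)" .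
qed

lemma integrable_gaussian: "integrable lborel (gaussian :: 'a::euclidean_space \<Rightarrow> real)"
  using integrable_norm[OF integrable_gaussian_cis[of 0]] by simp

lemma integral_gaussian:
  "(\<integral>x. gaussian x \<partial>(lborel :: 'a::euclidean_space measure)) = sqrt (2 * pi) ^ DIM('a)"
proof -
  have "complex_of_real (\<integral>x. gaussian x \<partial>(lborel :: 'a measure)) = complex_of_real (sqrt (2 * pi) ^ DIM('a))"
    using fourier_gaussian[of "0::'a"] by simp
  then show ?thesis by (simp only: of_real_eq_iff)
qed

section \<open>Affine substitutions\<close>

lemma
  fixes h :: "'a::euclidean_space \<Rightarrow> 'b::{banach, second_countable_topology}"
  assumes [measurable]: "h \<in> borel_measurable borel" and c: "c \<noteq> 0"
  shows integral_affine: "(\<integral>x. h x \<partial>lborel) = \<bar>c\<bar> ^ DIM('a) *\<^sub>R (\<integral>x. h (t + c *\<^sub>R x) \<partial>lborel)"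
    and integrable_affine: "integrable lborel (\<lambda>x. h (t + c *\<^sub>R x)) \<longleftrightarrow> integrable lborel h"
proof -
  let ?T = "\<lambda>x::'a. t + c *\<^sub>R x"
  have eq: "lborel = density (distr lborel borel ?T) (\<lambda>_. ennreal (\<bar>c\<bar> ^ DIM('a)))"
    using lborel_affine[OF c, of t] by (simp add: ennreal_power)
  have "(\<integral>x. h x \<partial>lborel) = (\<integral>x. \<bar>c\<bar> ^ DIM('a) *\<^sub>R h x \<partial>distr lborel borel ?T)"
    by (subst eq, subst integral_density) auto
  also have "\<dots> = \<bar>c\<bar> ^ DIM('a) *\<^sub>R (\<integral>x. h (?T x) \<partial>lborel)"
    by (subst integral_distr) auto
  finally show "(\<integral>x. h x \<partial>lborel) = \<bar>c\<bar> ^ DIM('a) *\<^sub>R (\<integral>x. h (?T x) \<partial>lborel)" .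
  have "integrable lborel h \<longleftrightarrow> integrable (distr lborel borel ?T) (\<lambda>x. \<bar>c\<bar> ^ DIM('a) *\<^sub>R h x)"
    by (subst eq, subst integrable_density) auto
  also have "\<dots> \<longleftrightarrow> integrable lborel (\<lambda>x. \<bar>c\<bar> ^ DIM('a) *\<^sub>R h (?T x))"
    by (subst integrable_distr_eq) auto
  also have "\<dots> \<longleftrightarrow> integrable lborel (\<lambda>x. h (?T x))"
  proof
    assume "integrable lborel (\<lambda>x. \<bar>c\<bar> ^ DIM('a) *\<^sub>R h (?T x))"
    then have "integrable lborel (\<lambda>x. (1 / \<bar>c\<bar> ^ DIM('a)) *\<^sub>R (\<bar>c\<bar> ^ DIM('a) *\<^sub>R h (?T x)))"
      by (rule integrable_scaleR_right)
    then show "integrable lborel (\<lambda>x. h (?T x))" using c by simp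
  qed (rule integrable_scaleR_right)
  finally show "integrable lborel (\<lambda>x. h (?T x)) \<longleftrightarrow> integrable lborel h" by simp
qed

lemma
  fixes h :: "'a::euclidean_space \<Rightarrow> 'b::{banach, second_countable_topology}"
  assumes "h \<in> borel_measurable borel"
  shows integral_reflect: "(\<integral>u. h (t - u) \<partial>lborel) = (\<integral>u. h u \<partial>lborel)"
    and integrable_reflect: "integrable lborel (\<lambda>u. h (t - u)) \<longleftrightarrow> integrable lborel h"
  using integral_affine[OF assms, of "-1" t] integrable_affine[OF assms, of "-1" t] by simp_all

section \<open>Plancherel's theorem\<close>

definition ft :: "(real ^ 'd \<Rightarrow> complex) \<Rightarrow> real ^ 'd::finite \<Rightarrow> complex" where
  "ft F \<xi> = (\<integral>t. F t * cis (- (2 * pi * (\<xi> \<bullet> t))) \<partial>lborel)"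

definition autocorr :: "(real ^ 'd \<Rightarrow> complex) \<Rightarrow> real ^ 'd::finite \<Rightarrow> complex" where
  "autocorr F u = (\<integral>t. F t * cnj (F (t - u)) \<partial>lborel)"

lemma integrable_times_cis:
  fixes F :: "'a::euclidean_space \<Rightarrow> complex"
  assumes "integrable lborel F" and [measurable]: "g \<in> borel_measurable borel"
  shows "integrable lborel (\<lambda>t. F t * cis (g t))"
proof (rule Bochner_Integration.integrable_bound[OF assms(1)])
  show "(\<lambda>t. F t * cis (g t)) \<in> borel_measurable lborel"
    using borel_measurable_integrable[OF assms(1)] by measurable
qed (simp add: norm_mult)

lemma measurable_ft [measurable]:
  fixes F :: "real ^ 'd::finite \<Rightarrow> complex"
  assumes [measurable]: "F \<in> borel_measurable borel"
  shows "ft F \<in> borel_measurable borel"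
  unfolding ft_def by measurable

lemma norm_ft_le: "cmod (ft F \<xi>) \<le> (\<integral>t. cmod (F t) \<partial>lborel)"
proof -
  have "cmod (ft F \<xi>) \<le> (\<integral>t. cmod (F t * cis (- (2 * pi * (\<xi> \<bullet> t)))) \<partial>lborel)"
    unfolding ft_def by (rule integral_norm_bound)
  then show ?thesis by (simp add: norm_mult)
qed

text \<open>The convolution theorem: substituting \<open>t - u\<close> for the second variable of the double integral
  separates it into a product of the transform with its conjugate.\<close>

lemma
  fixes F :: "real ^ 'd::finite \<Rightarrow> complex"
  assumes int: "integrable lborel F"
  shows integrable_autocorr: "integrable lborel (autocorr F)"
    and ft_autocorr: "ft (autocorr F) \<xi> = complex_of_real ((cmod (ft F \<xi>))\<^sup>2)"
proof -
  have [measurable]: "F \<in> borel_measurable borel" using int by auto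
  let ?e = "\<lambda>t. cis (- (2 * pi * (\<xi> \<bullet> t)))"
  define k where "k = (\<lambda>t u. F t * cnj (F (t - u)))"
  have k: "integrable (lborel \<Otimes>\<^sub>M lborel) (case_prod k)"
  proof (rule lborel_pair.Fubini_integrable)
    show "case_prod k \<in> borel_measurable (lborel \<Otimes>\<^sub>M lborel)"
      unfolding k_def by measurable
    have "(\<integral>u. norm (case (t, u) of (t, u) \<Rightarrow> k t u) \<partial>lborel) =
        cmod (F t) * (\<integral>u. cmod (F u) \<partial>lborel)" for t
      using integral_reflect[of "\<lambda>u. cmod (F u)" t] by (simp add: k_def norm_mult)
    then show "integrable lborel (\<lambda>t. \<integral>u. norm (case (t, u) of (t, u) \<Rightarrow> k t u) \<partial>lborel)"
      using int by simp
    have "integrable lborel (\<lambda>u. k t u)" for t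
      unfolding k_def using int by (intro integrable_mult_right integrable_cnj) (simp add: integrable_reflect)
    then show "AE t in lborel. integrable lborel (\<lambda>u. case (t, u) of (t, u) \<Rightarrow> k t u)"
      by simp
  qed
  have "autocorr F = (\<lambda>u. \<integral>t. k t u \<partial>lborel)"
    by (simp add: fun_eq_iff autocorr_def k_def)
  then show "integrable lborel (autocorr F)"
    using lborel_pair.integrable_snd[OF k] by simp
  define ke where "ke = (\<lambda>t u. k t u * ?e u)"
  have ke: "integrable (lborel \<Otimes>\<^sub>M lborel) (case_prod ke)"
    by (rule Bochner_Integration.integrable_bound[OF k])
       (auto simp: ke_def k_def norm_mult)
  have split: "ke t u = (F t * ?e t) * cnj (F (t - u) * ?e (t - u))" for t u
  proof -
    have "?e u = ?e t * cnj (?e (t - u))"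
      by (simp add: cis_cnj cis_mult inner_diff_right algebra_simps)
    then show ?thesis unfolding ke_def k_def by simp
  qed
  have "ft (autocorr F) \<xi> = (\<integral>u. (\<integral>t. ke t u \<partial>lborel) \<partial>lborel)"
    unfolding ft_def autocorr_def ke_def k_def by simp
  also have "\<dots> = (\<integral>t. (\<integral>u. ke t u \<partial>lborel) \<partial>lborel)"
    by (rule lborel_pair.Fubini_integral[OF ke])
  also have "\<dots> = (\<integral>t. (F t * ?e t) * cnj (ft F \<xi>) \<partial>lborel)"
  proof (intro Bochner_Integration.integral_cong refl)
    fix t
    have "(\<integral>u. ke t u \<partial>lborel) = (F t * ?e t) * cnj (\<integral>u. F (t - u) * ?e (t - u) \<partial>lborel)"
      unfolding split by (simp only: integral_mult_right_zero Bochner_Integration.integral_cnj)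
    also have "(\<integral>u. F (t - u) * ?e (t - u) \<partial>lborel) = ft F \<xi>"
      unfolding ft_def by (rule integral_reflect[of "\<lambda>t. F t * ?e t" t]) measurable
    finally show "(\<integral>u. ke t u \<partial>lborel) = (F t * ?e t) * cnj (ft F \<xi>)" .
  qed
  also have "\<dots> = ft F \<xi> * cnj (ft F \<xi>)"
    unfolding ft_def by (simp only: integral_mult_left_zero)
  finally show "ft (autocorr F) \<xi> = complex_of_real ((cmod (ft F \<xi>))\<^sup>2)"
    by (simp only: complex_norm_square)
qed

lemma autocorr_eq_cinner:
  assumes "square_integrable F"
  shows "autocorr F u = cinner (abs_L2 F) (tf_shift (u, 0) (abs_L2 F))"
  using square_integrable_tf_shift[OF assms, of 0 u]
  by (simp add: autocorr_def tf_shift_abs_L2 cinner_abs_L2 assms)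

text \<open>The energy density is the Fourier transform of the autocorrelation, so Fubini's theorem moves
  the transform to the Gaussian, whose width is inverted: a wide Gaussian weight on the left averages
  the autocorrelation near the origin on the right.\<close>

lemma gaussian_average_energy:
  fixes F :: "real ^ 'd::finite \<Rightarrow> complex"
  assumes int: "integrable lborel F" and s: "s > 0"
  shows "complex_of_real (\<integral>\<xi>. (cmod (ft F \<xi>))\<^sup>2 * gaussian (\<xi> /\<^sub>R s) \<partial>lborel) =
    complex_of_real (1 / sqrt (2 * pi) ^ DIM(real ^ 'd)) *
      (\<integral>y. autocorr F (y /\<^sub>R (2 * pi * s)) * complex_of_real (gaussian y) \<partial>lborel)"
proof -
  let ?D = "DIM(real ^ 'd)"
  let ?\<kappa> = "sqrt (2 * pi) ^ ?D"
  have [measurable]: "F \<in> borel_measurable borel" using int by auto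
  note R = integrable_autocorr[OF int]
  have [measurable]: "autocorr F \<in> borel_measurable borel" using R by auto
  define k where "k = (\<lambda>\<xi> u. complex_of_real (gaussian \<xi>) * (autocorr F u * cis (- (2 * pi * ((s *\<^sub>R \<xi>) \<bullet> u)))))"
  have k: "integrable (lborel \<Otimes>\<^sub>M lborel) (case_prod k)"
  proof (rule lborel_pair.Fubini_integrable)
    show "case_prod k \<in> borel_measurable (lborel \<Otimes>\<^sub>M lborel)"
      unfolding k_def by measurable
    have "(\<integral>u. norm (case (\<xi>, u) of (\<xi>, u) \<Rightarrow> k \<xi> u) \<partial>lborel) =
        gaussian \<xi> * (\<integral>u. cmod (autocorr F u) \<partial>lborel)" for \<xi>
      by (simp add: k_def norm_mult)
    then show "integrable lborel (\<lambda>\<xi>. \<integral>u. norm (case (\<xi>, u) of (\<xi>, u) \<Rightarrow> k \<xi> u) \<partial>lborel)"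
      by (simp add: integrable_gaussian)
    have "integrable lborel (\<lambda>u. k \<xi> u)" for \<xi>
      unfolding k_def by (intro integrable_mult_right integrable_times_cis R) measurable
    then show "AE \<xi> in lborel. integrable lborel (\<lambda>u. case (\<xi>, u) of (\<xi>, u) \<Rightarrow> k \<xi> u)"
      by simp
  qed
  have inner1: "(\<integral>u. k \<xi> u \<partial>lborel) = complex_of_real ((cmod (ft F (s *\<^sub>R \<xi>)))\<^sup>2 * gaussian \<xi>)" for \<xi>
    using ft_autocorr[OF int, of "s *\<^sub>R \<xi>"] unfolding k_def ft_def by simp
  have inner2: "(\<integral>\<xi>. k \<xi> u \<partial>lborel) =
      autocorr F u * complex_of_real (?\<kappa> * gaussian ((2 * pi * s) *\<^sub>R u))" for u
  proof -
    have "(\<integral>\<xi>. k \<xi> u \<partial>lborel) =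
        (\<integral>\<xi>. autocorr F u * (complex_of_real (gaussian \<xi>) * cis (\<xi> \<bullet> (- (2 * pi * s) *\<^sub>R u))) \<partial>lborel)"
      unfolding k_def by (intro Bochner_Integration.integral_cong) (auto simp: mult_ac)
    also have "\<dots> = autocorr F u * complex_of_real (?\<kappa> * gaussian (- (2 * pi * s) *\<^sub>R u))"
      by (simp only: integral_mult_right_zero fourier_gaussian)
    finally show ?thesis by (simp add: gaussian_def)
  qed
  have "complex_of_real (\<integral>\<xi>. (cmod (ft F \<xi>))\<^sup>2 * gaussian (\<xi> /\<^sub>R s) \<partial>lborel) =
      complex_of_real (s ^ ?D * (\<integral>\<xi>. (cmod (ft F (s *\<^sub>R \<xi>)))\<^sup>2 * gaussian \<xi> \<partial>lborel))"
    using s by (subst integral_affine[of _ s 0]) auto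
  also have "\<dots> = complex_of_real (s ^ ?D) * (\<integral>\<xi>. (\<integral>u. k \<xi> u \<partial>lborel) \<partial>lborel)"
    unfolding inner1 integral_complex_of_real by (rule of_real_mult)
  also have "(\<integral>\<xi>. (\<integral>u. k \<xi> u \<partial>lborel) \<partial>lborel) = (\<integral>u. (\<integral>\<xi>. k \<xi> u \<partial>lborel) \<partial>lborel)"
    by (rule lborel_pair.Fubini_integral[OF k, symmetric])
  also have "\<dots> = complex_of_real ?\<kappa> *
      (\<integral>u. autocorr F u * complex_of_real (gaussian ((2 * pi * s) *\<^sub>R u)) \<partial>lborel)"
    unfolding inner2 of_real_mult mult.left_commute[of "autocorr F _"]
    by (rule integral_mult_right_zero)
  also have "(\<integral>u. autocorr F u * complex_of_real (gaussian ((2 * pi * s) *\<^sub>R u)) \<partial>lborel) =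
      complex_of_real ((1 / (2 * pi * s)) ^ ?D) *
      (\<integral>y. autocorr F (y /\<^sub>R (2 * pi * s)) * complex_of_real (gaussian y) \<partial>lborel)"
  proof -
    define c where "c = 1 / (2 * pi * s)"
    have c: "c > 0" and cs: "2 * pi * s * c = 1" "inverse (2 * pi * s) = c"
      using s by (simp_all add: c_def inverse_eq_divide)
    have "(\<integral>u. autocorr F u * complex_of_real (gaussian ((2 * pi * s) *\<^sub>R u)) \<partial>lborel) =
        \<bar>c\<bar> ^ ?D *\<^sub>R (\<integral>y. autocorr F (0 + c *\<^sub>R y) *
          complex_of_real (gaussian ((2 * pi * s) *\<^sub>R (0 + c *\<^sub>R y))) \<partial>lborel)"
      using c by (intro integral_affine) auto
    then show ?thesis
      unfolding c_def[symmetric] cs using c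
      by (simp only: add_0 scaleR_scaleR cs scaleR_one abs_of_pos scaleR_conv_of_real[where 'a = complex])
  qed
  finally have "complex_of_real (\<integral>\<xi>. (cmod (ft F \<xi>))\<^sup>2 * gaussian (\<xi> /\<^sub>R s) \<partial>lborel) =
      complex_of_real (s ^ ?D * (?\<kappa> * (1 / (2 * pi * s)) ^ ?D)) *
      (\<integral>y. autocorr F (y /\<^sub>R (2 * pi * s)) * complex_of_real (gaussian y) \<partial>lborel)"
    by (simp only: of_real_mult mult.assoc)
  also have "s ^ ?D * (?\<kappa> * (1 / (2 * pi * s)) ^ ?D) = (s * (sqrt (2 * pi) * (1 / (2 * pi * s)))) ^ ?D"
    by (simp only: power_mult_distrib)
  also have "s * (sqrt (2 * pi) * (1 / (2 * pi * s))) = 1 / sqrt (2 * pi)"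
    using s by (simp add: real_div_sqrt field_simps)
  finally show ?thesis
    by (simp add: power_divide)
qed

text \<open>As \<open>s\<close> tends to infinity in \<open>gaussian_average_energy\<close>, the weights on the left increase to 1, while
  on the right the autocorrelation is evaluated closer and closer to the origin, where it is
  continuous with value \<open>\<parallel>F\<parallel>\<^sup>2\<close>.\<close>

theorem Plancherel:
  fixes F :: "real ^ 'd::finite \<Rightarrow> complex"
  assumes int: "integrable lborel F" and sq: "square_integrable F"
  shows "(\<integral>\<^sup>+\<xi>. ennreal ((cmod (ft F \<xi>))\<^sup>2) \<partial>lborel) = ennreal (\<integral>t. (cmod (F t))\<^sup>2 \<partial>lborel)"
proof -
  let ?\<kappa> = "sqrt (2 * pi) ^ DIM(real ^ 'd)"
  let ?N = "\<integral>t. (cmod (F t))\<^sup>2 \<partial>lborel"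
  define f where "f = abs_L2 F"
  have [measurable]: "F \<in> borel_measurable borel" using int by auto
  have [measurable]: "autocorr F \<in> borel_measurable borel"
    using integrable_autocorr[OF int] by auto
  have R0: "autocorr F 0 = complex_of_real ?N"
    unfolding autocorr_def by (simp add: integral_mult_cnj_self)
  define s where "s n = real (Suc n)" for n
  have s: "s n > 0" for n by (simp add: s_def)
  have R_lim: "(\<lambda>n. autocorr F (y /\<^sub>R (2 * pi * s n))) \<longlonglongrightarrow> autocorr F 0" for y
  proof -
    have "(\<lambda>n. inverse (2 * pi) * inverse (real (Suc n))) \<longlonglongrightarrow> inverse (2 * pi) * 0"
      by (intro tendsto_mult tendsto_const LIMSEQ_inverse_real_of_nat)
    then have "(\<lambda>n. inverse (2 * pi * s n)) \<longlonglongrightarrow> 0"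
      by (simp add: s_def)
    then have "(\<lambda>n. y /\<^sub>R (2 * pi * s n)) \<longlonglongrightarrow> 0 *\<^sub>R y"
      by (intro tendsto_scaleR tendsto_const)
    then have "(\<lambda>n. tf_shift (y /\<^sub>R (2 * pi * s n), 0) f) \<longlonglongrightarrow> f"
      by (intro translation_tendsto) simp
    moreover have "tf_shift (0, 0) f = f"
      using translation_tendsto[of "\<lambda>_. 0" f] by (simp add: LIMSEQ_const_iff)
    ultimately show ?thesis
      unfolding autocorr_eq_cinner[OF sq] f_def[symmetric]
      using bounded_linear.tendsto[OF bounded_linear_cinner_right] by metis
  qed
  have R_le: "cmod (autocorr F u) \<le> norm f * norm f" for u
    unfolding autocorr_eq_cinner[OF sq] f_def[symmetric]
    using norm_cinner_le[of f "tf_shift (u, 0) f"] by (simp add: norm_tf_shift)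
  have "(\<lambda>n. \<integral>y. autocorr F (y /\<^sub>R (2 * pi * s n)) * complex_of_real (gaussian y) \<partial>lborel) \<longlonglongrightarrow>
      (\<integral>y. autocorr F 0 * complex_of_real (gaussian (y :: real ^ 'd)) \<partial>lborel)"
  proof (rule integral_dominated_convergence[where w = "\<lambda>y. norm f * norm f * gaussian y"])
    show "AE y in lborel. (\<lambda>n. autocorr F (y /\<^sub>R (2 * pi * s n)) * complex_of_real (gaussian y))
        \<longlonglongrightarrow> autocorr F 0 * complex_of_real (gaussian y)"
      by (intro AE_I2 tendsto_mult R_lim tendsto_const)
    show "AE y in lborel. norm (autocorr F (y /\<^sub>R (2 * pi * s n)) * complex_of_real (gaussian y))
        \<le> norm f * norm f * gaussian y" for n
      by (intro AE_I2) (auto simp: norm_mult intro!: mult_right_mono R_le)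
  qed (use integrable_gaussian in auto)
  then have "(\<lambda>n. complex_of_real (1 / ?\<kappa>) *
      (\<integral>y. autocorr F (y /\<^sub>R (2 * pi * s n)) * complex_of_real (gaussian y) \<partial>lborel)) \<longlonglongrightarrow>
      complex_of_real (1 / ?\<kappa>) * (\<integral>y. autocorr F 0 * complex_of_real (gaussian (y :: real ^ 'd)) \<partial>lborel)"
    by (intro tendsto_mult tendsto_const)
  also have "complex_of_real (1 / ?\<kappa>) *
      (\<integral>y. autocorr F 0 * complex_of_real (gaussian (y :: real ^ 'd)) \<partial>lborel) = complex_of_real ?N"
    by (simp add: R0 integral_gaussian)
  finally have "(\<lambda>n. complex_of_real (\<integral>\<xi>. (cmod (ft F \<xi>))\<^sup>2 * gaussian (\<xi> /\<^sub>R s n) \<partial>lborel))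
      \<longlonglongrightarrow> complex_of_real ?N"
    by (simp only: gaussian_average_energy[OF int s])
  then have lim1: "(\<lambda>n. ennreal (\<integral>\<xi>. (cmod (ft F \<xi>))\<^sup>2 * gaussian (\<xi> /\<^sub>R s n) \<partial>lborel)) \<longlonglongrightarrow> ennreal ?N"
    by (intro tendsto_ennrealI) (simp only: tendsto_of_real_iff)
  let ?L = "\<integral>t. cmod (F t) \<partial>lborel"
  have fin: "integrable lborel (\<lambda>\<xi>. (cmod (ft F \<xi>))\<^sup>2 * gaussian (\<xi> /\<^sub>R s n))" for n
  proof (rule Bochner_Integration.integrable_bound)
    have "integrable lborel (\<lambda>\<xi> :: real ^ 'd. gaussian (0 + inverse (s n) *\<^sub>R \<xi>))"
      using s[of n] by (subst integrable_affine) (auto simp: integrable_gaussian)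
    then show "integrable lborel (\<lambda>\<xi> :: real ^ 'd. ?L\<^sup>2 * gaussian (\<xi> /\<^sub>R s n))"
      by simp
    show "AE \<xi> in lborel. norm ((cmod (ft F \<xi>))\<^sup>2 * gaussian (\<xi> /\<^sub>R s n)) \<le> norm (?L\<^sup>2 * gaussian (\<xi> /\<^sub>R s n))"
      by (intro AE_I2) (auto simp: norm_mult intro!: mult_right_mono power_mono norm_ft_le)
  qed measurable
  have mono: "gaussian (\<xi> /\<^sub>R s m) \<le> gaussian (\<xi> /\<^sub>R s n)" if "m \<le> n" for m n and \<xi> :: "real ^ 'd"
  proof -
    have "inverse (s n) * norm \<xi> \<le> inverse (s m) * norm \<xi>"
      using that s[of m] by (intro mult_right_mono le_imp_inverse_le) (auto simp: s_def)
    then have "(norm (\<xi> /\<^sub>R s n))\<^sup>2 \<le> (norm (\<xi> /\<^sub>R s m))\<^sup>2"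
      using s[of n] s[of m] by (intro power_mono) auto
    then show ?thesis by (simp add: gaussian_def)
  qed
  have "(\<lambda>n. \<integral>\<^sup>+\<xi>. ennreal ((cmod (ft F \<xi>))\<^sup>2 * gaussian (\<xi> /\<^sub>R s n)) \<partial>lborel) \<longlonglongrightarrow>
      (\<integral>\<^sup>+\<xi>. ennreal ((cmod (ft F \<xi>))\<^sup>2) \<partial>lborel)"
  proof (rule nn_integral_LIMSEQ)
    show "incseq (\<lambda>n \<xi>. ennreal ((cmod (ft F \<xi>))\<^sup>2 * gaussian (\<xi> /\<^sub>R s n)))"
      by (auto simp: incseq_def le_fun_def intro!: ennreal_leI mult_left_mono mono)
    fix \<xi> :: "real ^ 'd"
    have "(\<lambda>n. inverse (s n)) \<longlonglongrightarrow> 0"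
      unfolding s_def by (rule LIMSEQ_inverse_real_of_nat)
    then have "(\<lambda>n. exp (- (norm (inverse (s n) *\<^sub>R \<xi>))\<^sup>2 / 2)) \<longlonglongrightarrow> exp (- (norm (0 *\<^sub>R \<xi>))\<^sup>2 / 2)"
      by (intro tendsto_intros) auto
    then have "(\<lambda>n. (cmod (ft F \<xi>))\<^sup>2 * gaussian (\<xi> /\<^sub>R s n)) \<longlonglongrightarrow> (cmod (ft F \<xi>))\<^sup>2 * 1"
      unfolding gaussian_def by (intro tendsto_mult tendsto_const) simp
    then show "(\<lambda>n. ennreal ((cmod (ft F \<xi>))\<^sup>2 * gaussian (\<xi> /\<^sub>R s n))) \<longlonglongrightarrow> ennreal ((cmod (ft F \<xi>))\<^sup>2)"
      by (intro tendsto_ennrealI) simp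
  qed measurable
  moreover have "(\<integral>\<^sup>+\<xi>. ennreal ((cmod (ft F \<xi>))\<^sup>2 * gaussian (\<xi> /\<^sub>R s n)) \<partial>lborel) =
      ennreal (\<integral>\<xi>. (cmod (ft F \<xi>))\<^sup>2 * gaussian (\<xi> /\<^sub>R s n) \<partial>lborel)" for n
    by (rule nn_integral_eq_integral[OF fin]) auto
  ultimately show ?thesis
    using lim1 by (intro LIMSEQ_unique[OF _ lim1]) simp
qed

section \<open>The orthogonality relations of the short-time Fourier transform\<close>

lemma stft_add: "stft g (f1 + f2) z = stft g f1 z + stft g f2 z"
  by (simp add: stft_def cinner_add_left)

lemma stft_cscale: "stft g (c *\<^sub>C f) z = c * stft g f z"
  by (simp add: stft_def cinner_cscale_left)

lemma stft_window_add: "stft (g1 + g2) f z = stft g1 f z + stft g2 f z"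
  by (simp add: stft_def tf_shift_add cinner_add_right)

lemma stft_window_cscale: "stft (c *\<^sub>C g) f z = cnj c * stft g f z"
  by (simp add: stft_def tf_shift_cscale cinner_cscale_right)

lemma stft_abs_L2:
  assumes "square_integrable f" "square_integrable g"
  shows "stft (abs_L2 g) (abs_L2 f) (x, \<xi>) = ft (\<lambda>t. f t * cnj (g (t - x))) \<xi>"
  unfolding stft_def tf_shift_abs_L2[OF assms(2)]
    cinner_abs_L2[OF assms(1) square_integrable_tf_shift[OF assms(2)]] ft_def
  by (simp add: cis_cnj mult_ac)

lemma measurable_stft [measurable]: "stft g f \<in> borel_measurable borel"
proof -
  obtain f' g' where f: "square_integrable f'" "f = abs_L2 f'" and g: "square_integrable g'" "g = abs_L2 g'"
    using L2_cases by metis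
  note [measurable] = measurable_square_integrable[OF f(1)] measurable_square_integrable[OF g(1)]
  have "stft g f = (\<lambda>z. \<integral>t. f' t * cnj (g' (t - fst z)) * cis (- (2 * pi * (snd z \<bullet> t))) \<partial>lborel)"
    using f g by (auto simp: fun_eq_iff stft_abs_L2 ft_def)
  also have "\<dots> \<in> borel_measurable (lborel \<Otimes>\<^sub>M lborel)"
    by measurable
  finally show ?thesis
    unfolding lborel_prod by simp
qed

lemma square_integrable_translate:
  assumes "square_integrable g"
  shows "square_integrable (\<lambda>t. g (t - x))"
  using square_integrable_tf_shift[OF assms, of 0 x] by simp

text \<open>For fixed \<open>x\<close> the function \<open>\<xi> \<mapsto> V\<^sub>g f(x, \<xi>)\<close> is the Fourier transform of
  \<open>t \<mapsto> f(t) \<cdot> cnj (g(t - x))\<close>. This function is always integrable, and for almost every \<open>x\<close> it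
  is square integrable as well; Plancherel's theorem and Tonelli's theorem then give the value.\<close>

lemma nn_integral_stft:
  "(\<integral>\<^sup>+z. ennreal ((cmod (stft g f z))\<^sup>2) \<partial>lborel) = ennreal ((norm f)\<^sup>2 * (norm g)\<^sup>2)"
proof -
  obtain f' g' where f: "square_integrable f'" "f = abs_L2 f'" and g: "square_integrable g'" "g = abs_L2 g'"
    using L2_cases by metis
  note [measurable] = measurable_square_integrable[OF f(1)] measurable_square_integrable[OF g(1)]
  define G where "G = (\<lambda>x t. f' t * cnj (g' (t - x)))"
  have [measurable]: "G x \<in> borel_measurable borel" for x
    unfolding G_def by measurable
  have [measurable]: "(\<lambda>(x, t). G x t) \<in> borel_measurable (lborel \<Otimes>\<^sub>M lborel)"
    unfolding G_def by measurable
  have shift: "(\<integral>\<^sup>+x. ennreal ((cmod (g' (t - x)))\<^sup>2) \<partial>lborel) = ennreal ((norm g)\<^sup>2)" for t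
  proof -
    have int: "integrable lborel (\<lambda>x. (cmod (g' x))\<^sup>2)"
      using g by (simp add: square_integrable_def)
    have "(\<integral>\<^sup>+x. ennreal ((cmod (g' (t - x)))\<^sup>2) \<partial>lborel) =
        ennreal (\<integral>x. (cmod (g' (t - x)))\<^sup>2 \<partial>lborel)"
      using integrable_reflect[of "\<lambda>x. (cmod (g' x))\<^sup>2" t] int by (intro nn_integral_eq_integral) auto
    also have "(\<integral>x. (cmod (g' (t - x)))\<^sup>2 \<partial>lborel) = (norm g)\<^sup>2"
      unfolding g(2) norm_abs_L2[OF g(1)] by (rule integral_reflect) measurable
    finally show ?thesis .
  qed
  have total: "(\<integral>\<^sup>+x. (\<integral>\<^sup>+t. ennreal ((cmod (G x t))\<^sup>2) \<partial>lborel) \<partial>lborel) =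
      ennreal ((norm f)\<^sup>2 * (norm g)\<^sup>2)"
  proof -
    have "(\<integral>\<^sup>+x. (\<integral>\<^sup>+t. ennreal ((cmod (G x t))\<^sup>2) \<partial>lborel) \<partial>lborel) =
        (\<integral>\<^sup>+t. (\<integral>\<^sup>+x. ennreal ((cmod (G x t))\<^sup>2) \<partial>lborel) \<partial>lborel)"
      by (rule lborel_pair.Fubini') measurable
    also have "\<dots> = (\<integral>\<^sup>+t. ennreal ((cmod (f' t))\<^sup>2) * ennreal ((norm g)\<^sup>2) \<partial>lborel)"
    proof (intro nn_integral_cong)
      fix t
      have "(\<integral>\<^sup>+x. ennreal ((cmod (G x t))\<^sup>2) \<partial>lborel) =
          (\<integral>\<^sup>+x. ennreal ((cmod (f' t))\<^sup>2) * ennreal ((cmod (g' (t - x)))\<^sup>2) \<partial>lborel)"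
        by (simp add: G_def norm_mult power_mult_distrib ennreal_mult)
      also have "\<dots> = ennreal ((cmod (f' t))\<^sup>2) * ennreal ((norm g)\<^sup>2)"
        by (subst nn_integral_cmult) (auto simp: shift)
      finally show "(\<integral>\<^sup>+x. ennreal ((cmod (G x t))\<^sup>2) \<partial>lborel) =
          ennreal ((cmod (f' t))\<^sup>2) * ennreal ((norm g)\<^sup>2)" .
    qed
    also have "\<dots> = (\<integral>\<^sup>+t. ennreal ((cmod (f' t))\<^sup>2) \<partial>lborel) * ennreal ((norm g)\<^sup>2)"
      by (rule nn_integral_multc) measurable
    also have "(\<integral>\<^sup>+t. ennreal ((cmod (f' t))\<^sup>2) \<partial>lborel) = ennreal ((norm f)\<^sup>2)"
      using f(1) unfolding f(2) norm_abs_L2[OF f(1)]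
      by (intro nn_integral_eq_integral) (auto simp: square_integrable_def)
    finally show ?thesis by (simp add: ennreal_mult)
  qed
  have "AE x in lborel. (\<integral>\<^sup>+t. ennreal ((cmod (G x t))\<^sup>2) \<partial>lborel) \<noteq> \<infinity>"
    by (rule nn_integral_PInf_AE) (measurable, simp add: total)
  then have slice: "AE x in lborel. (\<integral>\<^sup>+\<xi>. ennreal ((cmod (stft g f (x, \<xi>)))\<^sup>2) \<partial>lborel) =
      (\<integral>\<^sup>+t. ennreal ((cmod (G x t))\<^sup>2) \<partial>lborel)"
  proof eventually_elim
    case (elim x)
    have int2: "integrable lborel (\<lambda>t. (cmod (G x t))\<^sup>2)"
      using elim by (intro integrableI_bounded) (auto simp: less_top)
    then have sq: "square_integrable (G x)"
      by (simp add: square_integrable_def)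
    have "integrable lborel (G x)"
      unfolding G_def by (intro integrable_mult_cnj f square_integrable_translate g)
    from Plancherel[OF this sq]
    have "(\<integral>\<^sup>+\<xi>. ennreal ((cmod (stft g f (x, \<xi>)))\<^sup>2) \<partial>lborel) = ennreal (\<integral>t. (cmod (G x t))\<^sup>2 \<partial>lborel)"
      unfolding f(2) g(2) stft_abs_L2[OF f(1) g(1)] G_def .
    also have "\<dots> = (\<integral>\<^sup>+t. ennreal ((cmod (G x t))\<^sup>2) \<partial>lborel)"
      by (rule nn_integral_eq_integral[OF int2, symmetric]) simp
    finally show ?case .
  qed
  have "(\<integral>\<^sup>+z. ennreal ((cmod (stft g f z))\<^sup>2) \<partial>lborel) =
      (\<integral>\<^sup>+z. ennreal ((cmod (stft g f z))\<^sup>2) \<partial>(lborel \<Otimes>\<^sub>M lborel))"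
    by (simp add: lborel_prod)
  also have "\<dots> = (\<integral>\<^sup>+x. (\<integral>\<^sup>+\<xi>. ennreal ((cmod (stft g f (x, \<xi>)))\<^sup>2) \<partial>lborel) \<partial>lborel)"
    by (rule lborel.nn_integral_fst[symmetric]) (simp add: lborel_prod)
  also have "\<dots> = ennreal ((norm f)\<^sup>2 * (norm g)\<^sup>2)"
    unfolding total[symmetric] by (rule nn_integral_cong_AE[OF slice])
  finally show ?thesis .
qed

lemma integrable_stft_squared: "integrable lborel (\<lambda>z. (cmod (stft g f z))\<^sup>2)"
  by (rule integrableI_bounded) (simp_all add: nn_integral_stft)

lemma integral_stft_squared:
  "(\<integral>z. (cmod (stft g f z))\<^sup>2 \<partial>lborel) = (norm f)\<^sup>2 * (norm g)\<^sup>2"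
proof -
  have "ennreal (\<integral>z. (cmod (stft g f z))\<^sup>2 \<partial>lborel) = ennreal ((norm f)\<^sup>2 * (norm g)\<^sup>2)"
    by (subst nn_integral_stft[symmetric])
       (rule nn_integral_eq_integral[symmetric, OF integrable_stft_squared], simp)
  then show ?thesis by (subst (asm) ennreal_inj) auto
qed

lemma integrable_stft_mult: "integrable lborel (\<lambda>z. stft g1 f1 z * cnj (stft g2 f2 z))"
proof (rule Bochner_Integration.integrable_bound)
  show "integrable lborel (\<lambda>z. (cmod (stft g1 f1 z))\<^sup>2 + (cmod (stft g2 f2 z))\<^sup>2)"
    by (intro Bochner_Integration.integrable_add integrable_stft_squared)
  have "cmod (stft g1 f1 z * cnj (stft g2 f2 z)) \<le> (cmod (stft g1 f1 z))\<^sup>2 + (cmod (stft g2 f2 z))\<^sup>2" for z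
  proof -
    have "0 \<le> cmod (stft g1 f1 z) * cmod (stft g2 f2 z)" by simp
    with sum_squares_bound[of "cmod (stft g1 f1 z)" "cmod (stft g2 f2 z)"]
    have "cmod (stft g1 f1 z) * cmod (stft g2 f2 z) \<le> (cmod (stft g1 f1 z))\<^sup>2 + (cmod (stft g2 f2 z))\<^sup>2"
      by linarith
    then show ?thesis by (simp add: norm_mult)
  qed
  then show "AE z in lborel. norm (stft g1 f1 z * cnj (stft g2 f2 z)) \<le>
      norm ((cmod (stft g1 f1 z))\<^sup>2 + (cmod (stft g2 f2 z))\<^sup>2)"
    by simp
qed measurable

lemma integral_norm_stft_mult_le:
  "(\<integral>z. cmod (stft g1 f1 z * cnj (stft g2 f2 z)) \<partial>lborel) \<le>
     (norm f1 * norm g1) * (norm f2 * norm g2)"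
proof -
  let ?a = "\<lambda>z. ennreal (cmod (stft g1 f1 z))" and ?b = "\<lambda>z. ennreal (cmod (stft g2 f2 z))"
  let ?I = "\<integral>z. cmod (stft g1 f1 z * cnj (stft g2 f2 z)) \<partial>lborel"
  have "(\<integral>\<^sup>+z. ?a z * ?b z \<partial>lborel) = (\<integral>\<^sup>+z. ennreal (cmod (stft g1 f1 z * cnj (stft g2 f2 z))) \<partial>lborel)"
    by (simp add: norm_mult ennreal_mult)
  also have "\<dots> = ennreal ?I"
    by (intro nn_integral_eq_integral integrable_norm integrable_stft_mult) auto
  finally have "(ennreal ?I)\<^sup>2 \<le> (\<integral>\<^sup>+z. ?a z ^ 2 \<partial>lborel) * (\<integral>\<^sup>+z. ?b z ^ 2 \<partial>lborel)"
    using Cauchy_Schwarz_nn_integral[of ?a lborel ?b] by simp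
  also have "\<dots> = ennreal (((norm f1)\<^sup>2 * (norm g1)\<^sup>2) * ((norm f2)\<^sup>2 * (norm g2)\<^sup>2))"
    by (simp add: ennreal_power nn_integral_stft ennreal_mult)
  finally have "?I\<^sup>2 \<le> ((norm f1 * norm g1) * (norm f2 * norm g2))\<^sup>2"
    by (simp add: ennreal_power power_mult_distrib)
  then show ?thesis by (rule power2_le_imp_le) simp
qed

text \<open>The diagonal case is \<open>integral_stft_squared\<close>; polarization in the signal and then in
  the window gives the full relation.\<close>

theorem stft_orthogonality:
  fixes f1 :: "'d::finite L2"
  shows "(\<integral>z. stft g1 f1 z * cnj (stft g2 f2 z) \<partial>lborel) = cinner f1 f2 * cnj (cinner g1 g2)"
proof -
  note int = integrable_stft_mult
  note integral_add = Bochner_Integration.integral_add[OF int int]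
  have same_window: "(\<integral>z. stft g f1 z * cnj (stft g f2 z) \<partial>lborel) = cinner f1 f2 * cinner g g"
    for g f1 f2 :: "'d L2"
  proof -
    have "(\<integral>z. stft g f1 z * cnj (stft g f2 z) \<partial>lborel) - cinner f1 f2 * cinner g g = 0"
    proof (rule sesquilinear_eq_0I[of "\<lambda>f1 f2. (\<integral>z. stft g f1 z * cnj (stft g f2 z) \<partial>lborel) - cinner f1 f2 * cinner g g"])
      fix f h k :: "'d L2" and c
      show "(\<integral>z. stft g (f + h) z * cnj (stft g k z) \<partial>lborel) - cinner (f + h) k * cinner g g =
          ((\<integral>z. stft g f z * cnj (stft g k z) \<partial>lborel) - cinner f k * cinner g g) +
          ((\<integral>z. stft g h z * cnj (stft g k z) \<partial>lborel) - cinner h k * cinner g g)"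
        by (simp add: stft_add distrib_right integral_add cinner_add_left)
      show "(\<integral>z. stft g k z * cnj (stft g (f + h) z) \<partial>lborel) - cinner k (f + h) * cinner g g =
          ((\<integral>z. stft g k z * cnj (stft g f z) \<partial>lborel) - cinner k f * cinner g g) +
          ((\<integral>z. stft g k z * cnj (stft g h z) \<partial>lborel) - cinner k h * cinner g g)"
        by (simp add: stft_add distrib_left distrib_right integral_add cinner_add_right)
      show "(\<integral>z. stft g (c *\<^sub>C f) z * cnj (stft g h z) \<partial>lborel) - cinner (c *\<^sub>C f) h * cinner g g =
          c * ((\<integral>z. stft g f z * cnj (stft g h z) \<partial>lborel) - cinner f h * cinner g g)"
        by (simp add: stft_cscale cinner_cscale_left mult.assoc right_diff_distrib)
      show "(\<integral>z. stft g f z * cnj (stft g (c *\<^sub>C h) z) \<partial>lborel) - cinner f (c *\<^sub>C h) * cinner g g =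
          cnj c * ((\<integral>z. stft g f z * cnj (stft g h z) \<partial>lborel) - cinner f h * cinner g g)"
        by (simp add: stft_cscale cinner_cscale_right mult.left_commute[of _ "cnj c"] mult.assoc right_diff_distrib)
      have "(\<integral>z. stft g f z * cnj (stft g f z) \<partial>lborel) =
          complex_of_real (\<integral>z. (cmod (stft g f z))\<^sup>2 \<partial>lborel)"
        by (simp only: complex_norm_square[symmetric] integral_complex_of_real)
      then show "(\<integral>z. stft g f z * cnj (stft g f z) \<partial>lborel) - cinner f f * cinner g g = 0"
        by (simp only: integral_stft_squared cinner_self of_real_mult diff_self)
    qed
    then show ?thesis by simp
  qed
  have "(\<integral>z. stft g1 f1 z * cnj (stft g2 f2 z) \<partial>lborel) - cinner f1 f2 * cinner g2 g1 = 0"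
  proof (rule sesquilinear_eq_0I[of "\<lambda>g2 g1. (\<integral>z. stft g1 f1 z * cnj (stft g2 f2 z) \<partial>lborel) - cinner f1 f2 * cinner g2 g1"])
    fix f h k :: "'d L2" and c
    show "(\<integral>z. stft k f1 z * cnj (stft (f + h) f2 z) \<partial>lborel) - cinner f1 f2 * cinner (f + h) k =
        ((\<integral>z. stft k f1 z * cnj (stft f f2 z) \<partial>lborel) - cinner f1 f2 * cinner f k) +
        ((\<integral>z. stft k f1 z * cnj (stft h f2 z) \<partial>lborel) - cinner f1 f2 * cinner h k)"
      by (simp add: stft_window_add distrib_left integral_add cinner_add_left)
    show "(\<integral>z. stft (f + h) f1 z * cnj (stft k f2 z) \<partial>lborel) - cinner f1 f2 * cinner k (f + h) =
        ((\<integral>z. stft f f1 z * cnj (stft k f2 z) \<partial>lborel) - cinner f1 f2 * cinner k f) +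
        ((\<integral>z. stft h f1 z * cnj (stft k f2 z) \<partial>lborel) - cinner f1 f2 * cinner k h)"
      by (simp add: stft_window_add distrib_left distrib_right integral_add cinner_add_right)
    show "(\<integral>z. stft h f1 z * cnj (stft (c *\<^sub>C f) f2 z) \<partial>lborel) - cinner f1 f2 * cinner (c *\<^sub>C f) h =
        c * ((\<integral>z. stft h f1 z * cnj (stft f f2 z) \<partial>lborel) - cinner f1 f2 * cinner f h)"
      by (simp add: stft_window_cscale cinner_cscale_left mult.left_commute[of _ c] right_diff_distrib)
    show "(\<integral>z. stft (c *\<^sub>C h) f1 z * cnj (stft f f2 z) \<partial>lborel) - cinner f1 f2 * cinner f (c *\<^sub>C h) =
        cnj c * ((\<integral>z. stft h f1 z * cnj (stft f f2 z) \<partial>lborel) - cinner f1 f2 * cinner f h)"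
      by (simp add: stft_window_cscale cinner_cscale_right mult.assoc mult.left_commute[of _ "cnj c"] right_diff_distrib)
    show "(\<integral>z. stft f f1 z * cnj (stft f f2 z) \<partial>lborel) - cinner f1 f2 * cinner f f = 0"
      by (simp add: same_window)
  qed
  then show ?thesis
    using cinner_commute[of g2 g1] by simp
qed

section \<open>Time-frequency shifts in the range\<close>

definition tf_op :: "(real ^ 'd) \<times> (real ^ 'd) \<Rightarrow> 'd::finite L2 \<Rightarrow>\<^sub>L 'd L2" where
  "tf_op z = Blinfun (tf_shift z)"

lemma blinfun_tf_op [simp]: "blinfun_apply (tf_op z) f = tf_shift z f"
proof -
  have "bounded_linear (tf_shift z :: 'a L2 \<Rightarrow> 'a L2)"
    by (rule bounded_linear_intro[where K = 1])
       (auto simp: tf_shift_add tf_shift_cscale scaleR_L2_def norm_tf_shift)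
  then show ?thesis by (simp add: tf_op_def bounded_linear_Blinfun_apply)
qed

lemma tf_op_bounded: "tf_op z \<in> bounded_ops"
  by (simp add: bounded_ops_def tf_shift_cscale)

definition scale_op :: "complex \<Rightarrow> ('d::finite L2 \<Rightarrow>\<^sub>L 'd L2) \<Rightarrow> 'd L2 \<Rightarrow>\<^sub>L 'd L2" where
  "scale_op c A = Blinfun (\<lambda>f. c *\<^sub>C blinfun_apply A f)"

lemma blinfun_scale_op [simp]: "blinfun_apply (scale_op c A) f = c *\<^sub>C blinfun_apply A f"
proof -
  have "bounded_linear (\<lambda>f. c *\<^sub>C blinfun_apply A f)"
    by (rule bounded_linear_compose[OF bounded_linear_cscale blinfun.bounded_linear_right])
  then show ?thesis by (simp add: scale_op_def bounded_linear_Blinfun_apply)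
qed

lemma scale_op_bounded: "A \<in> bounded_ops \<Longrightarrow> scale_op c A \<in> bounded_ops"
  by (auto simp: bounded_ops_def cscale_cscale mult.commute)

lemma add_bounded: "A \<in> bounded_ops \<Longrightarrow> B \<in> bounded_ops \<Longrightarrow> A + B \<in> bounded_ops"
  by (auto simp: bounded_ops_def blinfun.add_left cscale_add_right)

text \<open>The property that characterizes \<open>loc_op\<close>. An explicit operator with this property is
  recognized as a localization operator by uniqueness.\<close>

definition represents ::
  "'d::finite L2 \<Rightarrow> 'd L2 \<Rightarrow> ((real ^ 'd) \<times> (real ^ 'd) \<Rightarrow> complex) \<Rightarrow> ('d L2 \<Rightarrow>\<^sub>L 'd L2) \<Rightarrow> bool" where
  "represents \<phi>\<^sub>1 \<phi>\<^sub>2 a A \<longleftrightarrow> A \<in> bounded_ops \<and>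
     (\<forall>f g. cinner (blinfun_apply A f) g =
        (\<integral>z. a z * stft \<phi>\<^sub>1 f z * cnj (stft \<phi>\<^sub>2 g z) \<partial>lborel))"

lemma loc_op_eqI:
  assumes "represents \<phi>\<^sub>1 \<phi>\<^sub>2 a A"
  shows "loc_op \<phi>\<^sub>1 \<phi>\<^sub>2 a = A"
  unfolding loc_op_def represents_def[symmetric]
proof (rule the_equality, rule assms)
  fix B assume "represents \<phi>\<^sub>1 \<phi>\<^sub>2 a B"
  with assms show "B = A"
    by (intro blinfun_eqI cinner_eqI) (simp add: represents_def)
qed

lemma integrable_symbol_stft:
  assumes "a \<in> Linfty"
  shows "integrable lborel (\<lambda>z. a z * stft \<phi>\<^sub>1 f z * cnj (stft \<phi>\<^sub>2 g z))"
proof -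
  obtain C where C: "AE z in lborel. cmod (a z) \<le> C" and [measurable]: "a \<in> borel_measurable lborel"
    using assms by (auto simp: Linfty_def)
  have "integrable lborel (\<lambda>z. complex_of_real C * (stft \<phi>\<^sub>1 f z * cnj (stft \<phi>\<^sub>2 g z)))"
    by (intro integrable_mult_right integrable_stft_mult)
  then show ?thesis
  proof (rule Bochner_Integration.integrable_bound)
    show "AE z in lborel. norm (a z * stft \<phi>\<^sub>1 f z * cnj (stft \<phi>\<^sub>2 g z)) \<le>
        norm (complex_of_real C * (stft \<phi>\<^sub>1 f z * cnj (stft \<phi>\<^sub>2 g z)))"
      using C
    proof eventually_elim
      case (elim z)
      then have "cmod (a z) \<le> \<bar>C\<bar>" by simp
      then show ?case by (simp add: norm_mult mult.assoc mult_right_mono)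
    qed
  qed measurable
qed

definition loc_range :: "'d::finite L2 \<Rightarrow> 'd L2 \<Rightarrow> ('d L2 \<Rightarrow>\<^sub>L 'd L2) set" where
  "loc_range \<phi>\<^sub>1 \<phi>\<^sub>2 = {A. \<exists>a\<in>Linfty. represents \<phi>\<^sub>1 \<phi>\<^sub>2 a A}"

lemma loc_range_subset_image: "loc_range \<phi>\<^sub>1 \<phi>\<^sub>2 \<subseteq> loc_op \<phi>\<^sub>1 \<phi>\<^sub>2 ` Linfty"
  using loc_op_eqI unfolding loc_range_def by blast

lemma loc_range_bounded: "loc_range \<phi>\<^sub>1 \<phi>\<^sub>2 \<subseteq> bounded_ops"
  by (auto simp: loc_range_def represents_def)

lemma loc_range_zero: "0 \<in> loc_range \<phi>\<^sub>1 \<phi>\<^sub>2"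
  unfolding loc_range_def mem_Collect_eq
  by (rule bexI[of _ "\<lambda>_. 0"]) (auto simp: represents_def bounded_ops_def Linfty_def)

lemma loc_range_add:
  assumes "A \<in> loc_range \<phi>\<^sub>1 \<phi>\<^sub>2" "B \<in> loc_range \<phi>\<^sub>1 \<phi>\<^sub>2"
  shows "A + B \<in> loc_range \<phi>\<^sub>1 \<phi>\<^sub>2"
proof -
  obtain a b where ab: "a \<in> Linfty" "b \<in> Linfty" "represents \<phi>\<^sub>1 \<phi>\<^sub>2 a A" "represents \<phi>\<^sub>1 \<phi>\<^sub>2 b B"
    using assms by (auto simp: loc_range_def)
  obtain C D where "AE z in lborel. cmod (a z) \<le> C" "AE z in lborel. cmod (b z) \<le> D"
    using ab(1,2) by (auto simp: Linfty_def)
  then have "AE z in lborel. cmod (a z + b z) \<le> C + D"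
    by eventually_elim (metis add_mono norm_triangle_le)
  then have "(\<lambda>z. a z + b z) \<in> Linfty"
    using ab(1,2) by (auto simp: Linfty_def)
  moreover have "represents \<phi>\<^sub>1 \<phi>\<^sub>2 (\<lambda>z. a z + b z) (A + B)"
    using ab unfolding represents_def
    by (simp add: add_bounded blinfun.add_left cinner_add_left distrib_right integrable_symbol_stft)
  ultimately show ?thesis by (auto simp: loc_range_def)
qed

lemma loc_range_scale:
  assumes "A \<in> loc_range \<phi>\<^sub>1 \<phi>\<^sub>2"
  shows "scale_op c A \<in> loc_range \<phi>\<^sub>1 \<phi>\<^sub>2"
proof -
  obtain a where a: "a \<in> Linfty" "represents \<phi>\<^sub>1 \<phi>\<^sub>2 a A"
    using assms by (auto simp: loc_range_def)
  obtain C where "AE z in lborel. cmod (a z) \<le> C"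
    using a(1) by (auto simp: Linfty_def)
  then have "AE z in lborel. cmod (c * a z) \<le> cmod c * C"
    by eventually_elim (simp add: norm_mult mult_left_mono)
  then have "(\<lambda>z. c * a z) \<in> Linfty"
    using a(1) by (auto simp: Linfty_def)
  moreover have "represents \<phi>\<^sub>1 \<phi>\<^sub>2 (\<lambda>z. c * a z) (scale_op c A)"
    using a unfolding represents_def
    by (simp add: scale_op_bounded cinner_cscale_left mult.assoc)
  ultimately show ?thesis by (auto simp: loc_range_def)
qed

lemma tf_shift_commute:
  "tf_shift (x, \<xi>) (tf_shift (y, \<eta>) f) =
     cis (2 * pi * (\<xi> \<bullet> y - \<eta> \<bullet> x)) *\<^sub>C tf_shift (y, \<eta>) (tf_shift (x, \<xi>) f)"
proof -
  obtain f' where f: "square_integrable f'" "f = abs_L2 f'"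
    using L2_cases by metis
  have "cis (2 * pi * (\<xi> \<bullet> t)) * (cis (2 * pi * (\<eta> \<bullet> (t - x))) * f' (t - x - y)) =
      cis (2 * pi * (\<xi> \<bullet> y - \<eta> \<bullet> x)) * (cis (2 * pi * (\<eta> \<bullet> t)) * (cis (2 * pi * (\<xi> \<bullet> (t - y))) * f' (t - y - x)))"
    for t
  proof -
    have "2 * pi * (\<xi> \<bullet> t) + 2 * pi * (\<eta> \<bullet> (t - x)) =
        2 * pi * (\<xi> \<bullet> y - \<eta> \<bullet> x) + (2 * pi * (\<eta> \<bullet> t) + 2 * pi * (\<xi> \<bullet> (t - y)))"
      unfolding inner_diff_right by (simp add: right_diff_distrib)
    moreover have "t - x - y = t - y - x"
      by (simp add: diff_diff_eq add.commute)
    ultimately show ?thesis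
      unfolding mult.assoc[symmetric] cis_mult by (simp only: add.assoc)
  qed
  note phase = this
  note sq = square_integrable_tf_shift[OF f(1)]
  show ?thesis
    unfolding f(2) tf_shift_abs_L2[OF f(1)] tf_shift_abs_L2[OF sq]
      cscale_abs_L2[OF square_integrable_tf_shift[OF sq]] phase ..
qed

text \<open>The commutation relation of time-frequency shifts: moving signal and window together only
  modulates the transform by a character of phase space.\<close>

lemma stft_covariance:
  "stft (tf_shift (y, \<eta>) \<phi>) (tf_shift (y, \<eta>) f) (x, \<xi>) =
     cis (2 * pi * (\<eta> \<bullet> x - \<xi> \<bullet> y)) * stft \<phi> f (x, \<xi>)"
proof -
  have "cnj (cis (2 * pi * (\<xi> \<bullet> y - \<eta> \<bullet> x))) = cis (2 * pi * (\<eta> \<bullet> x - \<xi> \<bullet> y))"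
    by (simp add: cis_cnj right_diff_distrib)
  then show ?thesis
    unfolding stft_def tf_shift_commute[of x \<xi> y \<eta>] cinner_cscale_right cinner_tf_shift by simp
qed

text \<open>With the character of \<open>stft_covariance\<close> as symbol, the integral defining the form of the
  localization operator is an instance of \<open>stft_orthogonality\<close>, and the operator comes out as
  \<open>V\<^sub>\<phi>\<^sub>1 \<phi>\<^sub>2(w) \<cdot> \<pi>(w)\<close>.\<close>

theorem tf_op_in_loc_range:
  assumes "stft \<phi>\<^sub>1 \<phi>\<^sub>2 w \<noteq> 0"
  shows "tf_op w \<in> loc_range \<phi>\<^sub>1 \<phi>\<^sub>2"
proof -
  obtain y \<eta> where w: "w = (y, \<eta>)" by (cases w)
  define a where "a = (\<lambda>z. cis (2 * pi * (\<eta> \<bullet> fst z - snd z \<bullet> y)))"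
  have a: "a \<in> Linfty"
  proof -
    have "a \<in> borel_measurable (lborel \<Otimes>\<^sub>M lborel)"
      unfolding a_def by measurable
    then show ?thesis
      unfolding Linfty_def lborel_prod by (auto simp: a_def intro!: exI[of _ 1])
  qed
  have "represents \<phi>\<^sub>1 \<phi>\<^sub>2 a (scale_op (stft \<phi>\<^sub>1 \<phi>\<^sub>2 w) (tf_op w))"
    unfolding represents_def
  proof (intro conjI allI)
    show "scale_op (stft \<phi>\<^sub>1 \<phi>\<^sub>2 w) (tf_op w) \<in> bounded_ops"
      by (intro scale_op_bounded tf_op_bounded)
    fix f g
    have cov: "a z * stft \<phi>\<^sub>1 f z = stft (tf_shift w \<phi>\<^sub>1) (tf_shift w f) z" for z
      using stft_covariance[of y \<eta> \<phi>\<^sub>1 f "fst z" "snd z"] by (simp add: a_def w)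
    have "(\<integral>z. a z * stft \<phi>\<^sub>1 f z * cnj (stft \<phi>\<^sub>2 g z) \<partial>lborel) =
        cinner (tf_shift w f) g * cnj (cinner (tf_shift w \<phi>\<^sub>1) \<phi>\<^sub>2)"
      unfolding cov by (rule stft_orthogonality)
    also have "cnj (cinner (tf_shift w \<phi>\<^sub>1) \<phi>\<^sub>2) = stft \<phi>\<^sub>1 \<phi>\<^sub>2 w"
      unfolding stft_def by (rule cinner_commute[symmetric])
    finally show "cinner (blinfun_apply (scale_op (stft \<phi>\<^sub>1 \<phi>\<^sub>2 w) (tf_op w)) f) g =
        (\<integral>z. a z * stft \<phi>\<^sub>1 f z * cnj (stft \<phi>\<^sub>2 g z) \<partial>lborel)"
      by (simp add: cinner_cscale_left mult.commute)
  qed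
  with a have "scale_op (stft \<phi>\<^sub>1 \<phi>\<^sub>2 w) (tf_op w) \<in> loc_range \<phi>\<^sub>1 \<phi>\<^sub>2"
    by (auto simp: loc_range_def)
  from loc_range_scale[OF this, of "1 / stft \<phi>\<^sub>1 \<phi>\<^sub>2 w"]
  have "scale_op (1 / stft \<phi>\<^sub>1 \<phi>\<^sub>2 w) (scale_op (stft \<phi>\<^sub>1 \<phi>\<^sub>2 w) (tf_op w)) \<in> loc_range \<phi>\<^sub>1 \<phi>\<^sub>2" .
  also have "scale_op (1 / stft \<phi>\<^sub>1 \<phi>\<^sub>2 w) (scale_op (stft \<phi>\<^sub>1 \<phi>\<^sub>2 w) (tf_op w)) = tf_op w"
    by (rule blinfun_eqI) (simp add: cscale_cscale assms)
  finally show ?thesis .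
qed

section \<open>The trace pairing and Fourier--Wigner inversion\<close>

definition trace_basis :: "'d::finite L2 set" where
  "trace_basis = (SOME E. is_onb E)"

lemma is_onb_trace_basis: "is_onb (trace_basis :: 'd::finite L2 set)"
  unfolding trace_basis_def by (rule someI_ex[OF ex_onb])

lemma
  assumes S: "nuclear_rep S u v" and T: "T \<in> bounded_ops"
  shows trace_has_sum_nuclear:
      "((\<lambda>n. cinner (blinfun_apply T (v n)) (u n)) has_sum op_trace (T o\<^sub>L S)) UNIV"
    and trace_has_sum_basis:
      "((\<lambda>e. cinner (blinfun_apply T (blinfun_apply S e)) e) has_sum op_trace (T o\<^sub>L S)) trace_basis"
proof -
  obtain t where t: "((\<lambda>n. cinner (blinfun_apply T (v n)) (u n)) has_sum t) UNIV"
    "((\<lambda>e. cinner (blinfun_apply T (blinfun_apply S e)) e) has_sum t) trace_basis"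
    by (rule trace_nuclear[OF S T is_onb_trace_basis])
  have "op_trace (T o\<^sub>L S) = t"
    unfolding op_trace_def trace_basis_def[symmetric] using infsumI[OF t(2)] by simp
  with t show
      "((\<lambda>n. cinner (blinfun_apply T (v n)) (u n)) has_sum op_trace (T o\<^sub>L S)) UNIV"
      "((\<lambda>e. cinner (blinfun_apply T (blinfun_apply S e)) e) has_sum op_trace (T o\<^sub>L S)) trace_basis"
    by simp_all
qed

text \<open>For a single rank-one term \<open>\<langle>\<cdot>, u\<^sub>n\<rangle> v\<^sub>n\<close> this is the orthogonality relation for
  \<open>V\<^sub>f g\<close> and \<open>V\<^sub>v\<^sub>n u\<^sub>n\<close>. The terms may be integrated one by one because their \<open>L\<^sup>1\<close> norms are at
  most \<open>\<parallel>f\<parallel> \<parallel>g\<parallel> \<parallel>u\<^sub>n\<parallel> \<parallel>v\<^sub>n\<parallel>\<close>.\<close>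

theorem
  assumes S: "nuclear_rep S u v"
  shows integrable_stft_trace:
      "integrable lborel (\<lambda>w. stft f g w * op_trace (tf_op w o\<^sub>L S))"
    and fourier_wigner_inversion:
      "(\<integral>w. stft f g w * op_trace (tf_op w o\<^sub>L S) \<partial>lborel) = cinner (blinfun_apply S g) f"
proof -
  define F where "F n w = stft f g w * cnj (stft (v n) (u n) w)" for n w
  have term_eq: "cinner (tf_shift w (v n)) (u n) = cnj (stft (v n) (u n) w)" for n w
    unfolding stft_def by (rule cinner_commute)
  have uv: "summable (\<lambda>n. norm (u n) * norm (v n))"
    using S by (simp add: nuclear_rep_def)
  have "(\<lambda>n. F n w) sums (stft f g w * op_trace (tf_op w o\<^sub>L S))" for w
  proof -
    have "(\<lambda>n. cnj (stft (v n) (u n) w)) sums op_trace (tf_op w o\<^sub>L S)"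
      using has_sum_imp_sums[OF trace_has_sum_nuclear[OF S tf_op_bounded, of w]] by (simp add: term_eq)
    then show ?thesis unfolding F_def by (rule sums_mult)
  qed
  then have suminf: "(\<Sum>n. F n w) = stft f g w * op_trace (tf_op w o\<^sub>L S)" for w
    by (simp add: sums_iff)
  have int: "integrable lborel (F n)" for n
    unfolding F_def by (rule integrable_stft_mult)
  have ae: "AE w in lborel. summable (\<lambda>n. norm (F n w))"
  proof (intro AE_I2)
    fix w
    have "summable (\<lambda>n. cmod (stft f g w) * (norm (u n) * norm (v n)))"
      by (rule summable_mult[OF uv])
    then show "summable (\<lambda>n. norm (F n w))"
    proof (rule summable_comparison_test[rotated], intro exI[of _ 0] allI impI)
      fix n
      have "cmod (stft (v n) (u n) w) \<le> norm (u n) * norm (v n)"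
        unfolding stft_def using norm_cinner_le[of "u n" "tf_shift w (v n)"] by (simp add: norm_tf_shift)
      then show "norm (norm (F n w)) \<le> cmod (stft f g w) * (norm (u n) * norm (v n))"
        by (simp add: F_def norm_mult mult_left_mono)
    qed
  qed
  have sum_int: "summable (\<lambda>n. \<integral>w. norm (F n w) \<partial>lborel)"
  proof (rule summable_comparison_test[OF _ summable_mult[OF uv, of "norm g * norm f"]], intro exI[of _ 0] allI impI)
    fix n
    have "0 \<le> (\<integral>w. norm (F n w) \<partial>lborel)" by simp
    moreover have "(\<integral>w. norm (F n w) \<partial>lborel) \<le> (norm g * norm f) * (norm (u n) * norm (v n))"
      unfolding F_def by (rule integral_norm_stft_mult_le)
    ultimately show "norm (\<integral>w. norm (F n w) \<partial>lborel) \<le> norm g * norm f * (norm (u n) * norm (v n))"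
      by simp
  qed
  show "integrable lborel (\<lambda>w. stft f g w * op_trace (tf_op w o\<^sub>L S))"
    using integrable_suminf[OF int ae sum_int] by (simp only: suminf)
  have "(\<lambda>n. cinner g (u n) * cinner (v n) f) sums (\<integral>w. stft f g w * op_trace (tf_op w o\<^sub>L S) \<partial>lborel)"
  proof -
    have "integral\<^sup>L lborel (F n) = cinner g (u n) * cinner (v n) f" for n
      unfolding F_def stft_orthogonality using cinner_commute[of "v n" f] by simp
    then show ?thesis
      using sums_integral[OF int ae sum_int] by (simp only: suminf)
  qed
  moreover have "(\<lambda>n. cinner g (u n) * cinner (v n) f) sums cinner (blinfun_apply S g) f"
  proof -
    have "((\<lambda>n. cinner g (u n) *\<^sub>C v n) has_sum blinfun_apply S g) UNIV"
      using S by (simp add: nuclear_rep_def)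
    from has_sum_imp_sums[OF has_sum_bounded_linear[OF bounded_linear_cinner_left this, of f]]
    show ?thesis by (simp add: cinner_cscale_left)
  qed
  ultimately show "(\<integral>w. stft f g w * op_trace (tf_op w o\<^sub>L S) \<partial>lborel) = cinner (blinfun_apply S g) f"
    by (rule sums_unique2)
qed

section \<open>Duality in finitely many trace functionals\<close>

text \<open>Duality for subspaces of a finite-dimensional space, by Gaussian elimination on the coordinates
  in \<open>I\<close>.\<close>

lemma finite_interpolation:
  fixes b :: "'i \<Rightarrow> complex"
  assumes "finite I"
    and zero: "(\<lambda>_. 0) \<in> V"
    and add: "\<And>v w. v \<in> V \<Longrightarrow> w \<in> V \<Longrightarrow> (\<lambda>i. v i + w i) \<in> V"
    and scale: "\<And>c v. v \<in> V \<Longrightarrow> (\<lambda>i. c * v i) \<in> V"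
    and annihilator: "\<And>\<kappa>. (\<forall>v\<in>V. (\<Sum>i\<in>I. \<kappa> i * v i) = 0) \<Longrightarrow> (\<Sum>i\<in>I. \<kappa> i * b i) = 0"
  shows "\<exists>v\<in>V. \<forall>i\<in>I. v i = b i"
  using assms
proof (induction I arbitrary: V b rule: finite_induct)
  case empty
  then show ?case by auto
next
  case (insert j I)
  note zero = insert.prems(1) and add = insert.prems(2) and scale = insert.prems(3)
    and ann = insert.prems(4)
  show ?case
  proof (cases "\<forall>v\<in>V. v j = 0")
    case True
    have "b j = 0"
    proof -
      have "(\<Sum>i\<in>insert j I. (if i = j then 1 else 0) * v i) = v j" for v :: "'i \<Rightarrow> complex"
        using insert.hyps by (simp add: if_distrib[of "\<lambda>x. x * _"] cong: if_cong)
      then show ?thesis using ann[of "\<lambda>i. if i = j then 1 else 0"] True by simp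
    qed
    have "\<exists>v\<in>V. \<forall>i\<in>I. v i = b i"
    proof (rule insert.IH[OF zero add scale])
      fix \<kappa> assume *: "\<forall>v\<in>V. (\<Sum>i\<in>I. \<kappa> i * v i) = 0"
      have "(\<Sum>i\<in>insert j I. \<kappa> i * v i) = 0" if "v \<in> V" for v
        using * True that insert.hyps by simp
      then have "(\<Sum>i\<in>insert j I. \<kappa> i * b i) = 0" by (intro ann) simp
      then show "(\<Sum>i\<in>I. \<kappa> i * b i) = 0"
        using insert.hyps \<open>b j = 0\<close> by simp
    qed
    then show ?thesis using True \<open>b j = 0\<close> by fastforce
  next
    case False
    then obtain w0 where "w0 \<in> V" "w0 j \<noteq> 0" by auto
    define w where "w = (\<lambda>i. (1 / w0 j) * w0 i)"
    have w: "w \<in> V" "w j = 1"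
      unfolding w_def using scale[OF \<open>w0 \<in> V\<close>, of "1 / w0 j"] \<open>w0 j \<noteq> 0\<close> by simp_all
    \<comment> \<open>Subtracting multiples of w clears the coordinate j and leaves the problem on I; an
      annihilator there extends to j by the value that makes it vanish on w.\<close>
    have "\<exists>v\<in>{v \<in> V. v j = 0}. \<forall>i\<in>I. v i = b i - b j * w i"
    proof (rule insert.IH)
      fix \<kappa> assume *: "\<forall>v\<in>{v \<in> V. v j = 0}. (\<Sum>i\<in>I. \<kappa> i * v i) = 0"
      define \<mu> where "\<mu> = \<kappa>(j := - (\<Sum>i\<in>I. \<kappa> i * w i))"
      have \<mu>: "(\<Sum>i\<in>insert j I. \<mu> i * x i) = (\<Sum>i\<in>I. \<kappa> i * (x i - x j * w i))" for x
      proof -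
        have "(\<Sum>i\<in>I. \<mu> i * x i) = (\<Sum>i\<in>I. \<kappa> i * x i)"
          using insert.hyps by (intro sum.cong) (auto simp: \<mu>_def)
        then have "(\<Sum>i\<in>insert j I. \<mu> i * x i) = (\<Sum>i\<in>I. \<kappa> i * x i) - x j * (\<Sum>i\<in>I. \<kappa> i * w i)"
          using insert.hyps by (simp add: \<mu>_def)
        then show ?thesis
          by (simp add: right_diff_distrib sum_subtractf sum_distrib_left mult.left_commute)
      qed
      have "(\<Sum>i\<in>insert j I. \<mu> i * v i) = 0" if v: "v \<in> V" for v
      proof -
        have "(\<lambda>i. v i + - v j * w i) \<in> V"
          by (intro add v scale w)
        then have "(\<Sum>i\<in>I. \<kappa> i * (v i + - v j * w i)) = 0"
          using * w by (intro bspec[OF *]) simp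
        then show ?thesis unfolding \<mu> by simp
      qed
      then have "(\<Sum>i\<in>insert j I. \<mu> i * b i) = 0" by (intro ann) simp
      then show "(\<Sum>i\<in>I. \<kappa> i * (b i - b j * w i)) = 0" unfolding \<mu> .
    qed (auto simp: zero add scale)
    then obtain v where v: "v \<in> V" "v j = 0" "\<And>i. i \<in> I \<Longrightarrow> v i = b i - b j * w i" by auto
    have "(\<lambda>i. v i + b j * w i) \<in> V"
      by (intro add v(1) scale w)
    moreover have "\<forall>i\<in>insert j I. v i + b j * w i = b i"
      using v w by auto
    ultimately show ?thesis by (intro bexI[of _ "\<lambda>i. v i + b j * w i"])
  qed
qed

lemma has_sum_finite_sum:
  fixes f :: "'i \<Rightarrow> 'a \<Rightarrow> 'b::topological_comm_monoid_add"
  assumes "finite I" "\<And>i. i \<in> I \<Longrightarrow> (f i has_sum s i) A"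
  shows "((\<lambda>x. \<Sum>i\<in>I. f i x) has_sum (\<Sum>i\<in>I. s i)) A"
  using assms by (induction I rule: finite_induct) (auto intro: has_sum_add)

text \<open>By the inversion formula the combination \<open>\<Sum>\<^sub>S \<kappa> S \<cdot> S\<close> is the zero operator, and so is its
  product with \<open>T\<close>.\<close>

theorem trace_functionals_determined:
  fixes I :: "('d::finite L2 \<Rightarrow>\<^sub>L 'd L2) set"
  assumes I: "finite I" "I \<subseteq> trace_class" and T: "T \<in> bounded_ops"
    and zero: "AE w in lborel. (\<Sum>S\<in>I. \<kappa> S * op_trace (tf_op w o\<^sub>L S)) = 0"
  shows "(\<Sum>S\<in>I. \<kappa> S * op_trace (T o\<^sub>L S)) = 0"
proof -
  have "\<forall>S\<in>I. \<exists>u v. nuclear_rep S u v"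
    using I(2) trace_class_nuclear by auto
  then obtain u v where nuc: "\<And>S. S \<in> I \<Longrightarrow> nuclear_rep S (u S) (v S)"
    by metis
  have "(\<Sum>S\<in>I. \<kappa> S *\<^sub>C blinfun_apply S g) = 0" for g
  proof (rule cinner_eqI)
    fix f
    have "cinner (\<Sum>S\<in>I. \<kappa> S *\<^sub>C blinfun_apply S g) f =
        (\<Sum>S\<in>I. \<kappa> S * (\<integral>w. stft f g w * op_trace (tf_op w o\<^sub>L S) \<partial>lborel))"
      by (simp add: cinner_sum_left cinner_cscale_left fourier_wigner_inversion[OF nuc])
    also have "\<dots> = (\<integral>w. (\<Sum>S\<in>I. \<kappa> S * (stft f g w * op_trace (tf_op w o\<^sub>L S))) \<partial>lborel)"
      by (subst Bochner_Integration.integral_sum)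
         (auto intro!: integrable_mult_right integrable_stft_trace[OF nuc])
    also have "\<dots> = (\<integral>w. 0 \<partial>(lborel :: ((real ^ 'd) \<times> (real ^ 'd)) measure))"
    proof (rule integral_cong_AE)
      show "(\<lambda>w. \<Sum>S\<in>I. \<kappa> S * (stft f g w * op_trace (tf_op w o\<^sub>L S))) \<in> borel_measurable lborel"
      proof (rule borel_measurable_sum)
        fix S assume "S \<in> I"
        then have "integrable lborel (\<lambda>w. \<kappa> S * (stft f g w * op_trace (tf_op w o\<^sub>L S)))"
          by (intro integrable_mult_right integrable_stft_trace[OF nuc])
        then show "(\<lambda>w. \<kappa> S * (stft f g w * op_trace (tf_op w o\<^sub>L S))) \<in> borel_measurable lborel"
          by (rule borel_measurable_integrable)
      qed
      show "AE w in lborel. (\<Sum>S\<in>I. \<kappa> S * (stft f g w * op_trace (tf_op w o\<^sub>L S))) = 0"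
        using zero
      proof eventually_elim
        case (elim w)
        have "(\<Sum>S\<in>I. \<kappa> S * (stft f g w * op_trace (tf_op w o\<^sub>L S))) =
            stft f g w * (\<Sum>S\<in>I. \<kappa> S * op_trace (tf_op w o\<^sub>L S))"
          by (simp add: sum_distrib_left mult.left_commute)
        then show ?case by (simp add: elim)
      qed
    qed simp
    finally show "cinner (\<Sum>S\<in>I. \<kappa> S *\<^sub>C blinfun_apply S g) f = cinner 0 f" by simp
  qed
  note zero_op = this
  have "((\<lambda>e. \<Sum>S\<in>I. \<kappa> S * cinner (blinfun_apply T (blinfun_apply S e)) e) has_sum
      (\<Sum>S\<in>I. \<kappa> S * op_trace (T o\<^sub>L S))) trace_basis"
    by (intro has_sum_finite_sum I has_sum_cmult_right trace_has_sum_basis[OF nuc T])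
  moreover have "(\<Sum>S\<in>I. \<kappa> S * cinner (blinfun_apply T (blinfun_apply S e)) e) = 0" for e
  proof -
    have "(\<Sum>S\<in>I. \<kappa> S * cinner (blinfun_apply T (blinfun_apply S e)) e) =
        cinner (blinfun_apply T (\<Sum>S\<in>I. \<kappa> S *\<^sub>C blinfun_apply S e)) e"
      by (simp add: blinfun.sum_right bounded_ops_cscale[OF T] cinner_sum_left cinner_cscale_left)
    then show ?thesis by (simp add: zero_op blinfun.zero_right)
  qed
  ultimately have "((\<lambda>e :: 'd L2. 0 :: complex) has_sum (\<Sum>S\<in>I. \<kappa> S * op_trace (T o\<^sub>L S))) trace_basis"
    by simp
  then show ?thesis by (metis has_sum_0_simp has_sum_unique)
qed

text \<open>Not only approximation but equality is possible on finitely many trace functionals: the values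
  attained on the range form a subspace, and \<open>trace_functionals_determined\<close> says that its
  annihilators annihilate the values of \<open>T\<close>.\<close>

lemma loc_range_interpolates:
  fixes \<phi>\<^sub>1 \<phi>\<^sub>2 :: "'d::finite L2"
  assumes nz: "AE w in lborel. stft \<phi>\<^sub>1 \<phi>\<^sub>2 w \<noteq> 0"
    and I: "finite I" "I \<subseteq> trace_class" and T: "T \<in> bounded_ops"
  shows "\<exists>A\<in>loc_range \<phi>\<^sub>1 \<phi>\<^sub>2. \<forall>S\<in>I. op_trace (A o\<^sub>L S) = op_trace (T o\<^sub>L S)"
proof -
  \<comment> \<open>Outside I the trace need not be additive in A, so those coordinates are set to zero.\<close>
  define t where "t A = (\<lambda>S. if S \<in> I then op_trace (A o\<^sub>L S) else 0)" for A :: "'d L2 \<Rightarrow>\<^sub>L 'd L2"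
  define R where "R = loc_range \<phi>\<^sub>1 \<phi>\<^sub>2"
  have R: "A \<in> bounded_ops" if "A \<in> R" for A
    using that loc_range_bounded unfolding R_def by blast
  have trace: "((\<lambda>e. cinner (blinfun_apply A (blinfun_apply S e)) e) has_sum op_trace (A o\<^sub>L S)) trace_basis"
    if "S \<in> I" "A \<in> R" for A S
  proof -
    from trace_class_nuclear[OF subsetD[OF I(2) that(1)]] obtain u v where "nuclear_rep S u v"
      by blast
    from trace_has_sum_basis[OF this R[OF that(2)]] show ?thesis .
  qed
  have trace_eqI: "op_trace (A o\<^sub>L S) = s"
    if "S \<in> I" "A \<in> R" "((\<lambda>e. cinner (blinfun_apply A (blinfun_apply S e)) e) has_sum s) trace_basis" for A S s
    using has_sum_unique[OF trace[OF that(1,2)] that(3)] .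
  have t_add: "(\<lambda>S. t A S + t B S) = t (A + B)" if "A \<in> R" "B \<in> R" for A B
  proof
    fix S
    have "A + B \<in> R" using that unfolding R_def by (rule loc_range_add)
    then show "t A S + t B S = t (A + B) S"
      using has_sum_add[OF trace[of S A] trace[of S B]] that trace_eqI[of S "A + B" "t A S + t B S"]
      by (simp add: t_def blinfun.add_left cinner_add_left)
  qed
  have t_scale: "(\<lambda>S. c * t A S) = t (scale_op c A)" if "A \<in> R" for A c
  proof
    fix S
    have "scale_op c A \<in> R" using that unfolding R_def by (rule loc_range_scale)
    then show "c * t A S = t (scale_op c A) S"
      using has_sum_cmult_right[OF trace[of S A], of c] that trace_eqI[of S "scale_op c A" "c * t A S"]
      by (simp add: t_def cinner_cscale_left)
  qed
  have zero_R: "0 \<in> R"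
    unfolding R_def by (rule loc_range_zero)
  have "\<exists>v\<in>t ` R. \<forall>S\<in>I. v S = op_trace (T o\<^sub>L S)"
  proof (rule finite_interpolation[OF I(1)])
    have "scale_op 0 (0 :: 'd L2 \<Rightarrow>\<^sub>L 'd L2) = 0"
      by (rule blinfun_eqI) simp
    then have "t 0 = (\<lambda>_. 0)"
      using t_scale[OF zero_R, of 0] by simp
    then show "(\<lambda>_. 0) \<in> t ` R"
      using zero_R by (intro image_eqI[of _ _ 0]) simp_all
    show "(\<lambda>S. v S + w S) \<in> t ` R" if "v \<in> t ` R" "w \<in> t ` R" for v w
      using that t_add loc_range_add[of _ \<phi>\<^sub>1 \<phi>\<^sub>2] unfolding R_def by fastforce
    show "(\<lambda>S. c * v S) \<in> t ` R" if "v \<in> t ` R" for c v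
      using that t_scale loc_range_scale[of _ \<phi>\<^sub>1 \<phi>\<^sub>2] unfolding R_def by fastforce
    fix \<kappa> :: "('d L2 \<Rightarrow>\<^sub>L 'd L2) \<Rightarrow> complex"
    assume *: "\<forall>v\<in>t ` R. (\<Sum>S\<in>I. \<kappa> S * v S) = 0"
    have "AE w in lborel. (\<Sum>S\<in>I. \<kappa> S * op_trace (tf_op w o\<^sub>L S)) = 0"
      using nz
    proof eventually_elim
      case (elim w)
      then have "(\<Sum>S\<in>I. \<kappa> S * t (tf_op w) S) = 0"
        using * tf_op_in_loc_range unfolding R_def by blast
      then show ?case by (simp add: t_def)
    qed
    then show "(\<Sum>S\<in>I. \<kappa> S * op_trace (T o\<^sub>L S)) = 0"
      by (rule trace_functionals_determined[OF I T])
  qed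
  then show ?thesis unfolding R_def by (auto simp: t_def)
qed

section \<open>Weak* density\<close>

lemma topology_generated_by_finite_Inter:
  assumes "openin (topology_generated_by \<S>) U" "x \<in> U"
  shows "\<exists>F. finite F \<and> F \<subseteq> \<S> \<and> F \<noteq> {} \<and> x \<in> \<Inter>F \<and> \<Inter>F \<subseteq> U"
proof -
  have "generate_topology_on \<S> U"
    using assms(1) by (simp add: openin_topology_generated_by_iff)
  then show ?thesis
    using assms(2)
  proof (induction rule: generate_topology_on.induct)
    case (Int a b)
    then obtain F G where "finite F" "F \<subseteq> \<S>" "F \<noteq> {}" "x \<in> \<Inter>F" "\<Inter>F \<subseteq> a"
      "finite G" "G \<subseteq> \<S>" "G \<noteq> {}" "x \<in> \<Inter>G" "\<Inter>G \<subseteq> b" by auto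
    then show ?case by (intro exI[of _ "F \<union> G"]) auto
  next
    case (UN K)
    then obtain k where k: "k \<in> K" "x \<in> k" by auto
    from UN.IH[OF k] obtain F where F: "finite F" "F \<subseteq> \<S>" "F \<noteq> {}" "x \<in> \<Inter>F" "\<Inter>F \<subseteq> k"
      by (elim exE conjE)
    have "\<Inter>F \<subseteq> \<Union>K"
      using F(5) Union_upper[OF k(1)] by (rule subset_trans)
    with F show ?case by (intro exI[of _ F] conjI)
  next
    case (Basis s)
    then show ?case by (intro exI[of _ "{s}"]) auto
  qed auto
qed

lemma zero_trace_class: "0 \<in> (trace_class :: ('d::finite L2 \<Rightarrow>\<^sub>L 'd L2) set)"
proof -
  obtain E :: "'d L2 set" where "is_onb E" using ex_onb by blast
  moreover have "is_abs_op (0 :: 'd L2 \<Rightarrow>\<^sub>L 'd L2) 0"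
    by (simp add: is_abs_op_def bounded_ops_def)
  ultimately show ?thesis
    unfolding trace_class_def
    by (intro CollectI conjI exI[of _ 0] exI[of _ E]) (auto simp: bounded_ops_def)
qed

text \<open>The subbasis has \<open>bounded_ops\<close> itself as a member, given by the zero operator; this operator is
  trace class because an orthonormal basis exists.\<close>

lemma topspace_weak_star: "topspace weak_star_topology = (bounded_ops :: ('d::finite L2 \<Rightarrow>\<^sub>L 'd L2) set)"
  unfolding weak_star_topology_def topology_generated_by_topspace
proof
  show "(bounded_ops :: ('d L2 \<Rightarrow>\<^sub>L 'd L2) set) \<subseteq>
      \<Union> {{T \<in> bounded_ops. op_trace (T o\<^sub>L S) \<in> U} |S U. S \<in> trace_class \<and> open U}"
    using zero_trace_class by (auto intro!: exI[of _ bounded_ops] exI[of _ 0] exI[of _ UNIV])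
qed auto

theorem theorem5p1:
  fixes \<phi>\<^sub>1 \<phi>\<^sub>2 :: "'d::finite L2"
  assumes "AE z in lborel. stft \<phi>\<^sub>1 \<phi>\<^sub>2 z \<noteq> 0"
  shows "weak_star_topology closure_of (loc_op \<phi>\<^sub>1 \<phi>\<^sub>2 ` Linfty) = bounded_ops"
proof
  show "weak_star_topology closure_of (loc_op \<phi>\<^sub>1 \<phi>\<^sub>2 ` Linfty) \<subseteq> bounded_ops"
    using closure_of_subset_topspace topspace_weak_star by metis
  show "bounded_ops \<subseteq> weak_star_topology closure_of (loc_op \<phi>\<^sub>1 \<phi>\<^sub>2 ` Linfty)"
  proof
    fix T :: "'d L2 \<Rightarrow>\<^sub>L 'd L2" assume T: "T \<in> bounded_ops"
    have "\<exists>A. A \<in> loc_op \<phi>\<^sub>1 \<phi>\<^sub>2 ` Linfty \<and> A \<in> W"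
      if W: "T \<in> W" "openin weak_star_topology W" for W
    proof -
      obtain F where F: "finite F" "T \<in> \<Inter>F" "\<Inter>F \<subseteq> W"
        and sub: "F \<subseteq> {{T \<in> bounded_ops. op_trace (T o\<^sub>L S) \<in> U} |S U. S \<in> trace_class \<and> open U}"
        using topology_generated_by_finite_Inter[OF W(2)[unfolded weak_star_topology_def] W(1)] by blast
      have "\<forall>X\<in>F. \<exists>S. S \<in> trace_class \<and> (\<exists>U. X = {T \<in> bounded_ops. op_trace (T o\<^sub>L S) \<in> U})"
        using sub by blast
      then have "\<exists>\<sigma>. \<forall>X\<in>F. \<sigma> X \<in> trace_class \<and>
          (\<exists>U. X = {T \<in> bounded_ops. op_trace (T o\<^sub>L \<sigma> X) \<in> U})"
        by (rule bchoice)
      then obtain \<sigma> where \<sigma>: "\<forall>X\<in>F. \<sigma> X \<in> trace_class \<and>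
          (\<exists>U. X = {T \<in> bounded_ops. op_trace (T o\<^sub>L \<sigma> X) \<in> U})"
        by (elim exE)
      then have "\<sigma> ` F \<subseteq> trace_class" by auto
      from loc_range_interpolates[OF assms finite_imageI[OF F(1)] this T]
      obtain A where A: "A \<in> loc_range \<phi>\<^sub>1 \<phi>\<^sub>2"
        and eq: "\<forall>S\<in>\<sigma> ` F. op_trace (A o\<^sub>L S) = op_trace (T o\<^sub>L S)"
        by (elim bexE)
      have "A \<in> Y" if "Y \<in> F" for Y
      proof -
        from bspec[OF \<sigma> that]
        obtain U where Y: "Y = {T \<in> bounded_ops. op_trace (T o\<^sub>L \<sigma> Y) \<in> U}"
          by (elim conjE exE)
        have "T \<in> Y" using F(2) that by auto
        then have "op_trace (T o\<^sub>L \<sigma> Y) \<in> U"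
          by (subst (asm) Y) simp
        then have "op_trace (A o\<^sub>L \<sigma> Y) \<in> U"
          using eq that by simp
        moreover have "A \<in> bounded_ops"
          using A loc_range_bounded by (rule_tac subsetD)
        ultimately show ?thesis by (subst Y) simp
      qed
      then have "A \<in> W" using F(3) by blast
      then show ?thesis using A loc_range_subset_image by blast
    qed
    then show "T \<in> weak_star_topology closure_of (loc_op \<phi>\<^sub>1 \<phi>\<^sub>2 ` Linfty)"
      using T topspace_weak_star by (auto simp: in_closure_of)
  qed
qed

end
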